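(* Let $e\ge2$, $m\in\mathbb Z/e\mathbb Z$, and $\lambda\in B(\Lambda_m)$. Then $\mathrm{base}(\lambda)=\mathrm{floor}(\lambda)$.
   Context: Fix $e\ge2$; $\mathfrak g=\mathfrak g(A^{(1)}_{e-1})$ with fundamental weights $\Lambda_i$, $i\in\mathbb Z/e\mathbb Z$. Partitions. A partition is $\lambda=(\lambda_0\ge\lambda_1\ge\cdots)$, nonnegative integers, finitely many nonzero; it is $e$-restricted if $\lambda_k-\lambda_{k+1}<e$ for all $k\ge0$. For an integer charge $m$ (a representative of the class $m$), the set of beta numbers of $\lambda$ is $J=\{j_0>j_1>\cdots\}$, $j_k=\lambda_k+m-k$. $\lambda$ and $J$ determine each other, and operations on one are transported to the other. Base. Put $U(J)=\{x\in J\mid x-e\notin J\}$. If $U(J)=\emptyset$ (i.e. $\lambda$ is an $e$-core), $\mathrm{down}(J)=J$. Otherwise let $p'=\min U(J)$, $W(J)=\{x>p'-e\mid x\in J,\ x+e\notin J\}\cup\{p'\}$, $q'=\min W(J)$, and $\mathrm{down}(J)=(J\setminus\{q'\})\cup\{p'-e\}$. The operation preserves $e$-restrictedness and iterating it reaches an $e$-core after finitely many steps; this $e$-core is $\mathrm{base}(\lambda)$. Crystal. $B(\Lambda_m)$ is realized as the set of $e$-restricted partitions; the node in row $a$, column $b$ (counted from $0$) has residue $m-a+b\bmod e$. Read addable $i$-nodes ($A$) and removable $i$-nodes ($R$) from the first row to the last; repeatedly delete pairs $R\,A$ ($R$ left of $A$, nothing undeleted between) until the form $A\cdots AR\cdots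 R$; $\tilde f_i\lambda$ adds the node of the rightmost remaining $A$ (or is $0$), $\tilde e_i\lambda$ removes the node of the leftmost remaining $R$ (or is $0$). On $B(\Lambda_m)^{\otimes h}$ use the same rule for the concatenation of the $A/R$ sequences of the tensor factors read from the last factor to the first factor. Floor. For $h\ge1$ let $S_h:B(\Lambda_m)\to B(h\Lambda_m)\subset B(\Lambda_m)^{\otimes h}$ be the unique crystal morphism of amplitude $h$: it multiplies $wt,\epsilon_i,\varphi_i$ by $h$ and satisfies $S_h(\tilde e_i b)=\tilde e_i^hS_h(b)$, $S_h(\tilde f_ib)=\tilde f_i^hS_h(b)$; in particular $S_h(\emptyset)=\emptyset^{\otimes h}$. Here $B(h\Lambda_m)$ is the component of $\emptyset^{\otimes h}$. It is known that for all sufficiently divisible $h$ all tensor factors of $S_h(\lambda)$ are $e$-cores and $S_h(\lambda)=\nu_1^{\otimes a_1h}\otimes\nu_2^{\otimes(a_2-a_1)h}\otimes\cdots\otimes\nu_s^{\otimes(1-a_{s-1})h}$ with rational numbers $0<a_1<\cdots<a_{s-1}<1$ and pairwise distinct $e$-cores $\nu_1,\dots,\nu_s$ independent of $h$. Then $\mathrm{floor}(\lambda):=\nu_s$ (the last tensor factor). *)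

theory Defs
  imports Complex_Main "HOL-Library.FuncSet"
begin

section \<open>Partitions and beta numbers\<close>

definition is_partition :: "(nat \<Rightarrow> nat) \<Rightarrow> bool" where
  "is_partition l \<longleftrightarrow> antimono l \<and> finite {k. l k \<noteq> 0}"

text \<open>The carrier of \<open>B(\<Lambda>\<^sub>m)\<close>. It does not depend on \<open>m\<close>; only the residues of the nodes do.\<close>

definition restricted_partitions :: "nat \<Rightarrow> (nat \<Rightarrow> nat) set" where
  "restricted_partitions e = {l. is_partition l \<and> (\<forall>k. l k - l (Suc k) < e)}"

definition empty_partition :: "nat \<Rightarrow> nat" where
  "empty_partition = (\<lambda>_. 0)"

definition beta :: "int \<Rightarrow> (nat \<Rightarrow> nat) \<Rightarrow> int set" where
  "beta m l = range (\<lambda>k. int (l k) + m - int k)"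

definition partition_of_beta :: "int \<Rightarrow> int set \<Rightarrow> (nat \<Rightarrow> nat)" where
  "partition_of_beta m J = (THE l. is_partition l \<and> beta m l = J)"

section \<open>The base\<close>

definition U_set :: "nat \<Rightarrow> int set \<Rightarrow> int set" where
  "U_set e J = {x \<in> J. x - int e \<notin> J}"

definition is_core :: "nat \<Rightarrow> int \<Rightarrow> (nat \<Rightarrow> nat) \<Rightarrow> bool" where
  "is_core e m l \<longleftrightarrow> is_partition l \<and> U_set e (beta m l) = {}"

definition W_set :: "nat \<Rightarrow> int set \<Rightarrow> int set" where
  "W_set e J =
     (let p = Min (U_set e J) in {x. x > p - int e \<and> x \<in> J \<and> x + int e \<notin> J} \<union> {p})"

definition down :: "nat \<Rightarrow> int set \<Rightarrow> int set" where
  "down e J =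
     (if U_set e J = {} then J
      else (J - {Min (W_set e J)}) \<union> {Min (U_set e J) - int e})"

definition beta_base :: "nat \<Rightarrow> int set \<Rightarrow> int set" where
  "beta_base e J = (down e ^^ (LEAST n. U_set e ((down e ^^ n) J) = {})) J"

definition partition_base :: "nat \<Rightarrow> int \<Rightarrow> (nat \<Rightarrow> nat) \<Rightarrow> (nat \<Rightarrow> nat)" where
  "partition_base e m l = partition_of_beta m (beta_base e (beta m l))"

section \<open>Signatures\<close>

definition res :: "nat \<Rightarrow> int \<Rightarrow> nat \<Rightarrow> nat \<Rightarrow> int" where
  "res e m a b = (m - int a + int b) mod int e"

definition addable :: "nat \<Rightarrow> int \<Rightarrow> int \<Rightarrow> (nat \<Rightarrow> nat) \<Rightarrow> nat \<Rightarrow> bool" where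
  "addable e m i l a \<longleftrightarrow> (a = 0 \<or> l a < l (a - 1)) \<and> res e m a (l a) = i mod int e"

definition removable :: "nat \<Rightarrow> int \<Rightarrow> int \<Rightarrow> (nat \<Rightarrow> nat) \<Rightarrow> nat \<Rightarrow> bool" where
  "removable e m i l a \<longleftrightarrow> l (Suc a) < l a \<and> res e m a (l a - 1) = i mod int e"

datatype node_sign = Addable | Removable

text \<open>The letters of a signature carry the position of their node. For \<open>e \<ge> 2\<close> a row cannot
  contain both an addable and a removable \<open>i\<close>-node, and below the first zero row there is
  neither, so it suffices to inspect the rows up to that row.\<close>

definition signature :: "nat \<Rightarrow> int \<Rightarrow> int \<Rightarrow> (nat \<Rightarrow> nat) \<Rightarrow> (node_sign \<times> nat) list" where
  "signature e m i l =
     concat (map (\<lambda>a. (if addable e m i l a then [(Addable, a)] else []) @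
                      (if removable e m i l a then [(Removable, a)] else []))
       [0..<Suc (card {k. l k \<noteq> 0})])"

text \<open>An element of a tensor power is the list of its factors, first factor at index \<open>0\<close>;
  a node is given by the index of its factor and its row.\<close>

definition tensor_signature ::
    "nat \<Rightarrow> int \<Rightarrow> int \<Rightarrow> (nat \<Rightarrow> nat) list \<Rightarrow> (node_sign \<times> (nat \<times> nat)) list" where
  "tensor_signature e m i bs =
     concat (map (\<lambda>k. map (\<lambda>(s, a). (s, (k, a))) (signature e m i (bs ! k)))
       (rev [0..<length bs]))"

text \<open>Deletion of all pairs \<open>R A\<close>: if the reduced tail still starts with an \<open>A\<close>,
  an \<open>R\<close> put in front of it is deleted together with that \<open>A\<close>.\<close>

fun cancel :: "(node_sign \<times> 'p) list \<Rightarrow> (node_sign \<times> 'p) list" where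
  "cancel [] = []"
| "cancel (x # xs) =
     (case cancel xs of
        [] \<Rightarrow> [x]
      | y # ys \<Rightarrow> if fst x = Removable \<and> fst y = Addable then ys else x # y # ys)"

definition rightmost_addable :: "(node_sign \<times> 'p) list \<Rightarrow> 'p option" where
  "rightmost_addable ws =
     (case filter (\<lambda>w. fst w = Addable) (cancel ws) of
        [] \<Rightarrow> None | v # vs \<Rightarrow> Some (snd (last (v # vs))))"

definition leftmost_removable :: "(node_sign \<times> 'p) list \<Rightarrow> 'p option" where
  "leftmost_removable ws =
     (case filter (\<lambda>w. fst w = Removable) (cancel ws) of
        [] \<Rightarrow> None | v # vs \<Rightarrow> Some (snd v))"

section \<open>Crystal operators\<close>

text \<open>The value \<open>None\<close> plays the role of the element \<open>0\<close> outside the crystal.\<close>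

definition add_node :: "nat \<Rightarrow> (nat \<Rightarrow> nat) \<Rightarrow> (nat \<Rightarrow> nat)" where
  "add_node a l = l(a := l a + 1)"

definition remove_node :: "nat \<Rightarrow> (nat \<Rightarrow> nat) \<Rightarrow> (nat \<Rightarrow> nat)" where
  "remove_node a l = l(a := l a - 1)"

definition f_op :: "nat \<Rightarrow> int \<Rightarrow> int \<Rightarrow> (nat \<Rightarrow> nat) \<Rightarrow> (nat \<Rightarrow> nat) option" where
  "f_op e m i l =
     map_option (\<lambda>a. add_node a l) (rightmost_addable (signature e m i l))"

definition e_op :: "nat \<Rightarrow> int \<Rightarrow> int \<Rightarrow> (nat \<Rightarrow> nat) \<Rightarrow> (nat \<Rightarrow> nat) option" where
  "e_op e m i l =
     map_option (\<lambda>a. remove_node a l) (leftmost_removable (signature e m i l))"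

definition f_tensor ::
    "nat \<Rightarrow> int \<Rightarrow> int \<Rightarrow> (nat \<Rightarrow> nat) list \<Rightarrow> (nat \<Rightarrow> nat) list option" where
  "f_tensor e m i bs =
     map_option (\<lambda>(k, a). bs[k := add_node a (bs ! k)])
       (rightmost_addable (tensor_signature e m i bs))"

definition e_tensor ::
    "nat \<Rightarrow> int \<Rightarrow> int \<Rightarrow> (nat \<Rightarrow> nat) list \<Rightarrow> (nat \<Rightarrow> nat) list option" where
  "e_tensor e m i bs =
     map_option (\<lambda>(k, a). bs[k := remove_node a (bs ! k)])
       (leftmost_removable (tensor_signature e m i bs))"

definition iter :: "('b \<Rightarrow> 'b option) \<Rightarrow> nat \<Rightarrow> 'b \<Rightarrow> 'b option" where
  "iter g n b = ((\<lambda>x. Option.bind x g) ^^ n) (Some b)"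

text \<open>The functions \<open>\<epsilon>\<^sub>i\<close> and \<open>\<phi>\<^sub>i\<close> are obtained by taking for \<open>g\<close> the operator
  \<open>e\<^sub>i\<close> or \<open>f\<^sub>i\<close>.\<close>

definition string_length :: "('b \<Rightarrow> 'b option) \<Rightarrow> 'b \<Rightarrow> nat" where
  "string_length g b = Max {n. iter g n b \<noteq> None}"

section \<open>Weights\<close>

text \<open>A weight is recorded by its values on the basis of the Cartan subalgebra consisting of the
  simple coroots \<open>h\<^sub>j\<close> (here \<open>Coroot j\<close>, with \<open>j\<close> read modulo \<open>e\<close>) and the scaling element \<open>d\<close>,
  where \<open>\<Lambda>\<^sub>i(h\<^sub>j) = \<delta>\<^sub>i\<^sub>j\<close>, \<open>\<Lambda>\<^sub>i(d) = 0\<close>, \<open>\<alpha>\<^sub>i(d) = \<delta>\<^sub>i\<^sub>0\<close>. The value \<open>\<alpha>\<^sub>i(h\<^sub>j)\<close> is \<open>cartan e j i\<close>,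
  which is \<open>-2\<close> for \<open>e = 2\<close>, \<open>i \<noteq> j\<close>. The weight of a partition is \<open>\<Lambda>\<^sub>m\<close> minus the sum of the
  \<open>\<alpha>\<^sub>i\<close> over the residues \<open>i\<close> of its nodes.\<close>

datatype cartan_basis = Coroot int | Scaling

definition cartan :: "nat \<Rightarrow> int \<Rightarrow> int \<Rightarrow> int" where
  "cartan e j i =
     2 * of_bool (j mod int e = i mod int e)
     - of_bool (j mod int e = (i + 1) mod int e)
     - of_bool (j mod int e = (i - 1) mod int e)"

definition content :: "nat \<Rightarrow> int \<Rightarrow> (nat \<Rightarrow> nat) \<Rightarrow> int \<Rightarrow> nat" where
  "content e m l i = card {(a, b). b < l a \<and> res e m a b = i mod int e}"

fun wt :: "nat \<Rightarrow> int \<Rightarrow> (nat \<Rightarrow> nat) \<Rightarrow> cartan_basis \<Rightarrow> int" where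
  "wt e m l (Coroot j) =
     of_bool (j mod int e = m mod int e)
     - (\<Sum>i\<in>{0..<int e}. int (content e m l i) * cartan e j i)"
| "wt e m l Scaling = - int (content e m l 0)"

definition wt_tensor :: "nat \<Rightarrow> int \<Rightarrow> (nat \<Rightarrow> nat) list \<Rightarrow> cartan_basis \<Rightarrow> int" where
  "wt_tensor e m bs x = (\<Sum>b\<leftarrow>bs. wt e m b x)"

section \<open>The morphism of amplitude h and the floor\<close>

definition tensor_power :: "nat \<Rightarrow> nat \<Rightarrow> (nat \<Rightarrow> nat) list set" where
  "tensor_power e h = {bs. length bs = h \<and> set bs \<subseteq> restricted_partitions e}"

text \<open>\<open>B(h\<Lambda>\<^sub>m)\<close>, the connected component of the tensor power of the empty partition.\<close>

definition highest_component :: "nat \<Rightarrow> int \<Rightarrow> nat \<Rightarrow> (nat \<Rightarrow> nat) list set" where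
  "highest_component e m h =
     {bs. (replicate h empty_partition, bs) \<in>
        {(x, y). x \<in> tensor_power e h \<and> y \<in> tensor_power e h \<and>
           (\<exists>i. f_tensor e m i x = Some y \<or> e_tensor e m i x = Some y)}\<^sup>*}"

definition amplitude_morphism ::
    "nat \<Rightarrow> int \<Rightarrow> nat \<Rightarrow> ((nat \<Rightarrow> nat) \<Rightarrow> (nat \<Rightarrow> nat) list) \<Rightarrow> bool" where
  "amplitude_morphism e m h S \<longleftrightarrow>
     S \<in> restricted_partitions e \<rightarrow> highest_component e m h \<and>
     (\<forall>b\<in>restricted_partitions e.
        (\<forall>x. wt_tensor e m (S b) x = int h * wt e m b x) \<and>
        (\<forall>i. string_length (e_tensor e m i) (S b) = h * string_length (e_op e m i) b \<and>
             string_length (f_tensor e m i) (S b) = h * string_length (f_op e m i) b \<and>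
             map_option S (e_op e m i b) = iter (e_tensor e m i) h (S b) \<and>
             map_option S (f_op e m i b) = iter (f_tensor e m i) h (S b)))"

text \<open>Extensionality fixes the irrelevant values outside \<open>B(\<Lambda>\<^sub>m)\<close>, so that the unique
  crystal morphism is also unique as a HOL function.\<close>

definition S_map :: "nat \<Rightarrow> int \<Rightarrow> nat \<Rightarrow> (nat \<Rightarrow> nat) \<Rightarrow> (nat \<Rightarrow> nat) list" where
  "S_map e m h =
     (THE S. S \<in> extensional (restricted_partitions e) \<and> amplitude_morphism e m h S)"

text \<open>The stable shape of \<open>S\<^sub>h(\<lambda>)\<close>: the factor \<open>\<nu>\<^sub>k\<close> is repeated \<open>(a\<^sub>k - a\<^sub>k\<^sub>-\<^sub>1) h\<close> times, with
  \<open>a\<^sub>0 = 0\<close> and \<open>a\<^sub>s = 1\<close>, for all \<open>h \<ge> 1\<close> divisible by some fixed \<open>N \<ge> 1\<close>. In particular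
  these multiplicities are integers for such \<open>h\<close>.\<close>

definition stable_form ::
    "nat \<Rightarrow> int \<Rightarrow> (nat \<Rightarrow> nat) \<Rightarrow> nat \<Rightarrow> (nat \<Rightarrow> rat) \<Rightarrow> (nat \<Rightarrow> (nat \<Rightarrow> nat)) \<Rightarrow> bool" where
  "stable_form e m l s a \<nu> \<longleftrightarrow>
     1 \<le> s \<and> a 0 = 0 \<and> a s = 1 \<and> (\<forall>k<s. a k < a (Suc k)) \<and>
     inj_on \<nu> {1..s} \<and> (\<forall>k\<in>{1..s}. is_core e m (\<nu> k)) \<and>
     (\<exists>N\<ge>1. \<forall>h\<ge>1. N dvd h \<longrightarrow>
        (\<exists>n :: nat \<Rightarrow> nat.
           (\<forall>k\<in>{1..s}. of_nat (n k) = (a k - a (k - 1)) * of_nat h) \<and>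
           S_map e m h l = concat (map (\<lambda>k. replicate (n k) (\<nu> k)) [1..<Suc s])))"

definition partition_floor :: "nat \<Rightarrow> int \<Rightarrow> (nat \<Rightarrow> nat) \<Rightarrow> (nat \<Rightarrow> nat)" where
  "partition_floor e m l = (THE c. \<exists>s a \<nu>. stable_form e m l s a \<nu> \<and> c = \<nu> s)"

end

theory Submission
  imports Defs "HOL-Library.Product_Lexorder" "HOL-Library.Multiset"
begin

text \<open>The morphism \<open>S\<^sub>h\<close> is constructed on \<open>h\<close>-tuples of bead sets, whose sites are read position by
  position through all components. If all components equal the beta numbers of \<open>\<lambda>\<close>, then \<open>h\<close>
  applications of \<open>f\<^sub>i\<close> act once on every component; if the charges of the components are far apart,
  the same rule is that of the tensor product. Exchanging neighbouring charges bead by bead and rotating the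
  components commute with all \<open>f\<^sub>i\<close> and lead from the first charge vector to the second, so the
  relations between words in the \<open>f\<^sub>i\<close> carry over.

  The base is obtained by attaching the beads of \<open>\<lambda>\<close> one after the other, from the smallest, to a core.
  Processing the first row of \<open>\<lambda>\<close> last shows by induction on the number of rows that the base of \<open>f\<^sub>i \<lambda>\<close>
  is the base of \<open>\<lambda>\<close> if \<open>\<phi>\<^sub>i(\<lambda>) \<ge> 2\<close>, and arises from it by adding all addable \<open>i\<close>-nodes if
  \<open>\<phi>\<^sub>i(\<lambda>) = 1\<close>. The last factor of \<open>S\<^sub>h(\<lambda>)\<close> obeys the same rule: \<open>f\<^sub>i\<^sup>h\<close> replaces cores by cores with
  all addable \<open>i\<close>-nodes added, beginning with the first factors, and reaches the last one only if it
  exhausts \<open>\<phi>\<^sub>i(S\<^sub>h(\<lambda>)) = h \<phi>\<^sub>i(\<lambda>)\<close>.\<close>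

section \<open>Signature words\<close>

text \<open>The tensor product rule gives no access to the fact on which \<open>S_map\<close> rests:
  a relation between words in the operators, applied to the empty partition, survives when every
  letter is repeated \<open>h\<close> times and the words act on the vacuum of the tensor power. On
  \<open>h\<close> equal bead sets it is evident. It can be carried away from there because moving a
  bead inside a component and passing it to the next component are two commuting rules, each a
  cancellation of the same kind, along rows and along columns. Exchanges merely permute the charges;
  the rotation, which adds \<open>e\<close> to one of them, is what separates them. Uniqueness of
  the morphism comes down to the image of the empty partition, which is determined by its weight. On
  the other side, \<open>down\<close> selects beads by minima over the whole set, which does not fit
  an induction on rows. Attaching single beads does, and its effect on the addition of
  \<open>i\<close>-nodes is governed by the residue of the bead. Cores matter in the tensor product
  because they never have addable and removable \<open>i\<close>-nodes together, so nothing cancels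
  inside a block of equal cores.\<close>

definition phi_word :: "(node_sign \<times> 'p) list \<Rightarrow> nat" where
  "phi_word w = length (filter (\<lambda>x. fst x = Addable) (cancel w))"

definition eps_word :: "(node_sign \<times> 'p) list \<Rightarrow> nat" where
  "eps_word w = length (filter (\<lambda>x. fst x = Removable) (cancel w))"

text \<open>Adding the node \<open>p\<close> turns its \<open>A\<close> into an \<open>R\<close> and
  leaves the other letters of the same residue alone; see \<open>signature_add_node\<close> and
  \<open>tensor_signature_add_node\<close>.\<close>

definition flip_at :: "'p \<Rightarrow> (node_sign \<times> 'p) list \<Rightarrow> (node_sign \<times> 'p) list" where
  "flip_at p = map (\<lambda>(s, q). (if q = p then Removable else s, q))"

lemma node_sign_not [simp]: "s \<noteq> Addable \<longleftrightarrow> s = Removable" "s \<noteq> Removable \<longleftrightarrow> s = Addable"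
  by (cases s; simp)+

text \<open>This is the reduced form \<open>A...AR...R\<close>. It lets the first surviving letter
  decide whether any \<open>A\<close> survives at all.\<close>

lemma sorted_cancel:
  "sorted_wrt (\<lambda>x y. fst x = Removable \<longrightarrow> fst y = Removable) (cancel w)"
proof (induction w)
  case IH: (Cons z w)
  show ?case
  proof (cases "cancel w")
    case (Cons y ys)
    then show ?thesis using IH by (cases "fst z"; cases "fst y") auto
  qed simp
qed simp

lemma cancel_head_Removable:
  "cancel w = x # xs \<Longrightarrow> fst x = Removable \<Longrightarrow> \<forall>y\<in>set xs. fst y = Removable"
  using sorted_cancel[of w] by auto

lemma phi_word_Nil [simp]: "phi_word [] = 0" and eps_word_Nil [simp]: "eps_word [] = 0"
  by (simp_all add: phi_word_def eps_word_def)

lemma phi_word_0_cancel: "phi_word w = 0 \<longleftrightarrow> (\<forall>y\<in>set (cancel w). fst y = Removable)"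
  by (simp add: phi_word_def filter_empty_conv)

lemma phi_word_0_hd:
  assumes "cancel w = y # ys"
  shows "phi_word w = 0 \<longleftrightarrow> fst y = Removable"
  using cancel_head_Removable[OF assms] assms by (auto simp: phi_word_0_cancel)

lemma phi_word_Addable [simp]: "phi_word ((Addable, p) # w) = Suc (phi_word w)"
  and eps_word_Addable [simp]: "eps_word ((Addable, p) # w) = eps_word w"
  by (cases "cancel w"; simp add: phi_word_def eps_word_def)+

text \<open>\<open>cancel\<close> works from the right, so a new first letter meets a word that is
  already reduced. An \<open>R\<close> uses up one surviving \<open>A\<close> if there is one; the
  truncated subtraction covers the other case.\<close>

lemma phi_word_Removable [simp]: "phi_word ((Removable, p) # w) = phi_word w - 1"
proof (cases "cancel w")
  case (Cons y ys)
  then show ?thesis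
    using phi_word_0_hd[OF Cons] by (auto simp: phi_word_def)
qed (simp add: phi_word_def)

lemma eps_word_Removable [simp]:
  "eps_word ((Removable, p) # w) = (if phi_word w = 0 then Suc (eps_word w) else eps_word w)"
proof (cases "cancel w")
  case (Cons y ys)
  then show ?thesis
    using phi_word_0_hd[OF Cons] by (auto simp: eps_word_def)
qed (auto simp: phi_word_def eps_word_def)

lemma rightmost_addable_Nil [simp]: "rightmost_addable [] = None"
  and leftmost_removable_Nil [simp]: "leftmost_removable [] = None"
  by (simp_all add: rightmost_addable_def leftmost_removable_def)

lemma rightmost_addable_eq_None: "rightmost_addable w = None \<longleftrightarrow> phi_word w = 0"
  by (auto simp: rightmost_addable_def phi_word_def split: list.splits)

lemma leftmost_removable_eq_None: "leftmost_removable w = None \<longleftrightarrow> eps_word w = 0"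
  by (auto simp: leftmost_removable_def eps_word_def split: list.splits)

lemma rightmost_addable_alt:
  "rightmost_addable w = (let as = filter (\<lambda>x. fst x = Addable) (cancel w) in
     if as = [] then None else Some (snd (last as)))"
  by (auto simp: rightmost_addable_def Let_def split: list.splits)

lemma rightmost_addable_Addable [simp]:
  "rightmost_addable ((Addable, p) # w) =
     (if phi_word w = 0 then Some p else rightmost_addable w)"
  by (cases "cancel w") (auto simp: rightmost_addable_alt phi_word_def Let_def)

text \<open>A leading \<open>R\<close> takes the leftmost surviving \<open>A\<close>. This is the
  rightmost one only if no other is left, which explains the bound 1.\<close>

lemma rightmost_addable_Removable [simp]:
  "rightmost_addable ((Removable, p) # w) =
     (if phi_word w \<le> 1 then None else rightmost_addable w)"
proof (cases "cancel w")
  case (Cons y ys)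
  then show ?thesis
    using phi_word_0_hd[OF Cons] cancel_head_Removable[OF Cons]
    by (auto simp: rightmost_addable_alt phi_word_def Let_def filter_empty_conv)
qed (auto simp: rightmost_addable_alt phi_word_def)

lemma leftmost_removable_Addable [simp]:
  "leftmost_removable ((Addable, p) # w) = leftmost_removable w"
  by (cases "cancel w") (auto simp: leftmost_removable_def)

lemma leftmost_removable_Removable [simp]:
  "leftmost_removable ((Removable, p) # w) =
     (if phi_word w = 0 then Some p else leftmost_removable w)"
proof (cases "cancel w")
  case (Cons y ys)
  then show ?thesis
    using phi_word_0_hd[OF Cons] by (auto simp: leftmost_removable_def)
qed (auto simp: leftmost_removable_def phi_word_def)

lemma word_induct [case_names Nil Addable Removable]:
  assumes "P []" "\<And>p w. P w \<Longrightarrow> P ((Addable, p) # w)" "\<And>p w. P w \<Longrightarrow> P ((Removable, p) # w)"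
  shows "P w"
proof (induction w)
  case (Cons x w)
  then show ?case using assms(2,3) by (cases x; cases "fst x") auto
qed (rule assms(1))

text \<open>The tensor product rule in terms of counts: surviving \<open>R\<close>s of
  \<open>u\<close> and surviving \<open>A\<close>s of \<open>v\<close> cancel each other, and
  nothing else is affected.\<close>

lemma phi_word_append: "phi_word (u @ v) = phi_word u + (phi_word v - eps_word u)"
  and eps_word_append: "eps_word (u @ v) = eps_word v + (eps_word u - phi_word v)"
proof -
  have "phi_word (u @ v) = phi_word u + (phi_word v - eps_word u) \<and>
        eps_word (u @ v) = eps_word v + (eps_word u - phi_word v)"
    by (induction u rule: word_induct) auto
  then show "phi_word (u @ v) = phi_word u + (phi_word v - eps_word u)"
    "eps_word (u @ v) = eps_word v + (eps_word u - phi_word v)" by auto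
qed

lemma rightmost_addable_append:
  "rightmost_addable (u @ v) =
     (if eps_word u < phi_word v then rightmost_addable v else rightmost_addable u)"
proof (induction u rule: word_induct)
  case Nil
  show ?case using rightmost_addable_eq_None[of v] by auto
qed (auto simp: phi_word_append)

lemma word_map [simp]:
  "phi_word (map (apsnd g) w) = phi_word w"
  "eps_word (map (apsnd g) w) = eps_word w"
  "rightmost_addable (map (apsnd g) w) = map_option g (rightmost_addable w)"
  "leftmost_removable (map (apsnd g) w) = map_option g (leftmost_removable w)"
proof -
  have *: "phi_word (map (apsnd g) w) = phi_word w" for w
    by (induction w rule: word_induct) auto
  show "phi_word (map (apsnd g) w) = phi_word w" by (fact *)
  show "eps_word (map (apsnd g) w) = eps_word w"
    by (induction w rule: word_induct) (auto simp: *)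
  show "rightmost_addable (map (apsnd g) w) = map_option g (rightmost_addable w)"
    by (induction w rule: word_induct) (auto simp: *)
  show "leftmost_removable (map (apsnd g) w) = map_option g (leftmost_removable w)"
    by (induction w rule: word_induct) (auto simp: *)
qed

lemma rightmost_addable_in: "rightmost_addable w = Some p \<Longrightarrow> (Addable, p) \<in> set w"
  by (induction w rule: word_induct) (auto split: if_splits)

lemma leftmost_removable_in: "leftmost_removable w = Some p \<Longrightarrow> (Removable, p) \<in> set w"
  by (induction w rule: word_induct) (auto split: if_splits)

lemma flip_at_Nil [simp]: "flip_at p [] = []"
  and flip_at_Cons [simp]:
    "flip_at p ((s, q) # w) = (if q = p then Removable else s, q) # flip_at p w"
  by (simp_all add: flip_at_def)

lemma flip_at_append [simp]: "flip_at p (u @ v) = flip_at p u @ flip_at p v"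
  by (simp add: flip_at_def)

lemma flip_at_notin: "p \<notin> snd ` set w \<Longrightarrow> flip_at p w = w"
  by (induction w) (auto simp: flip_at_def)

text \<open>The flipped letter is the last \<open>A\<close> of the reduced word, so no cancellation
  changes and the reduced word stays sorted. Distinct labels ensure that only this letter is
  flipped.\<close>

lemma phi_eps_flip_at:
  assumes "distinct (map snd w)" "rightmost_addable w = Some p"
  shows "Suc (phi_word (flip_at p w)) = phi_word w \<and> eps_word (flip_at p w) = Suc (eps_word w)"
  using assms
proof (induction w rule: word_induct)
  case (Addable q w)
  show ?case
  proof (cases "phi_word w = 0")
    case True
    then show ?thesis using Addable flip_at_notin[of q w] by auto
  next
    case False
    then have "rightmost_addable w = Some p" using Addable by simp
    moreover from this have "p \<noteq> q" using rightmost_addable_in Addable(2) by force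
    ultimately show ?thesis using Addable by auto
  qed
next
  case (Removable q w)
  then have "rightmost_addable w = Some p" by (auto split: if_splits)
  moreover from this have "p \<noteq> q" using rightmost_addable_in Removable(2) by force
  ultimately show ?case using Removable by (auto split: if_splits)
qed auto

text \<open>Because of this equivalence \<open>e_op\<close> and \<open>f_op\<close>, and likewise
  their tensor versions, are inverse to each other: the letter flipped by one is the letter found by
  the other.\<close>

lemma leftmost_removable_flip_at:
  assumes "distinct (map snd w)" "(Addable, p) \<in> set w"
  shows "leftmost_removable (flip_at p w) = Some p \<longleftrightarrow> rightmost_addable w = Some p"
  using assms
proof (induction w rule: word_induct)
  case (Addable q w)
  show ?case
  proof (cases "q = p")
    case True
    then have "p \<notin> snd ` set w" using Addable.prems by auto
    then show ?thesis
      using True flip_at_notin[of p w] rightmost_addable_in[of w p] leftmost_removable_in[of w p]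
      by force
  next
    case False
    then show ?thesis using Addable rightmost_addable_eq_None[of w] by auto
  qed
next
  case (Removable q w)
  then have "q \<noteq> p" by force
  then show ?case
    using Removable phi_eps_flip_at[of w p] by auto
qed auto

text \<open>Seen from outside, a block is characterised by its two counts. Hence two words whose
  blocks have equal counts act in the same block, and only the action inside it remains to be
  compared.\<close>

lemma blocks_rightmost_addable:
  assumes "\<And>t. t \<in> set ts \<Longrightarrow> phi_word (B t) = phi_word (B' t) \<and> eps_word (B t) = eps_word (B' t)"
  shows "phi_word (concat (map B ts)) = phi_word (concat (map B' ts)) \<and>
    eps_word (concat (map B ts)) = eps_word (concat (map B' ts)) \<and>
    (phi_word (concat (map B ts)) = 0 \<or>
     (\<exists>t\<in>set ts. 0 < phi_word (B t) \<and>
        rightmost_addable (concat (map B ts)) = rightmost_addable (B t) \<and>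
        rightmost_addable (concat (map B' ts)) = rightmost_addable (B' t)))"
  using assms
proof (induction ts)
  case (Cons t ts)
  let ?w = "concat (map B ts)" and ?w' = "concat (map B' ts)"
  have IH: "phi_word ?w = phi_word ?w'" "eps_word ?w = eps_word ?w'"
    "phi_word ?w = 0 \<or> (\<exists>t\<in>set ts. 0 < phi_word (B t) \<and>
        rightmost_addable ?w = rightmost_addable (B t) \<and>
        rightmost_addable ?w' = rightmost_addable (B' t))"
    using Cons by auto
  have t: "phi_word (B t) = phi_word (B' t)" "eps_word (B t) = eps_word (B' t)"
    using Cons.prems by auto
  show ?case
  proof (cases "eps_word (B t) < phi_word ?w")
    case True
    then show ?thesis using IH t
      by (auto simp: phi_word_append eps_word_append rightmost_addable_append)
  next
    case False
    then show ?thesis using IH(1,2) t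
      by (auto simp: phi_word_append eps_word_append rightmost_addable_append)
  qed
qed simp

section \<open>Partitions and tensor products\<close>

definition rows :: "(nat \<Rightarrow> nat) \<Rightarrow> nat" where
  "rows l = card {k. l k \<noteq> 0}"

definition tail :: "(nat \<Rightarrow> nat) \<Rightarrow> nat \<Rightarrow> nat" where
  "tail l = (\<lambda>k. l (Suc k))"

lemma tail_apply [simp]: "tail l k = l (Suc k)"
  by (simp add: tail_def)

lemma is_partitionD: "is_partition l \<Longrightarrow> a \<le> b \<Longrightarrow> l b \<le> l a"
  by (auto simp: is_partition_def antimono_def)

lemma is_partition_Suc: "is_partition l \<Longrightarrow> l (Suc a) \<le> l a"
  by (rule is_partitionD) auto

lemma support_partition:
  assumes "is_partition l"
  shows "{k. l k \<noteq> 0} = {..<rows l}"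
proof -
  let ?S = "{k. l k \<noteq> 0}"
  have fin: "finite ?S" using assms by (simp add: is_partition_def)
  show ?thesis
  proof (cases "?S = {}")
    case False
    define M where "M = Max ?S"
    have "?S = {..M}"
    proof (intro equalityI subsetI)
      fix k assume "k \<in> {..M}"
      moreover have "l M \<noteq> 0" using Max_in[OF fin False] by (simp add: M_def)
      ultimately show "k \<in> ?S" using is_partitionD[OF assms, of k M] by auto
    next
      fix k assume "k \<in> ?S"
      then show "k \<in> {..M}" using Max_ge[OF fin] unfolding M_def by blast
    qed
    then show ?thesis unfolding rows_def by (simp only: card_atMost lessThan_Suc_atMost)
  qed (simp add: rows_def)
qed

lemma partition_eq_0_iff:
  assumes "is_partition l" shows "l k = 0 \<longleftrightarrow> rows l \<le> k"
proof -
  have "k \<in> {k. l k \<noteq> 0} \<longleftrightarrow> k \<in> {..<rows l}" by (simp only: support_partition[OF assms])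
  then show ?thesis by auto
qed

lemma is_partition_iff: "is_partition l \<longleftrightarrow> antimono l \<and> (\<exists>k. l k = 0)"
proof
  assume *: "antimono l \<and> (\<exists>k. l k = 0)"
  then obtain n where "l n = 0" by auto
  then have "k < n" if "l k \<noteq> 0" for k
    using * that by (metis antimonoD le_zero_eq linorder_not_le)
  then have "{k. l k \<noteq> 0} \<subseteq> {..<n}" by auto
  then show "is_partition l" using * finite_subset by (auto simp: is_partition_def)
next
  assume "is_partition l"
  then show "antimono l \<and> (\<exists>k. l k = 0)"
    using partition_eq_0_iff[of l "rows l"] unfolding is_partition_def by blast
qed

lemma is_partition_tail:
  assumes "is_partition l" shows "is_partition (tail l)"
  unfolding is_partition_iff
proof
  show "antimono (tail l)"
    by (rule decseq_SucI) (simp add: is_partition_Suc[OF assms])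
  show "\<exists>k. tail l k = 0"
    using partition_eq_0_iff[OF assms] by (intro exI[of _ "rows l"]) auto
qed

lemma rows_tail:
  assumes "is_partition l" shows "rows (tail l) = rows l - 1"
proof -
  have "{k. tail l k \<noteq> 0} = {..<rows l - 1}"
    using partition_eq_0_iff[OF assms] by auto
  then show ?thesis by (simp add: rows_def)
qed

lemma is_partition_empty [simp]: "is_partition empty_partition"
  by (simp add: is_partition_def empty_partition_def antimono_def)

lemma restricted_is_partition: "l \<in> restricted_partitions e \<Longrightarrow> is_partition l"
  by (simp add: restricted_partitions_def)

lemma restricted_tail: "l \<in> restricted_partitions e \<Longrightarrow> tail l \<in> restricted_partitions e"
  by (auto simp: restricted_partitions_def is_partition_tail)

lemma partition_rows_0: "is_partition l \<Longrightarrow> rows l = 0 \<Longrightarrow> l = empty_partition"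
  by (auto simp: partition_eq_0_iff empty_partition_def)

text \<open>Deleting the first row goes with lowering the charge by one: the rows below then keep
  their residues and their beta numbers.\<close>

lemma partition_induct [consumes 1, case_names empty Cons]:
  fixes m :: int
  assumes "is_partition l"
    and "\<And>m. P empty_partition m"
    and "\<And>l m. is_partition l \<Longrightarrow> l 0 > 0 \<Longrightarrow> P (tail l) (m - 1) \<Longrightarrow> P l m"
  shows "P l m"
  using assms(1)
proof (induction "rows l" arbitrary: l m)
  case 0
  then show ?case using partition_rows_0[of l] assms(2) by simp
next
  case (Suc n l m)
  have "P (tail l) (m - 1)"
    using Suc(1)[of "tail l"] Suc(2,3) rows_tail is_partition_tail by simp
  moreover have "0 < l 0" using Suc(2,3) partition_eq_0_iff[of l 0] by simp
  ultimately show ?case using assms(3) Suc(3) by simp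
qed

section \<open>The signature of a partition and of its tail\<close>

definition row_word :: "nat \<Rightarrow> int \<Rightarrow> int \<Rightarrow> (nat \<Rightarrow> nat) \<Rightarrow> nat \<Rightarrow> (node_sign \<times> nat) list" where
  "row_word e m i l a =
     (if addable e m i l a then [(Addable, a)] else []) @
     (if removable e m i l a then [(Removable, a)] else [])"

lemma row_word_empty:
  assumes "is_partition l" "rows l < a" shows "row_word e m i l a = []"
proof -
  have "l a = 0" "l (a - 1) = 0" "a \<noteq> 0" using partition_eq_0_iff[OF assms(1)] assms(2) by auto
  then show ?thesis by (simp add: row_word_def addable_def removable_def)
qed

text \<open>The number of inspected rows is made free, since partitions with different numbers of
  rows are compared later, such as \<open>l\<close> and \<open>add_node a l\<close>.\<close>

lemma signature_eq:
  assumes "is_partition l" "rows l < n"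
  shows "signature e m i l = concat (map (row_word e m i l) [0..<n])"
proof -
  have "[0..<n] = [0..<Suc (rows l)] @ [Suc (rows l)..<n]"
    using assms(2) upt_add_eq_append[of 0 "Suc (rows l)" "n - Suc (rows l)"] by simp
  moreover have "concat (map (row_word e m i l) [Suc (rows l)..<n]) = []"
    using row_word_empty[OF assms(1)] by auto
  ultimately show ?thesis
    by (simp add: signature_def row_word_def[abs_def] rows_def del: upt_Suc)
qed

lemma mod_int_neq:
  assumes "e \<ge> 2"
  shows "(x + 1) mod int e \<noteq> x mod int e" "(x - 1) mod int e \<noteq> x mod int e"
    "x mod int e \<noteq> (x + 1) mod int e" "x mod int e \<noteq> (x - 1) mod int e"
proof -
  have *: "(x + 1) mod int e \<noteq> x mod int e" for x
  proof
    assume "(x + 1) mod int e = x mod int e"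
    then have "int e dvd 1" using mod_eq_dvd_iff[of "x + 1" "int e" x] by simp
    then show False using assms by simp
  qed
  show "(x + 1) mod int e \<noteq> x mod int e" "(x - 1) mod int e \<noteq> x mod int e"
    "x mod int e \<noteq> (x + 1) mod int e" "x mod int e \<noteq> (x - 1) mod int e"
    using *[of x] *[of "x - 1"] by auto
qed

lemma removable_res: "removable e m i l a \<longleftrightarrow>
   l (Suc a) < l a \<and> (m - int a + int (l a) - 1) mod int e = i mod int e"
  by (auto simp: removable_def res_def of_nat_diff algebra_simps)

lemma addable_res: "addable e m i l a \<longleftrightarrow>
   (a = 0 \<or> l a < l (a - 1)) \<and> (m - int a + int (l a)) mod int e = i mod int e"
  by (auto simp: addable_def res_def)

lemma not_addable_removable:
  assumes "e \<ge> 2" "addable e m i l a" shows "\<not> removable e m i l a"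
  using assms mod_int_neq(2)[of e "m - int a + int (l a)"]
  by (auto simp: addable_res removable_res)

lemma row_word_tail:
  "row_word e m i l (Suc (Suc a)) = map (apsnd Suc) (row_word e (m - 1) i (tail l) (Suc a))"
  by (auto simp: row_word_def addable_res removable_res algebra_simps)

definition tail_word where
  "tail_word e m i l = map (apsnd Suc) (signature e (m - 1) i (tail l))"

text \<open>Deleting the first row creates an addable node in the next one if both have the same
  length. If that node has residue \<open>i\<close>, the tail has an extra \<open>A\<close>; in all
  other cases the words differ by the letter of the first row.\<close>

lemma signature_tail:
  assumes "is_partition l" "e \<ge> 2"
  shows "if l 1 = l 0 \<and> (m - 1 + int (l 0)) mod int e = i mod int e
     then tail_word e m i l = (Addable, 1) # signature e m i l
     else signature e m i l = row_word e m i l 0 @ tail_word e m i l"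
proof -
  let ?n = "rows l" and ?t = "tail l"
  let ?T = "concat (map (\<lambda>a. row_word e m i l (Suc (Suc a))) [0..<?n])"
  have part: "is_partition ?t" by (rule is_partition_tail[OF assms(1)])
  have "[0..<Suc (Suc ?n)] = 0 # 1 # map (\<lambda>a. Suc (Suc a)) [0..<?n]"
    by (rule nth_equalityI) (auto simp: nth_Cons nth_append split: nat.split)
  then have s: "signature e m i l = row_word e m i l 0 @ row_word e m i l 1 @ ?T"
    using signature_eq[OF assms(1), of "Suc (Suc ?n)" e m i] by (simp add: comp_def del: upt_Suc)
  have "[0..<Suc ?n] = 0 # map Suc [0..<?n]"
    by (rule nth_equalityI) (auto simp: nth_Cons nth_append split: nat.split)
  moreover have "rows ?t < Suc ?n" using rows_tail[OF assms(1)] by simp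
  ultimately have "signature e (m - 1) i ?t =
      row_word e (m - 1) i ?t 0 @ concat (map (\<lambda>a. row_word e (m - 1) i ?t (Suc a)) [0..<?n])"
    using signature_eq[OF part, of "Suc ?n" e "m - 1" i] by (simp add: comp_def del: upt_Suc)
  then have t: "tail_word e m i l = map (apsnd Suc) (row_word e (m - 1) i ?t 0) @ ?T"
    by (simp add: tail_word_def row_word_tail map_concat comp_def)
  have "l 1 \<le> l 0" by (rule is_partitionD[OF assms(1)]) simp
  then show ?thesis
    unfolding s t using mod_int_neq[OF assms(2), of "m - 1 + int (l 0)"]
      mod_int_neq[OF assms(2), of "m - 2 + int (l 0)"]
    by (auto simp: row_word_def addable_res removable_res algebra_simps)
qed

lemma signature_step_addable:
  assumes "is_partition l" "e \<ge> 2" "(m + int (l 0)) mod int e = i mod int e"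
  shows "signature e m i l = (Addable, 0) # tail_word e m i l"
  using signature_tail[OF assms(1,2), of m i] assms(3)
    mod_int_neq[OF assms(2), of "m + int (l 0)"]
  by (auto simp: row_word_def addable_res removable_res algebra_simps split: if_splits)

text \<open>A first row whose bead is congruent to \<open>i + 1\<close> acts like a leading
  \<open>R\<close> even if its last node is not removable, that is, if the next row has the same
  length. In that case the tail has an extra leading \<open>A\<close>, and deleting this
  \<open>A\<close> has the same effect on all four quantities as putting an \<open>R\<close> in
  front of it.\<close>

lemma signature_step_removable:
  fixes m :: int
  assumes "is_partition l" "e \<ge> 2" "(m + int (l 0) - 1) mod int e = i mod int e"
  defines "w \<equiv> signature e m i l" and "t \<equiv> tail_word e m i l"
  shows "phi_word w = phi_word t - 1"
    "eps_word w = (if phi_word t = 0 then Suc (eps_word t) else eps_word t)"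
    "rightmost_addable w = (if phi_word t \<le> 1 then None else rightmost_addable t)"
    "leftmost_removable w = (if phi_word t = 0 then Some 0 else leftmost_removable t)"
proof -
  have "l 1 \<le> l 0" by (rule is_partitionD[OF assms(1)]) simp
  then have "(if l 1 = l 0 then t = (Addable, 1) # w else w = (Removable, 0) # t)"
    using signature_tail[OF assms(1,2), of m i] assms(3)
      mod_int_neq[OF assms(2), of "m + int (l 0) - 1"]
    unfolding w_def t_def
    by (auto simp: row_word_def addable_res removable_res algebra_simps split: if_splits)
  then show "phi_word w = phi_word t - 1"
    "eps_word w = (if phi_word t = 0 then Suc (eps_word t) else eps_word t)"
    "rightmost_addable w = (if phi_word t \<le> 1 then None else rightmost_addable t)"
    "leftmost_removable w = (if phi_word t = 0 then Some 0 else leftmost_removable t)"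
    using rightmost_addable_eq_None[of w] by (auto split: if_splits)
qed

lemma signature_step_neutral:
  assumes "is_partition l" "e \<ge> 2" "(m + int (l 0)) mod int e \<noteq> i mod int e"
    "(m + int (l 0) - 1) mod int e \<noteq> i mod int e"
  shows "signature e m i l = tail_word e m i l"
  using signature_tail[OF assms(1,2), of m i] assms(3,4)
  by (auto simp: row_word_def addable_res removable_res algebra_simps split: if_splits)

lemma tail_word_simps [simp]:
  "phi_word (tail_word e m i l) = phi_word (signature e (m - 1) i (tail l))"
  "eps_word (tail_word e m i l) = eps_word (signature e (m - 1) i (tail l))"
  "rightmost_addable (tail_word e m i l) =
     map_option Suc (rightmost_addable (signature e (m - 1) i (tail l)))"
  "leftmost_removable (tail_word e m i l) =
     map_option Suc (leftmost_removable (signature e (m - 1) i (tail l)))"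
  by (simp_all add: tail_word_def)

lemma signature_empty:
  "signature e m i empty_partition = (if m mod int e = i mod int e then [(Addable, 0)] else [])"
  by (simp add: signature_def addable_res removable_res empty_partition_def)

lemma set_signature:
  assumes "is_partition l"
  shows "(s, a) \<in> set (signature e m i l) \<longleftrightarrow>
    (s = Addable \<and> addable e m i l a \<or> s = Removable \<and> removable e m i l a)"
proof -
  define n where "n = Suc (max a (rows l))"
  have n: "rows l < n" "a < n" by (auto simp: n_def)
  have "(s, a) \<in> set (row_word e m i l b) \<longleftrightarrow> a = b \<and>
    (s = Addable \<and> addable e m i l a \<or> s = Removable \<and> removable e m i l a)" for b
    by (auto simp: row_word_def)
  then show ?thesis unfolding signature_eq[OF assms n(1)] using n(2) by auto
qed

lemma sorted_concat_upt:
  assumes "\<And>a. sorted_wrt R (g a)" "\<And>a b x y. a < b \<Longrightarrow> x \<in> set (g a) \<Longrightarrow> y \<in> set (g b) \<Longrightarrow> R x y"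
  shows "sorted_wrt R (concat (map g [0..<n]))"
  by (induction n) (use assms in \<open>auto simp: sorted_wrt_append\<close>)

lemma sorted_signature:
  assumes "is_partition l" "e \<ge> 2"
  shows "sorted_wrt (\<lambda>x y. snd x < snd y) (signature e m i l)"
proof -
  have "sorted_wrt (\<lambda>x y. snd x < snd y) (row_word e m i l a)" for a
    using not_addable_removable[OF assms(2), of m i l a] by (auto simp: row_word_def)
  moreover have "snd x < snd y" if "a < b" "x \<in> set (row_word e m i l a)"
    "y \<in> set (row_word e m i l b)" for a b x y
    using that by (auto simp: row_word_def split: if_splits)
  ultimately show ?thesis
    unfolding signature_eq[OF assms(1) lessI] by (rule sorted_concat_upt)
qed

lemma distinct_signature:
  assumes "is_partition l" "e \<ge> 2"
  shows "distinct (map snd (signature e m i l))"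
proof -
  have "sorted_wrt (<) (map snd (signature e m i l))"
    unfolding sorted_wrt_map by (rule sorted_signature[OF assms])
  then show ?thesis unfolding strict_sorted_iff by simp
qed

section \<open>Adding and removing a node\<close>

lemma is_partition_add_node:
  assumes "is_partition l" "addable e m i l a"
  shows "is_partition (add_node a l)"
  unfolding is_partition_iff
proof
  show "antimono (add_node a l)"
  proof (rule decseq_SucI)
    fix k
    show "add_node a l (Suc k) \<le> add_node a l k"
      using is_partition_Suc[OF assms(1), of k] assms(2) by (auto simp: add_node_def addable_def)
  qed
  show "\<exists>k. add_node a l k = 0"
    using partition_eq_0_iff[OF assms(1)]
    by (intro exI[of _ "Suc a + rows l"]) (auto simp: add_node_def)
qed

text \<open>Outside row \<open>a\<close> the new node can only block a removal in the row above or
  enable an addition in the row below. The nodes concerned have residue \<open>i + 1\<close> and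
  \<open>i - 1\<close>, which differ from \<open>i\<close> because \<open>e \<ge> 2\<close>.\<close>

lemma row_word_add_node:
  assumes "is_partition l" "e \<ge> 2" "addable e m i l a"
  shows "row_word e m i (add_node a l) b = flip_at a (row_word e m i l b)"
proof -
  let ?r = "m - int a + int (l a)" and ?l = "add_node a l"
  have r: "?r mod int e = i mod int e" and a: "a = 0 \<or> l a < l (a - 1)"
    using assms(3) by (auto simp: addable_res)
  have r': "(?r + 1) mod int e \<noteq> i mod int e" "(?r - 1) mod int e \<noteq> i mod int e"
    using mod_int_neq[OF assms(2), of ?r] r by auto
  have l: "?l a = Suc (l a)" "b \<noteq> a \<Longrightarrow> ?l b = l b" for b by (auto simp: add_node_def)
  show ?thesis
  proof (cases "b = a")
    case True
    have "m - int a + int (?l a) = ?r + 1" by (simp add: l)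
    then have "(m - int a + int (?l a)) mod int e \<noteq> i mod int e" using r' by (simp only: simp_thms)
    then have "\<not> addable e m i ?l a" unfolding addable_res by blast
    moreover have "m - int a + int (?l a) - 1 = ?r" by (simp add: l)
    then have "(m - int a + int (?l a) - 1) mod int e = i mod int e" using r by (simp only:)
    then have "removable e m i ?l a"
      using is_partition_Suc[OF assms(1), of a] unfolding removable_res
      by (simp add: l less_Suc_eq_le)
    ultimately show ?thesis
      using assms(3) not_addable_removable[OF assms(2,3)] True by (simp add: row_word_def)
  next
    case False
    have "addable e m i ?l b = addable e m i l b"
    proof (cases "b = Suc a \<and> l b = l a")
      case True
      then have "b = Suc a" "l b = l a" by blast+
      then have "m - int b + int (l b) = ?r - 1" by (metis add_diff_eq diff_add_eq diff_diff_eq of_nat_Suc add.commute)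
      then have "(m - int b + int (l b)) mod int e \<noteq> i mod int e" using r' by (simp only: simp_thms)
      then show ?thesis using \<open>b \<noteq> a\<close> by (simp add: addable_res l)
    next
      case F: False
      have "?l b < ?l (b - 1) \<longleftrightarrow> l b < l (b - 1)" if "b \<noteq> 0"
        using that F \<open>b \<noteq> a\<close> l is_partition_Suc[OF assms(1), of a]
        by (cases "b = Suc a") (auto simp: l)
      then show ?thesis using \<open>b \<noteq> a\<close> l by (auto simp: addable_res)
    qed
    moreover have "removable e m i ?l b = removable e m i l b"
    proof (cases "Suc b = a \<and> l b = Suc (l a)")
      case True
      then have "m - int b + int (l b) - 1 = ?r + 1" by auto
      then have "(m - int b + int (l b) - 1) mod int e \<noteq> i mod int e" using r' by (simp only: simp_thms)
      then show ?thesis using \<open>b \<noteq> a\<close> by (simp add: removable_res l)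
    next
      case F: False
      have "?l (Suc b) < ?l b \<longleftrightarrow> l (Suc b) < l b"
        using F \<open>b \<noteq> a\<close> l a by (cases "Suc b = a") auto
      then show ?thesis using \<open>b \<noteq> a\<close> l by (auto simp: removable_res)
    qed
    ultimately show ?thesis using False by (simp add: row_word_def)
  qed
qed

lemma signature_add_node:
  assumes "is_partition l" "e \<ge> 2" "addable e m i l a"
  shows "signature e m i (add_node a l) = flip_at a (signature e m i l)"
proof -
  let ?n = "Suc (max (rows l) (rows (add_node a l)))"
  have "flip_at a (concat xs) = concat (map (flip_at a) xs)" for xs :: "(node_sign \<times> nat) list list"
    by (induction xs) auto
  moreover have "row_word e m i (add_node a l) = (\<lambda>b. flip_at a (row_word e m i l b))"
    by (rule ext) (rule row_word_add_node[OF assms])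
  ultimately show ?thesis
    using signature_eq[OF assms(1), of ?n e m i]
      signature_eq[OF is_partition_add_node[OF assms(1,3)], of ?n e m i]
    by (simp add: comp_def del: upt_Suc)
qed

lemma remove_node:
  assumes "is_partition l" "removable e m i l a" "e \<ge> 2"
  shows "is_partition (remove_node a l)" "add_node a (remove_node a l) = l"
    "addable e m i (remove_node a l) a"
proof -
  have pos: "l (Suc a) < l a" using assms(2) by (simp add: removable_def)
  show "add_node a (remove_node a l) = l" using pos by (auto simp: add_node_def remove_node_def)
  show "is_partition (remove_node a l)"
    unfolding is_partition_iff
  proof
    show "antimono (remove_node a l)"
    proof (rule decseq_SucI)
      fix k
      show "remove_node a l (Suc k) \<le> remove_node a l k"
        using is_partition_Suc[OF assms(1), of k] pos by (auto simp: remove_node_def)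
    qed
    show "\<exists>k. remove_node a l k = 0"
      using partition_eq_0_iff[OF assms(1)]
      by (intro exI[of _ "Suc a + rows l"]) (auto simp: remove_node_def)
  qed
  have "a = 0 \<or> l a \<le> l (a - 1)" using is_partition_Suc[OF assms(1), of "a - 1"] by (cases a) auto
  then show "addable e m i (remove_node a l) a"
    using assms(2) pos
    by (auto simp: addable_res removable_res remove_node_def of_nat_diff algebra_simps)
qed

lemma f_opE:
  assumes "is_partition l" "e \<ge> 2" "f_op e m i l = Some l'"
  obtains a where "rightmost_addable (signature e m i l) = Some a" "addable e m i l a"
    "l' = add_node a l" "is_partition l'" "signature e m i l' = flip_at a (signature e m i l)"
proof -
  obtain a where a: "rightmost_addable (signature e m i l) = Some a" "l' = add_node a l"
    using assms(3) by (auto simp: f_op_def)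
  then have "addable e m i l a"
    using rightmost_addable_in[OF a(1)] set_signature[OF assms(1)] by auto
  then show ?thesis
    using that a is_partition_add_node[OF assms(1)] signature_add_node[OF assms(1,2)] by auto
qed

lemma e_op_iff_f_op:
  assumes "is_partition l" "e \<ge> 2" "is_partition l'"
  shows "e_op e m i l = Some l' \<longleftrightarrow> f_op e m i l' = Some l"
proof
  assume "f_op e m i l' = Some l"
  from f_opE[OF assms(3,2) this] obtain a where
    a: "rightmost_addable (signature e m i l') = Some a" "addable e m i l' a"
    "l = add_node a l'" "signature e m i l = flip_at a (signature e m i l')" by metis
  have "leftmost_removable (signature e m i l) = Some a"
    unfolding a(4) leftmost_removable_flip_at[OF distinct_signature[OF assms(3,2)]
      rightmost_addable_in[OF a(1)]] by (rule a(1))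
  moreover have "remove_node a l = l'" by (auto simp: a(3) remove_node_def add_node_def)
  ultimately show "e_op e m i l = Some l'" by (simp add: e_op_def)
next
  assume "e_op e m i l = Some l'"
  then obtain a where a: "leftmost_removable (signature e m i l) = Some a" "l' = remove_node a l"
    by (auto simp: e_op_def)
  have "removable e m i l a"
    using leftmost_removable_in[OF a(1)] set_signature[OF assms(1)] by auto
  note r = remove_node[OF assms(1) this assms(2), folded a(2)]
  have "signature e m i l = flip_at a (signature e m i l')"
    using signature_add_node[OF r(1) assms(2) r(3)] r(2) by simp
  moreover have "(Addable, a) \<in> set (signature e m i l')"
    using r(3) set_signature[OF r(1)] by auto
  ultimately have "rightmost_addable (signature e m i l') = Some a"
    using leftmost_removable_flip_at[OF distinct_signature[OF r(1) assms(2)]] a(1) by metis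
  then show "f_op e m i l' = Some l" using r(2) by (simp add: f_op_def)
qed

lemma e_op_partition:
  assumes "is_partition l" "e \<ge> 2" "e_op e m i l = Some l'"
  shows "is_partition l'"
proof -
  obtain a where a: "leftmost_removable (signature e m i l) = Some a" "l' = remove_node a l"
    using assms(3) by (auto simp: e_op_def)
  have "removable e m i l a"
    using leftmost_removable_in[OF a(1)] set_signature[OF assms(1)] by auto
  then show ?thesis using remove_node[OF assms(1) _ assms(2)] a(2) by auto
qed

lemma rightmost_addable_signature_0:
  assumes "is_partition l" "e \<ge> 2" "rightmost_addable (signature e m i l) = Some 0"
  shows "(m + int (l 0)) mod int e = i mod int e"
    "phi_word (signature e (m - 1) i (tail l)) = 0"
proof -
  have 1: "(m + int (l 0)) mod int e = i mod int e"
    using rightmost_addable_in[OF assms(3)] set_signature[OF assms(1)] by (auto simp: addable_res)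
  show "(m + int (l 0)) mod int e = i mod int e" by (rule 1)
  show "phi_word (signature e (m - 1) i (tail l)) = 0"
    using assms(3) signature_step_addable[OF assms(1,2) 1] by (auto split: if_splits)
qed

lemma rightmost_addable_signature_Suc:
  assumes "is_partition l" "e \<ge> 2" "rightmost_addable (signature e m i l) = Some (Suc a)"
  shows "rightmost_addable (signature e (m - 1) i (tail l)) = Some a"
proof -
  consider "(m + int (l 0)) mod int e = i mod int e" | "(m + int (l 0) - 1) mod int e = i mod int e"
    | "(m + int (l 0)) mod int e \<noteq> i mod int e" "(m + int (l 0) - 1) mod int e \<noteq> i mod int e"
    by blast
  then show ?thesis
  proof cases
    case 1
    then show ?thesis using assms(3) signature_step_addable[OF assms(1,2)] by (auto split: if_splits)
  next
    case 2
    then show ?thesis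
      using assms(3) signature_step_removable(3)[OF assms(1,2)] by (auto split: if_splits)
  next
    case 3
    then show ?thesis using assms(3) signature_step_neutral[OF assms(1,2)] by auto
  qed
qed

lemma leftmost_removable_signature_Suc:
  assumes "is_partition l" "e \<ge> 2" "leftmost_removable (signature e m i l) = Some (Suc a)"
  shows "leftmost_removable (signature e (m - 1) i (tail l)) = Some a"
    "(m + int (l 0) - 1) mod int e = i mod int e \<Longrightarrow> phi_word (signature e (m - 1) i (tail l)) \<noteq> 0"
proof -
  consider "(m + int (l 0)) mod int e = i mod int e" | "(m + int (l 0) - 1) mod int e = i mod int e"
    | "(m + int (l 0)) mod int e \<noteq> i mod int e" "(m + int (l 0) - 1) mod int e \<noteq> i mod int e"
    by blast
  then show "leftmost_removable (signature e (m - 1) i (tail l)) = Some a"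
  proof cases
    case 1
    then show ?thesis using assms(3) signature_step_addable[OF assms(1,2)] by auto
  next
    case 2
    then show ?thesis
      using assms(3) signature_step_removable(4)[OF assms(1,2)] by (auto split: if_splits)
  next
    case 3
    then show ?thesis using assms(3) signature_step_neutral[OF assms(1,2)] by auto
  qed
  show "phi_word (signature e (m - 1) i (tail l)) \<noteq> 0"
    if "(m + int (l 0) - 1) mod int e = i mod int e"
    using assms(3) signature_step_removable(4)[OF assms(1,2) that] by (auto split: if_splits)
qed

section \<open>Restricted partitions form a connected crystal\<close>

lemma restricted_iff:
  "l \<in> restricted_partitions e \<longleftrightarrow>
     is_partition l \<and> l 0 - l 1 < e \<and> tail l \<in> restricted_partitions e"
  by (auto simp: restricted_partitions_def is_partition_tail)
     (metis One_nat_def not0_implies_Suc)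

lemma restricted_empty: "e \<ge> 1 \<Longrightarrow> empty_partition \<in> restricted_partitions e"
  by (simp add: restricted_partitions_def) (simp add: empty_partition_def)

text \<open>The only danger is a first row that grows although \<open>l 0 - l 1 = e - 1\<close>. But
  then the first row of the tail has an addable node of the same residue, so an \<open>A\<close>
  survives in the tail, further to the right, and the operator does not act on row 0.\<close>

lemma f_op_restricted:
  assumes "l \<in> restricted_partitions e" "e \<ge> 2" "f_op e m i l = Some l'"
  shows "l' \<in> restricted_partitions e"
  using restricted_is_partition[OF assms(1)] assms
proof (induction l m arbitrary: l' rule: partition_induct)
  case (empty m)
  then have "l' = add_node 0 empty_partition"
    by (auto simp: f_op_def signature_empty split: if_splits)
  moreover have "is_partition l'" using f_opE[OF is_partition_empty assms(2)] empty by metis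
  moreover have "add_node 0 empty_partition k - add_node 0 empty_partition (Suc k) < e" for k
    using assms(2) by (simp add: add_node_def empty_partition_def)
  ultimately show ?case by (simp add: restricted_partitions_def)
next
  case (Cons l m)
  from Cons.prems have R: "l \<in> restricted_partitions e" by simp
  obtain a where a: "rightmost_addable (signature e m i l) = Some a" "l' = add_node a l" "is_partition l'"
    using f_opE[OF Cons(1) assms(2)] Cons.prems by metis
  show ?case
  proof (cases a)
    case 0
    note s = rightmost_addable_signature_0[OF Cons(1) assms(2) a(1)[unfolded 0]]
    have "l 0 - l 1 \<noteq> e - 1"
    proof
      assume "l 0 - l 1 = e - 1"
      then have "int (l 0) = int (l 1) + int e - 1" using assms(2) by linarith
      then have "m + int (l 0) = m - 1 + int (tail l 0) + int e" by simp
      then have "(m - 1 + int (tail l 0)) mod int e = i mod int e"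
        using s(1) by (simp only: mod_add_self2)
      then show False
        using s(2) signature_step_addable[OF is_partition_tail[OF Cons(1)] assms(2)] by simp
    qed
    moreover have "tail l' = tail l" by (auto simp: a 0 add_node_def tail_def)
    moreover have "l' 0 = Suc (l 0)" "l' 1 = l 1" by (auto simp: a 0 add_node_def)
    ultimately show ?thesis using R a(3) restricted_iff[of l e] restricted_iff[of l' e] by auto
  next
    case (Suc b)
    have "f_op e (m - 1) i (tail l) = Some (add_node b (tail l))"
      using rightmost_addable_signature_Suc[OF Cons(1) assms(2) a(1)[unfolded Suc]]
      by (simp add: f_op_def)
    moreover have "tail l' = add_node b (tail l)" by (auto simp: a Suc add_node_def tail_def)
    ultimately have "tail l' \<in> restricted_partitions e"
      using Cons R assms(2) restricted_tail by metis
    moreover have "l' 0 = l 0" "l 1 \<le> l' 1" by (auto simp: a Suc add_node_def)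
    ultimately show ?thesis using R a(3) restricted_iff[of l e] restricted_iff[of l' e] by auto
  qed
qed

text \<open>Here the danger is a node taken from row 1 while \<open>l 0 - l 1 = e - 1\<close>, so
  that both beads are congruent to \<open>i + 1\<close>. Row 1 is chosen only if no \<open>A\<close>
  survives below it, and then nothing is left that could cancel the \<open>R\<close> of row 0, which
  would have been chosen instead.\<close>

lemma e_op_restricted:
  assumes "l \<in> restricted_partitions e" "e \<ge> 2" "e_op e m i l = Some l'"
  shows "l' \<in> restricted_partitions e"
  using restricted_is_partition[OF assms(1)] assms
proof (induction l m arbitrary: l' rule: partition_induct)
  case (empty m)
  then show ?case by (auto simp: e_op_def signature_empty split: if_splits)
next
  case (Cons l m)
  from Cons.prems have R: "l \<in> restricted_partitions e" by simp
  obtain a where a: "leftmost_removable (signature e m i l) = Some a" "l' = remove_node a l"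
    using Cons.prems(3) by (auto simp: e_op_def)
  have part: "is_partition l'" using e_op_partition[OF Cons(1) assms(2)] Cons.prems by blast
  show ?case
  proof (cases a)
    case 0
    have "tail l' = tail l" by (auto simp: a 0 remove_node_def tail_def)
    moreover have "l' 0 = l 0 - 1" "l' 1 = l 1" by (auto simp: a 0 remove_node_def)
    ultimately show ?thesis using R part restricted_iff[of l e] restricted_iff[of l' e] by auto
  next
    case (Suc b)
    note s = leftmost_removable_signature_Suc[OF Cons(1) assms(2) a(1)[unfolded Suc]]
    have "e_op e (m - 1) i (tail l) = Some (remove_node b (tail l))" using s by (simp add: e_op_def)
    moreover have t: "tail l' = remove_node b (tail l)" by (auto simp: a Suc remove_node_def tail_def)
    ultimately have R': "tail l' \<in> restricted_partitions e"
      using Cons R assms(2) restricted_tail by metis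
    have "l 0 - l' 1 < e"
    proof (rule ccontr)
      assume *: "\<not> l 0 - l' 1 < e"
      have "l 0 - l 1 < e" using R restricted_iff[of l e] by simp
      then have b: "b = 0" and l1: "l 1 > 0" "l 0 = l 1 + e - 1"
        using * by (auto simp: a Suc remove_node_def split: if_splits)
      have "removable e (m - 1) i (tail l) 0"
        using leftmost_removable_in[OF s(1)] set_signature[OF is_partition_tail[OF Cons(1)]] b by auto
      then have r: "(m - 1 + int (tail l 0) - 1) mod int e = i mod int e"
        by (simp add: removable_res)
      have "m + int (l 0) - 1 = m - 1 + int (tail l 0) - 1 + int e"
        using l1 assms(2) by simp
      then have "(m + int (l 0) - 1) mod int e = (m - 1 + int (tail l 0) - 1) mod int e"
        by (simp only: mod_add_self2)
      then have "phi_word (signature e (m - 1) i (tail l)) \<noteq> 0" using r s(2) by simp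
      then show False
        using s(1) b signature_step_removable(1,4)[OF is_partition_tail[OF Cons(1)] assms(2) r]
        by (auto split: if_splits)
    qed
    moreover have "l' 0 = l 0" by (auto simp: a Suc remove_node_def)
    ultimately show ?thesis using R R' part restricted_iff[of l' e] by auto
  qed
qed

text \<open>Putting a row on top never lowers \<open>eps_word\<close>, so it suffices to find an
  \<open>i\<close> for the last nonzero row. Its length is less than \<open>e\<close>, hence the
  residue of its last node differs from that of the addable node below it.\<close>

lemma eps_word_signature_pos:
  assumes "l \<in> restricted_partitions e" "e \<ge> 2" "l \<noteq> empty_partition"
  shows "\<exists>i. eps_word (signature e m i l) > 0"
  using restricted_is_partition[OF assms(1)] assms(1,3)
proof (induction l m rule: partition_induct)
  case (Cons l m)
  have R: "tail l \<in> restricted_partitions e" using Cons.prems restricted_tail by blast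
  show ?case
  proof (cases "tail l = empty_partition")
    case True
    have "l 1 = 0" using fun_cong[OF True, of 0] by (simp add: empty_partition_def)
    then have l: "0 < l 0" "l 0 < e" using Cons restricted_iff[of l e] by auto
    define i where "i = m + int (l 0) - 1"
    have "(m - 1) mod int e \<noteq> i mod int e"
    proof
      assume "(m - 1) mod int e = i mod int e"
      then have "int e dvd i - (m - 1)" by (metis mod_eq_dvd_iff)
      then show False using l by (auto simp: i_def dest: nat_dvd_not_less)
    qed
    then have "signature e (m - 1) i (tail l) = []" by (simp add: True signature_empty)
    then have "eps_word (signature e m i l) = 1"
      using signature_step_removable(2)[OF Cons(1) assms(2), of m i] by (simp add: i_def)
    then show ?thesis by (metis zero_less_one)
  next
    case False
    then obtain i where i: "eps_word (signature e (m - 1) i (tail l)) > 0" using Cons R by blast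
    consider "(m + int (l 0)) mod int e = i mod int e" | "(m + int (l 0) - 1) mod int e = i mod int e"
      | "(m + int (l 0)) mod int e \<noteq> i mod int e" "(m + int (l 0) - 1) mod int e \<noteq> i mod int e"
      by blast
    then have "eps_word (signature e m i l) > 0"
    proof cases
      case 1
      then show ?thesis using i signature_step_addable[OF Cons(1) assms(2)] by auto
    next
      case 2
      then show ?thesis using i signature_step_removable(2)[OF Cons(1) assms(2)] by auto
    next
      case 3
      then show ?thesis using i signature_step_neutral[OF Cons(1) assms(2)] by auto
    qed
    then show ?thesis by blast
  qed
qed simp

definition psize :: "(nat \<Rightarrow> nat) \<Rightarrow> nat" where
  "psize l = sum l {..<rows l}"

lemma psize_eq:
  assumes "is_partition l" "rows l \<le> n" shows "psize l = sum l {..<n}"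
  unfolding psize_def using assms partition_eq_0_iff[OF assms(1)]
  by (intro sum.mono_neutral_left) auto

lemma psize_add_node:
  assumes "is_partition l" "addable e m i l a"
  shows "psize (add_node a l) = Suc (psize l)"
proof -
  let ?n = "Suc (max a (max (rows l) (rows (add_node a l))))"
  have "sum (add_node a l) {..<?n} = (\<Sum>k<?n. l k + of_bool (k = a))"
    by (intro sum.cong) (auto simp: add_node_def)
  also have "\<dots> = sum l {..<?n} + 1"
  proof -
    have "(\<Sum>k<?n. of_bool (k = a) :: nat) = 1"
      by (subst sum.mono_neutral_right[of _ "{a}"]) auto
    then show ?thesis by (simp add: sum.distrib del: sum.lessThan_Suc)
  qed
  finally show ?thesis
    using psize_eq[OF assms(1), of ?n] psize_eq[OF is_partition_add_node[OF assms], of ?n]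
    by (simp del: sum.lessThan_Suc)
qed

text \<open>By \<open>eps_word_signature_pos\<close> the empty partition is the only restricted one
  without a predecessor, and a predecessor has one node less.\<close>

lemma restricted_induct [consumes 2, case_names empty f_op]:
  assumes "l \<in> restricted_partitions e" "e \<ge> 2"
    and "P empty_partition"
    and "\<And>l i l'. l \<in> restricted_partitions e \<Longrightarrow> P l \<Longrightarrow> f_op e m i l = Some l' \<Longrightarrow>
           l' \<in> restricted_partitions e \<Longrightarrow> P l'"
  shows "P l"
  using assms(1)
proof (induction "psize l" arbitrary: l rule: less_induct)
  case less
  show ?case
  proof (cases "l = empty_partition")
    case False
    then obtain i where "eps_word (signature e m i l) > 0"
      using eps_word_signature_pos[OF less(2) assms(2)] by blast
    then obtain l' where l': "e_op e m i l = Some l'"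
      using leftmost_removable_eq_None[of "signature e m i l"] by (auto simp: e_op_def)
    note part = restricted_is_partition[OF less(2)]
    note R = e_op_restricted[OF less(2) assms(2) l']
    have f: "f_op e m i l' = Some l"
      using e_op_iff_f_op[OF part assms(2) restricted_is_partition[OF R]] l' by blast
    obtain a where "addable e m i l' a" "l = add_node a l'"
      using f_opE[OF restricted_is_partition[OF R] assms(2) f] by metis
    then have "psize l' < psize l" using psize_add_node[OF restricted_is_partition[OF R]] by simp
    then show ?thesis using less R f assms(4) by blast
  qed (use assms(3) in simp)
qed

section \<open>Tensor products\<close>

lemma tensor_signature_append:
  "tensor_signature e m i (xs @ ys) =
     map (apsnd (apfst ((+) (length xs)))) (tensor_signature e m i ys) @ tensor_signature e m i xs"
proof -
  let ?g = "\<lambda>bs k. map (\<lambda>(s, a). (s, (k, a))) (signature e m i (bs ! k))"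
  have "map ((+) (length xs)) [0..<length ys] = [length xs..<length xs + length ys]"
    by (rule nth_equalityI) auto
  then have 1: "rev [0..<length xs + length ys] =
      map ((+) (length xs)) (rev [0..<length ys]) @ rev [0..<length xs]"
    using upt_add_eq_append[of 0 "length xs" "length ys"] by (simp add: rev_map[symmetric])
  have 2: "map (?g (xs @ ys)) (rev [0..<length xs]) = map (?g xs) (rev [0..<length xs])"
    by (rule map_cong) (simp_all add: nth_append)
  have 3: "?g (xs @ ys) (length xs + k) = map (apsnd (apfst ((+) (length xs)))) (?g ys k)" for k
    unfolding nth_append_length_plus map_map by (rule map_cong) (simp_all add: split_beta)
  have "tensor_signature e m i (xs @ ys) =
      concat (map (\<lambda>k. ?g (xs @ ys) (length xs + k)) (rev [0..<length ys])) @
      concat (map (?g (xs @ ys)) (rev [0..<length xs]))"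
    by (simp add: tensor_signature_def 1 comp_def del: upt_Suc)
  also have "\<dots> = concat (map (\<lambda>k. map (apsnd (apfst ((+) (length xs)))) (?g ys k)) (rev [0..<length ys])) @
      concat (map (?g xs) (rev [0..<length xs]))"
    by (simp only: 2 3)
  finally show ?thesis
    by (simp only: tensor_signature_def map_concat map_map comp_def)
qed

lemma tensor_signature_Nil [simp]: "tensor_signature e m i [] = []"
  by (simp add: tensor_signature_def)

lemma tensor_signature_singleton:
  "tensor_signature e m i [b] = map (apsnd (Pair 0)) (signature e m i b)"
  by (simp add: tensor_signature_def apsnd_def map_prod_def)

lemma tensor_signature_snoc:
  "tensor_signature e m i (bs @ [b]) =
     map (apsnd (Pair (length bs))) (signature e m i b) @ tensor_signature e m i bs"
  unfolding tensor_signature_append tensor_signature_singleton map_map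
  by (auto intro!: map_cong)

lemma set_tensor_signature:
  "(s, (k, a)) \<in> set (tensor_signature e m i bs) \<longleftrightarrow>
     k < length bs \<and> (s, a) \<in> set (signature e m i (bs ! k))"
  by (auto simp: tensor_signature_def)

lemma tensor_signature_shift [simp]:
  fixes n :: nat
  shows "phi_word (map (apsnd (apfst ((+) n))) w) = phi_word w"
  "eps_word (map (apsnd (apfst ((+) n))) w) = eps_word w"
  "rightmost_addable (map (apsnd (apfst ((+) n))) w) =
     map_option (apfst ((+) n)) (rightmost_addable w)"
  by simp_all

definition phi_tensor :: "nat \<Rightarrow> int \<Rightarrow> int \<Rightarrow> (nat \<Rightarrow> nat) list \<Rightarrow> nat" where
  "phi_tensor e m i bs = phi_word (tensor_signature e m i bs)"

definition eps_tensor :: "nat \<Rightarrow> int \<Rightarrow> int \<Rightarrow> (nat \<Rightarrow> nat) list \<Rightarrow> nat" where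
  "eps_tensor e m i bs = eps_word (tensor_signature e m i bs)"

abbreviation phi :: "nat \<Rightarrow> int \<Rightarrow> int \<Rightarrow> (nat \<Rightarrow> nat) \<Rightarrow> nat" where
  "phi e m i l \<equiv> phi_word (signature e m i l)"

abbreviation eps :: "nat \<Rightarrow> int \<Rightarrow> int \<Rightarrow> (nat \<Rightarrow> nat) \<Rightarrow> nat" where
  "eps e m i l \<equiv> eps_word (signature e m i l)"

lemma tensor_Nil [simp]: "phi_tensor e m i [] = 0" "eps_tensor e m i [] = 0"
  by (simp_all add: phi_tensor_def eps_tensor_def)

lemma tensor_append:
  "phi_tensor e m i (xs @ ys) =
     phi_tensor e m i ys + (phi_tensor e m i xs - eps_tensor e m i ys)"
  "eps_tensor e m i (xs @ ys) =
     eps_tensor e m i xs + (eps_tensor e m i ys - phi_tensor e m i xs)"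
  by (simp_all add: phi_tensor_def eps_tensor_def tensor_signature_append
      phi_word_append eps_word_append)

lemma tensor_singleton [simp]:
  "phi_tensor e m i [b] = phi e m i b" "eps_tensor e m i [b] = eps e m i b"
  by (simp_all add: phi_tensor_def eps_tensor_def tensor_signature_singleton)

lemma f_tensor_eq_None: "f_tensor e m i bs = None \<longleftrightarrow> phi_tensor e m i bs = 0"
  by (simp add: f_tensor_def phi_tensor_def rightmost_addable_eq_None)

lemma e_tensor_eq_None: "e_tensor e m i bs = None \<longleftrightarrow> eps_tensor e m i bs = 0"
  by (simp add: e_tensor_def eps_tensor_def leftmost_removable_eq_None)

lemma f_op_eq_None: "f_op e m i b = None \<longleftrightarrow> phi e m i b = 0"
  by (simp add: f_op_def rightmost_addable_eq_None)

lemma e_op_eq_None: "e_op e m i b = None \<longleftrightarrow> eps e m i b = 0"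
  by (simp add: e_op_def leftmost_removable_eq_None)

text \<open>The word of \<open>ys\<close> comes first in the concatenated word, so \<open>xs\<close>
  plays the part of the right-hand word in \<open>rightmost_addable_append\<close>.\<close>

lemma f_tensor_append:
  "f_tensor e m i (xs @ ys) =
     (if eps_tensor e m i ys < phi_tensor e m i xs
      then map_option (\<lambda>xs'. xs' @ ys) (f_tensor e m i xs)
      else map_option (\<lambda>ys'. xs @ ys') (f_tensor e m i ys))"
proof -
  have "k < length xs" if "rightmost_addable (tensor_signature e m i xs) = Some (k, a)" for k a
    using rightmost_addable_in[OF that] by (simp add: set_tensor_signature)
  then show ?thesis
    by (auto simp: f_tensor_def tensor_signature_append rightmost_addable_append
        phi_tensor_def eps_tensor_def option.map_comp comp_def split_beta
        nth_append list_update_append apfst_def map_prod_def intro!: option.map_cong)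
qed

lemma f_tensor_singleton: "f_tensor e m i [b] = map_option (\<lambda>b'. [b']) (f_op e m i b)"
  by (simp add: f_tensor_def f_op_def tensor_signature_singleton option.map_comp comp_def)

definition partitions :: "(nat \<Rightarrow> nat) list \<Rightarrow> bool" where
  "partitions bs \<longleftrightarrow> (\<forall>b\<in>set bs. is_partition b)"

lemma partitions_simps [simp]:
  "partitions []" "partitions (b # bs) \<longleftrightarrow> is_partition b \<and> partitions bs"
  "partitions (xs @ ys) \<longleftrightarrow> partitions xs \<and> partitions ys"
  by (auto simp: partitions_def)

lemma distinct_tensor_signature:
  assumes "partitions bs" "e \<ge> 2"
  shows "distinct (map snd (tensor_signature e m i bs))"
  using assms(1)
proof (induction bs rule: rev_induct)
  case (snoc b bs)
  have 1: "distinct (map snd (signature e m i b))" using snoc distinct_signature[OF _ assms(2)] by simp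
  have "map snd (tensor_signature e m i (bs @ [b])) =
      map (Pair (length bs)) (map snd (signature e m i b)) @ map snd (tensor_signature e m i bs)"
    by (simp add: tensor_signature_snoc comp_def)
  moreover have "distinct (map (Pair (length bs)) (map snd (signature e m i b)))"
    using 1 by (simp add: distinct_map inj_on_def)
  ultimately show ?case using snoc
    by (auto simp: set_tensor_signature)
qed simp

lemma flip_at_map_Pair:
  "flip_at (k, a) (map (apsnd (Pair k)) w) = map (apsnd (Pair k)) (flip_at a w)"
  by (induction w) auto

lemma tensor_signature_add_node:
  assumes "partitions bs" "e \<ge> 2" "k < length bs" "addable e m i (bs ! k) a"
  shows "tensor_signature e m i (bs[k := add_node a (bs ! k)]) =
    flip_at (k, a) (tensor_signature e m i bs)"
  using assms
proof (induction bs rule: rev_induct)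
  case (snoc b bs)
  show ?case
  proof (cases "k = length bs")
    case True
    have "flip_at (k, a) (tensor_signature e m i bs) = tensor_signature e m i bs"
      by (rule flip_at_notin) (auto simp: True set_tensor_signature)
    moreover have "is_partition b" using snoc by simp
    ultimately show ?thesis
      using True snoc.prems signature_add_node[of b e m i a]
      by (simp add: tensor_signature_snoc
          flip_at_map_Pair list_update_append)
  next
    case False
    then have k: "k < length bs" using snoc.prems by simp
    have "flip_at (k, a) (map (apsnd (Pair (length bs))) (signature e m i b)) =
        map (apsnd (Pair (length bs))) (signature e m i b)"
      by (rule flip_at_notin) (use False in auto)
    then show ?thesis
      using snoc k
      by (simp add: tensor_signature_snoc comp_def
          list_update_append nth_append)
  qed
qed simp

lemma f_tensorE:
  assumes "partitions bs" "e \<ge> 2" "f_tensor e m i bs = Some bs'"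
  obtains k a where "rightmost_addable (tensor_signature e m i bs) = Some (k, a)"
    "k < length bs" "addable e m i (bs ! k) a" "bs' = bs[k := add_node a (bs ! k)]"
    "tensor_signature e m i bs' = flip_at (k, a) (tensor_signature e m i bs)"
    "f_op e m i (bs ! k) = Some (add_node a (bs ! k))"
proof -
  obtain k a where *: "rightmost_addable (tensor_signature e m i bs) = Some (k, a)"
    "bs' = bs[k := add_node a (bs ! k)]"
    using assms(3) by (auto simp: f_tensor_def)
  then have k: "k < length bs" "(Addable, a) \<in> set (signature e m i (bs ! k))"
    using rightmost_addable_in by (auto simp: set_tensor_signature dest: rightmost_addable_in)
  then have a: "addable e m i (bs ! k) a"
    using assms(1) set_signature by (auto simp: partitions_def)
  have "rightmost_addable (signature e m i (bs ! k)) = Some a"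
    using *(1) k(1)
  proof (induction bs rule: rev_induct)
    case (snoc b bs)
    show ?case
    proof (cases "k = length bs")
      case True
      then have "(length bs, a) \<notin> snd ` set (tensor_signature e m i bs)"
        by (auto simp: set_tensor_signature)
      then show ?thesis
        using snoc True rightmost_addable_in[of "tensor_signature e m i bs" "(k, a)"]
        by (force simp: tensor_signature_snoc
            rightmost_addable_append split: if_splits)
    next
      case False
      then show ?thesis
        using snoc by (auto simp: tensor_signature_snoc
            rightmost_addable_append nth_append split: if_splits)
    qed
  qed simp
  then show ?thesis
    using that[of k a] * k a tensor_signature_add_node[OF assms(1,2) k(1) a]
    by (simp add: f_op_def)
qed

lemma f_tensor_partitions:
  assumes "partitions bs" "e \<ge> 2" "f_tensor e m i bs = Some bs'"
  shows "partitions bs'" "length bs' = length bs"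
proof -
  obtain k a where *: "k < length bs" "addable e m i (bs ! k) a" "bs' = bs[k := add_node a (bs ! k)]"
    using f_tensorE[OF assms] by metis
  then have "is_partition (add_node a (bs ! k))"
    using assms(1) is_partition_add_node by (auto simp: partitions_def)
  then show "partitions bs'" using assms(1) set_update_subset_insert[of bs k] *(3)
    by (fastforce simp: partitions_def)
  show "length bs' = length bs" by (simp add: *)
qed

lemma f_tensor_restricted:
  assumes "bs \<in> tensor_power e h" "e \<ge> 2" "f_tensor e m i bs = Some bs'"
  shows "bs' \<in> tensor_power e h"
proof -
  have "partitions bs"
    using assms(1) restricted_is_partition by (auto simp: tensor_power_def partitions_def)
  from f_tensorE[OF this assms(2,3)] obtain k a where *: "k < length bs"
    "bs' = bs[k := add_node a (bs ! k)]" "f_op e m i (bs ! k) = Some (add_node a (bs ! k))"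
    by metis
  moreover have "bs ! k \<in> restricted_partitions e"
    using assms(1) *(1) by (auto simp: tensor_power_def)
  ultimately have "add_node a (bs ! k) \<in> restricted_partitions e"
    using f_op_restricted[OF _ assms(2)] by blast
  then show ?thesis using assms(1) set_update_subset_insert[of bs k] *(2)
    by (fastforce simp: tensor_power_def)
qed

lemma f_tensor_count:
  assumes "partitions bs" "e \<ge> 2" "f_tensor e m i bs = Some bs'"
  shows "Suc (phi_tensor e m i bs') = phi_tensor e m i bs"
    "eps_tensor e m i bs' = Suc (eps_tensor e m i bs)"
  using f_tensorE[OF assms] phi_eps_flip_at[OF distinct_tensor_signature[OF assms(1,2)]]
  unfolding phi_tensor_def eps_tensor_def by metis+

lemma f_op_count:
  assumes "is_partition b" "e \<ge> 2" "f_op e m i b = Some b'"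
  shows "Suc (phi e m i b') = phi e m i b" "eps e m i b' = Suc (eps e m i b)"
  using f_tensor_count[of "[b]" e m i "[b']"] assms by (simp_all add: f_tensor_singleton)

lemma e_tensor_iff_f_tensor:
  assumes "partitions bs" "e \<ge> 2" "partitions bs'"
  shows "e_tensor e m i bs = Some bs' \<longleftrightarrow> f_tensor e m i bs' = Some bs"
proof
  assume "f_tensor e m i bs' = Some bs"
  from f_tensorE[OF assms(3,2) this] obtain k a where
    a: "rightmost_addable (tensor_signature e m i bs') = Some (k, a)" "k < length bs'"
    "bs = bs'[k := add_node a (bs' ! k)]"
    "tensor_signature e m i bs = flip_at (k, a) (tensor_signature e m i bs')" by metis
  have "leftmost_removable (tensor_signature e m i bs) = Some (k, a)"
    unfolding a(4) leftmost_removable_flip_at[OF distinct_tensor_signature[OF assms(3,2)]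
      rightmost_addable_in[OF a(1)]] by (rule a(1))
  moreover have "remove_node a (bs ! k) = bs' ! k"
    using a(2,3) by (auto simp: remove_node_def add_node_def)
  ultimately show "e_tensor e m i bs = Some bs'" using a(2,3) by (simp add: e_tensor_def)
next
  assume "e_tensor e m i bs = Some bs'"
  then obtain k a where a: "leftmost_removable (tensor_signature e m i bs) = Some (k, a)"
    "bs' = bs[k := remove_node a (bs ! k)]"
    by (auto simp: e_tensor_def)
  have k: "k < length bs" "(Removable, a) \<in> set (signature e m i (bs ! k))"
    using leftmost_removable_in[OF a(1)] by (auto simp: set_tensor_signature)
  have p: "is_partition (bs ! k)" using assms(1) k by (auto simp: partitions_def)
  then have "removable e m i (bs ! k) a" using k set_signature by auto
  note r = remove_node[OF p this assms(2)]
  have k': "k < length bs'" "bs' ! k = remove_node a (bs ! k)" using a(2) k by auto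
  have bs: "bs = bs'[k := add_node a (bs' ! k)]"
    unfolding k'(2) r(2) unfolding a(2) by simp
  have "tensor_signature e m i bs = flip_at (k, a) (tensor_signature e m i bs')"
    using tensor_signature_add_node[OF assms(3,2) k'(1), of m i a] r(3)
    by (simp only: k'(2)[symmetric] bs[symmetric])
  moreover have "(Addable, (k, a)) \<in> set (tensor_signature e m i bs')"
    using k' r(3) set_signature[OF r(1)] by (auto simp: set_tensor_signature)
  ultimately have "rightmost_addable (tensor_signature e m i bs') = Some (k, a)"
    using leftmost_removable_flip_at[OF distinct_tensor_signature[OF assms(3,2)]] a(1) by metis
  then show "f_tensor e m i bs' = Some bs" using bs[symmetric] by (simp add: f_tensor_def)
qed

lemma e_tensor_partitions:
  assumes "partitions bs" "e \<ge> 2" "e_tensor e m i bs = Some bs'"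
  shows "partitions bs'"
proof -
  obtain k a where a: "leftmost_removable (tensor_signature e m i bs) = Some (k, a)"
    "bs' = bs[k := remove_node a (bs ! k)]"
    using assms(3) by (auto simp: e_tensor_def)
  have k: "k < length bs" "(Removable, a) \<in> set (signature e m i (bs ! k))"
    using leftmost_removable_in[OF a(1)] by (auto simp: set_tensor_signature)
  have p: "is_partition (bs ! k)" using assms(1) k by (auto simp: partitions_def)
  then have "removable e m i (bs ! k) a" using k set_signature by auto
  note r = remove_node[OF p this assms(2)]
  show ?thesis using assms(1) r(1) a(2) set_update_subset_insert[of bs k]
    by (fastforce simp: partitions_def)
qed

section \<open>Iterated operators and string lengths\<close>

lemma iter_0 [simp]: "iter g 0 x = Some x"
  and iter_Suc: "iter g (Suc n) x = Option.bind (iter g n x) g"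
  by (simp_all add: iter_def)

lemma iter_add: "iter g (n + k) x = Option.bind (iter g n x) (iter g k)"
proof (induction k)
  case (Suc k)
  then show ?case by (cases "iter g n x") (simp_all add: iter_Suc)
qed simp

lemma iter_Suc': "iter g (Suc n) x = Option.bind (g x) (iter g n)"
  using iter_add[of g 1 n x] by (simp add: iter_Suc)

lemma iter_neq_None_iff:
  assumes "Q x" "\<And>x. Q x \<Longrightarrow> g x = None \<longleftrightarrow> \<mu> x = 0"
    "\<And>x y. Q x \<Longrightarrow> g x = Some y \<Longrightarrow> Q y \<and> Suc (\<mu> y) = \<mu> x"
  shows "iter g n x \<noteq> None \<longleftrightarrow> n \<le> \<mu> x"
  using assms(1)
proof (induction n arbitrary: x)
  case (Suc n)
  show ?case
  proof (cases "g x")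
    case None
    then have "\<mu> x = 0" using Suc.prems assms(2) by blast
    then show ?thesis using None by (simp add: iter_Suc')
  next
    case (Some y)
    then show ?thesis using Suc.IH[of y] assms(3)[OF Suc.prems Some] by (auto simp: iter_Suc')
  qed
qed simp

lemma string_length_eq:
  assumes "Q x" "\<And>x. Q x \<Longrightarrow> g x = None \<longleftrightarrow> \<mu> x = 0"
    "\<And>x y. Q x \<Longrightarrow> g x = Some y \<Longrightarrow> Q y \<and> Suc (\<mu> y) = \<mu> x"
  shows "string_length g x = \<mu> x"
proof -
  have "iter g n x \<noteq> None \<longleftrightarrow> n \<le> \<mu> x" for n
    by (rule iter_neq_None_iff[of Q x g \<mu>, OF assms])
  then have "{n. iter g n x \<noteq> None} = {..\<mu> x}" by (simp only: atMost_def)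
  moreover have "Max {..\<mu> x} = \<mu> x" by (rule Max_eqI) auto
  ultimately show ?thesis by (simp only: string_length_def)
qed

lemma string_length_f_tensor:
  assumes "partitions bs" "e \<ge> 2"
  shows "string_length (f_tensor e m i) bs = phi_tensor e m i bs"
  by (rule string_length_eq[of partitions])
     (use assms f_tensor_eq_None f_tensor_partitions f_tensor_count in \<open>blast+\<close>)

lemma string_length_e_tensor:
  assumes "partitions bs" "e \<ge> 2"
  shows "string_length (e_tensor e m i) bs = eps_tensor e m i bs"
proof (rule string_length_eq[of partitions])
  fix x y assume *: "partitions x" "e_tensor e m i x = Some y"
  then have y: "partitions y" using e_tensor_partitions assms(2) by blast
  then have "f_tensor e m i y = Some x" using * e_tensor_iff_f_tensor[OF *(1) assms(2) y] by blast
  then show "partitions y \<and> Suc (eps_tensor e m i y) = eps_tensor e m i x"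
    using y f_tensor_count[OF y assms(2)] by simp
qed (use assms e_tensor_eq_None in \<open>blast+\<close>)

lemma string_length_f_op:
  assumes "is_partition b" "e \<ge> 2"
  shows "string_length (f_op e m i) b = phi e m i b"
  by (rule string_length_eq[of is_partition])
     (use assms f_op_eq_None f_op_count in \<open>auto elim: f_opE\<close>)

lemma string_length_e_op:
  assumes "is_partition b" "e \<ge> 2"
  shows "string_length (e_op e m i) b = eps e m i b"
proof (rule string_length_eq[of is_partition])
  fix x y assume *: "is_partition x" "e_op e m i x = Some y"
  then have y: "is_partition y" using e_op_partition assms(2) by blast
  then have "f_op e m i y = Some x" using * e_op_iff_f_op[OF *(1) assms(2) y] by blast
  then show "is_partition y \<and> Suc (eps e m i y) = eps e m i x"
    using y f_op_count[OF y assms(2)] by simp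
qed (use assms e_op_eq_None in \<open>blast+\<close>)

lemma iter_f_tensor_count:
  assumes "partitions bs" "e \<ge> 2" "iter (f_tensor e m i) n bs = Some bs'"
  shows "partitions bs'" "phi_tensor e m i bs' + n = phi_tensor e m i bs"
    "eps_tensor e m i bs' = eps_tensor e m i bs + n"
proof -
  have "partitions bs' \<and> phi_tensor e m i bs' + n = phi_tensor e m i bs \<and>
    eps_tensor e m i bs' = eps_tensor e m i bs + n"
    using assms(3)
  proof (induction n arbitrary: bs')
    case (Suc n)
    then obtain z where z: "iter (f_tensor e m i) n bs = Some z" "f_tensor e m i z = Some bs'"
      by (cases "iter (f_tensor e m i) n bs") (auto simp: iter_Suc)
    then have IH: "partitions z" "phi_tensor e m i z + n = phi_tensor e m i bs"
      "eps_tensor e m i z = eps_tensor e m i bs + n"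
      using Suc.IH by auto
    show ?case
      using f_tensor_partitions(1)[OF IH(1) assms(2) z(2)] f_tensor_count[OF IH(1) assms(2) z(2)] IH
      by simp
  qed (use assms(1) in simp)
  then show "partitions bs'" "phi_tensor e m i bs' + n = phi_tensor e m i bs"
    "eps_tensor e m i bs' = eps_tensor e m i bs + n" by auto
qed

text \<open>A step in \<open>xs\<close> lowers \<open>phi_tensor\<close> of \<open>xs\<close>, and a
  step in \<open>ys\<close> raises \<open>eps_tensor\<close> of \<open>ys\<close>. So once the
  operator has passed from \<open>xs\<close> to \<open>ys\<close> it does not return, and
  \<open>k\<close> counts the steps before the passage.\<close>

lemma iter_f_tensor_append:
  assumes "partitions xs" "partitions ys" "e \<ge> 2" "n \<le> phi_tensor e m i (xs @ ys)"
  defines "k \<equiv> min n (phi_tensor e m i xs - eps_tensor e m i ys)"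
  shows "\<exists>xs' ys'. iter (f_tensor e m i) n (xs @ ys) = Some (xs' @ ys') \<and>
    iter (f_tensor e m i) k xs = Some xs' \<and> iter (f_tensor e m i) (n - k) ys = Some ys'"
  using assms(4) unfolding k_def
proof (induction n)
  case (Suc n)
  let ?k = "min n (phi_tensor e m i xs - eps_tensor e m i ys)"
  obtain xs' ys' where *: "iter (f_tensor e m i) n (xs @ ys) = Some (xs' @ ys')"
    "iter (f_tensor e m i) ?k xs = Some xs'" "iter (f_tensor e m i) (n - ?k) ys = Some ys'"
    using Suc by auto
  note x = iter_f_tensor_count[OF assms(1,3) *(2)]
  note y = iter_f_tensor_count[OF assms(2,3) *(3)]
  show ?case
  proof (cases "n < phi_tensor e m i xs - eps_tensor e m i ys")
    case True
    then have k: "?k = n" by simp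
    have "eps_tensor e m i ys' < phi_tensor e m i xs'" using True x(2) y(3) by simp
    then obtain zs where zs: "f_tensor e m i xs' = Some zs"
      using f_tensor_eq_None[of e m i xs'] by fastforce
    have "f_tensor e m i (xs' @ ys') = Some (zs @ ys')"
      using \<open>eps_tensor e m i ys' < phi_tensor e m i xs'\<close> zs by (simp add: f_tensor_append)
    moreover have "min (Suc n) (phi_tensor e m i xs - eps_tensor e m i ys) = Suc n"
      using True by simp
    ultimately show ?thesis using * k zs
      by (intro exI[of _ zs] exI[of _ ys']) (simp add: iter_Suc)
  next
    case False
    then have k: "?k = phi_tensor e m i xs - eps_tensor e m i ys"
      "min (Suc n) (phi_tensor e m i xs - eps_tensor e m i ys) = ?k" by auto
    have le: "\<not> eps_tensor e m i ys' < phi_tensor e m i xs'"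
      using False x(2) y(3) k by simp
    have "phi_tensor e m i ys' > 0"
      using Suc.prems y(2) False k by (simp add: tensor_append)
    then obtain zs where zs: "f_tensor e m i ys' = Some zs"
      using f_tensor_eq_None[of e m i ys'] by fastforce
    have "f_tensor e m i (xs' @ ys') = Some (xs' @ zs)"
      using le zs by (simp add: f_tensor_append)
    moreover have "Suc n - ?k = Suc (n - ?k)" by simp
    ultimately show ?thesis using * k(2) zs
      by (intro exI[of _ xs'] exI[of _ zs]) (simp only: iter_Suc, simp)
  qed
qed simp

section \<open>Tuples of bead sets\<close>

definition maya :: "int set \<Rightarrow> bool" where
  "maya J \<longleftrightarrow> (\<exists>B. (\<forall>x< -B. x \<in> J) \<and> (\<forall>x\<ge>B. x \<notin> J))"

text \<open>In terms of beta numbers, an addable node is a bead at \<open>j\<close> with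
  \<open>j + 1\<close> free, and a removable one is a bead at \<open>j + 1\<close> with
  \<open>j\<close> free. The label \<open>p\<close> is arbitrary, as the same letters are read with
  different labels.\<close>

definition bletter :: "int set \<Rightarrow> int \<Rightarrow> 'p \<Rightarrow> (node_sign \<times> 'p) list" where
  "bletter J j p = (if j \<in> J \<and> j + 1 \<notin> J then [(Addable, p)]
     else if j \<notin> J \<and> j + 1 \<in> J then [(Removable, p)] else [])"

definition move :: "int \<Rightarrow> int set \<Rightarrow> int set" where
  "move j J = insert (j + 1) (J - {j})"

text \<open>A configuration \<open>M\<close> consists of the bead sets \<open>M 0, \<dots>, M (h - 1)\<close>. The site \<open>(t, c)\<close> is the pair of
  positions \<open>i + e t, i + e t + 1\<close> of \<open>M c\<close>; sites are read in decreasing lexicographic order.\<close>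

definition cell :: "nat \<Rightarrow> int \<Rightarrow> (nat \<Rightarrow> int set) \<Rightarrow> int \<times> nat \<Rightarrow> (node_sign \<times> (int \<times> nat)) list" where
  "cell e i M n = bletter (M (snd n)) (i + int e * fst n) n"

definition sites :: "nat \<Rightarrow> nat \<Rightarrow> int \<Rightarrow> (nat \<Rightarrow> int set) \<Rightarrow> (int \<times> nat) set" where
  "sites e h i M = {n. snd n < h \<and> cell e i M n \<noteq> []}"

definition site_word :: "nat \<Rightarrow> nat \<Rightarrow> int \<Rightarrow> (nat \<Rightarrow> int set) \<Rightarrow> (node_sign \<times> (int \<times> nat)) list" where
  "site_word e h i M = concat (map (cell e i M) (rev (sorted_list_of_set (sites e h i M))))"

definition site_f :: "nat \<Rightarrow> nat \<Rightarrow> int \<Rightarrow> (nat \<Rightarrow> int set) \<Rightarrow> (nat \<Rightarrow> int set) option" where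
  "site_f e h i M = map_option (\<lambda>(t, c). M(c := move (i + int e * t) (M c)))
     (rightmost_addable (site_word e h i M))"

definition mayas :: "nat \<Rightarrow> (nat \<Rightarrow> int set) \<Rightarrow> bool" where
  "mayas h M \<longleftrightarrow> (\<forall>c<h. maya (M c))"

definition col :: "nat \<Rightarrow> nat \<Rightarrow> int \<Rightarrow> (nat \<Rightarrow> int set) \<Rightarrow> int \<Rightarrow> (node_sign \<times> (int \<times> nat)) list" where
  "col e h i M t = concat (map (\<lambda>c. cell e i M (t, c)) (rev [0..<h]))"

lemma concat_map_filter:
  "concat (map f (filter (\<lambda>x. f x \<noteq> []) xs)) = concat (map f xs)"
  by (induction xs) auto

lemma sorted_list_unique:
  fixes ns :: "'a::linorder list"
  assumes "sorted_wrt (>) ns"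
  shows "ns = rev (sorted_list_of_set (set ns))"
proof -
  have "sorted_wrt (<) (rev ns)" using assms by (simp add: sorted_wrt_rev)
  then have "sorted (rev ns)" "distinct (rev ns)" by (simp_all add: strict_sorted_iff)
  then have "rev ns = sorted_list_of_set (set (rev ns))"
    by (metis sorted_list_of_set.idem_if_sorted_distinct)
  then show ?thesis by (metis rev_rev_ident set_rev)
qed

text \<open>Positions without a letter contribute nothing, so it does not matter along which
  decreasing list the sites are read.\<close>

lemma site_word_eq:
  assumes "sorted_wrt (>) ns" "sites e h i M \<subseteq> set ns" "\<forall>n\<in>set ns. snd n < h"
  shows "site_word e h i M = concat (map (cell e i M) ns)"
proof -
  let ?ms = "filter (\<lambda>n. cell e i M n \<noteq> []) ns"
  have "set ?ms = sites e h i M" using assms(2,3) by (auto simp: sites_def)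
  moreover have "sorted_wrt (>) ?ms" by (rule sorted_wrt_filter[OF assms(1)])
  ultimately have "?ms = rev (sorted_list_of_set (sites e h i M))"
    using sorted_list_unique[of ?ms] by simp
  then show ?thesis unfolding site_word_def by (metis concat_map_filter)
qed

lemma sorted_product:
  fixes ts :: "'a::linorder list" and cs :: "'b::linorder list"
  assumes "sorted_wrt (>) ts" "sorted_wrt (>) cs"
  shows "sorted_wrt (>) (List.product ts cs)"
  using assms(1)
proof (induction ts)
  case (Cons t ts)
  have "sorted_wrt (>) (map (Pair t) cs)"
    using assms(2) by (simp add: sorted_wrt_map less_prod_def)
  then show ?case using Cons by (auto simp: sorted_wrt_append less_prod_def)
qed simp

lemma sorted_rev_upto: "sorted_wrt (>) (rev [a..b::int])"
  by (simp add: sorted_wrt_rev)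

lemma sorted_rev_upt: "sorted_wrt (>) (rev [a..<b])"
  by (simp add: sorted_wrt_rev)

lemma cell_bounded:
  assumes "maya J" "e > 0"
  shows "\<exists>K. \<forall>t p. bletter J (i + int e * t) p \<noteq> [] \<longrightarrow> \<bar>t\<bar> \<le> K"
proof -
  obtain B where B: "\<forall>x< -B. x \<in> J" "\<forall>x\<ge>B. x \<notin> J" using assms(1) by (auto simp: maya_def)
  show ?thesis
  proof (intro exI allI impI)
    fix t and p :: 'a assume *: "bletter J (i + int e * t) p \<noteq> []"
    let ?j = "i + int e * t"
    have "\<not> ?j < - B - 1"
    proof
      assume "?j < - B - 1"
      then have "?j \<in> J" "?j + 1 \<in> J" using B(1) by auto
      then show False using * by (simp add: bletter_def)
    qed
    moreover have "\<not> ?j \<ge> B"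
    proof
      assume "?j \<ge> B"
      then have "?j \<notin> J" "?j + 1 \<notin> J" using B(2) by auto
      then show False using * by (simp add: bletter_def)
    qed
    ultimately have "\<bar>?j\<bar> \<le> \<bar>B\<bar> + 1" by linarith
    then have "\<bar>int e * t\<bar> \<le> \<bar>B\<bar> + 1 + \<bar>i\<bar>" by linarith
    moreover have "1 * \<bar>t\<bar> \<le> int e * \<bar>t\<bar>"
      using assms(2) by (intro mult_right_mono) auto
    ultimately show "\<bar>t\<bar> \<le> \<bar>B\<bar> + 1 + \<bar>i\<bar>" by (simp add: abs_mult)
  qed
qed

lemma sites_bounded:
  assumes "mayas h M" "e > 0"
  shows "\<exists>K0. \<forall>n\<in>sites e h i M. \<bar>fst n\<bar> \<le> K0"
proof -
  have "\<exists>K. \<forall>t. bletter (M c) (i + int e * t) (t, c) \<noteq> [] \<longrightarrow> \<bar>t\<bar> \<le> K" if "c < h" for c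
  proof -
    have "maya (M c)" using assms(1) that by (simp add: mayas_def)
    from cell_bounded[OF this assms(2), where 'a = "int \<times> nat"] obtain K where
      K: "\<forall>t p. bletter (M c) (i + int e * t) (p :: int \<times> nat) \<noteq> [] \<longrightarrow> \<bar>t\<bar> \<le> K" by metis
    show ?thesis by (rule exI[of _ K]) (use K in blast)
  qed
  then obtain K where K: "bletter (M c) (i + int e * t) (t, c) \<noteq> [] \<Longrightarrow> \<bar>t\<bar> \<le> K c" if "c < h" for c t
    by metis
  show ?thesis
  proof (intro exI ballI)
    fix n assume n: "n \<in> sites e h i M"
    have "K (snd n) \<le> Max (K ` {..<h})" using n by (intro Max_ge) (auto simp: sites_def)
    moreover have "\<bar>fst n\<bar> \<le> K (snd n)"
      using K[of "snd n" "fst n"] n by (auto simp: sites_def cell_def)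
    ultimately show "\<bar>fst n\<bar> \<le> Max (K ` {..<h})" by (rule order_trans[rotated])
  qed
qed

text \<open>There are finitely many sites, so the word splits into columns over a large window. A
  threshold \<open>K0\<close> instead of a single window lets several configurations share one
  window.\<close>

lemma site_word_window:
  assumes "mayas h M" "e > 0"
  shows "\<exists>K0. \<forall>K\<ge>K0. site_word e h i M = concat (map (col e h i M) (rev [-K..K]))"
proof -
  obtain K0 where K0: "\<forall>n\<in>sites e h i M. \<bar>fst n\<bar> \<le> K0" using sites_bounded[OF assms] by blast
  show ?thesis
  proof (intro exI allI impI)
    fix K assume K: "K \<ge> K0"
    let ?ns = "List.product (rev [-K..K]) (rev [0..<h])"
    have "fst n \<in> {-K..K} \<and> snd n < h" if "n \<in> sites e h i M" for n
    proof -
      have "\<bar>fst n\<bar> \<le> K" using K0 K that by fastforce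
      then show ?thesis using that by (auto simp: sites_def)
    qed
    then have "sites e h i M \<subseteq> set ?ns" by (auto simp: mem_Times_iff)
    moreover have "sorted_wrt (>) ?ns" by (intro sorted_product sorted_rev_upto sorted_rev_upt)
    ultimately have "site_word e h i M = concat (map (cell e i M) ?ns)"
      by (intro site_word_eq) auto
    also have "\<dots> = concat (map (col e h i M) ts)"
      if "?ns = List.product ts (rev [0..<h])" for ts
      unfolding that by (induction ts) (simp_all add: col_def comp_def)
    finally show "site_word e h i M = concat (map (col e h i M) (rev [-K..K]))" by blast
  qed
qed

lemma site_word_windows:
  assumes "mayas h M" "mayas h M'" "e > 0"
  shows "\<exists>K. site_word e h i M = concat (map (col e h i M) (rev [-K..K])) \<and>
    site_word e h i M' = concat (map (col e h i M') (rev [-K..K]))"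
  using site_word_window[OF assms(1,3)] site_word_window[OF assms(2,3)] by (meson nle_le)

lemma maya_move: "maya J \<Longrightarrow> maya (move j J)"
  unfolding maya_def
proof (elim exE conjE)
  fix B assume "\<forall>x< -B. x \<in> J" "\<forall>x\<ge>B. x \<notin> J"
  then show "\<exists>B. (\<forall>x< -B. x \<in> move j J) \<and> (\<forall>x\<ge>B. x \<notin> move j J)"
    by (intro exI[of _ "\<bar>B\<bar> + \<bar>j\<bar> + 2"]) (auto simp: move_def)
qed

lemma maya_insert_remove: "maya J \<Longrightarrow> maya (insert p J)" "maya J \<Longrightarrow> maya (J - {p})"
proof -
  assume "maya J"
  then obtain B where "\<forall>x< -B. x \<in> J" "\<forall>x\<ge>B. x \<notin> J" by (auto simp: maya_def)
  then show "maya (insert p J)" "maya (J - {p})" unfolding maya_def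
    by (intro exI[of _ "\<bar>B\<bar> + \<bar>p\<bar> + 1"]; auto)+
qed

lemma site_f_mayas:
  assumes "mayas h M" "site_f e h i M = Some N" shows "mayas h N"
  using assms by (auto simp: site_f_def mayas_def maya_move)

lemma site_f_eq_None: "site_f e h i M = None \<longleftrightarrow> phi_word (site_word e h i M) = 0"
  by (simp add: site_f_def rightmost_addable_eq_None)

section \<open>Exchanging beads between neighbouring components\<close>

definition dletter :: "int set \<Rightarrow> int set \<Rightarrow> int \<Rightarrow> (node_sign \<times> int) list" where
  "dletter X Y p = (if p \<in> X \<and> p \<notin> Y then [(Addable, p)]
     else if p \<in> Y \<and> p \<notin> X then [(Removable, p)] else [])"

text \<open>The dual reading: a bead of \<open>X\<close> that is missing in \<open>Y\<close> can
  pass from \<open>X\<close> to \<open>Y\<close>. Which bead passes is determined by the same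
  cancellation rule, with positions read upwards.\<close>

definition dword :: "int set \<Rightarrow> int set \<Rightarrow> (node_sign \<times> int) list" where
  "dword X Y = concat (map (dletter X Y) (sorted_list_of_set ((X - Y) \<union> (Y - X))))"

lemma dword_eq:
  assumes "(X - Y) \<union> (Y - X) \<subseteq> {a..b}"
  shows "dword X Y = concat (map (dletter X Y) [a..b])"
proof -
  let ?ms = "filter (\<lambda>p. dletter X Y p \<noteq> []) [a..b]"
  have "set ?ms = (X - Y) \<union> (Y - X)" using assms by (auto simp: dletter_def)
  moreover have "sorted_wrt (<) ?ms" by (rule sorted_wrt_filter) simp
  then have "sorted ?ms" "distinct ?ms" by (simp_all add: strict_sorted_iff)
  ultimately have "?ms = sorted_list_of_set ((X - Y) \<union> (Y - X))"
    by (metis sorted_list_of_set.idem_if_sorted_distinct)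
  then show ?thesis unfolding dword_def by (metis concat_map_filter)
qed

lemma maya_diff_bounded:
  assumes "maya X" "maya Y"
  shows "\<exists>a. \<forall>b\<ge>a. (X - Y) \<union> (Y - X) \<subseteq> {-b..b}"
proof -
  obtain B C where "\<forall>x< -B. x \<in> X" "\<forall>x\<ge>B. x \<notin> X" "\<forall>x< -C. x \<in> Y" "\<forall>x\<ge>C. x \<notin> Y"
    using assms unfolding maya_def by blast
  then have "x \<in> {-b..b}" if "b \<ge> \<bar>B\<bar> + \<bar>C\<bar>" "x \<in> (X - Y) \<union> (Y - X)" for x b
    using that by (force simp: not_less[symmetric])
  then show ?thesis by blast
qed

text \<open>The letters at the positions \<open>j\<close>, \<open>j + 1\<close> of two consecutive bead sets \<open>X\<close>, \<open>Y\<close>, read along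
  the rows and along the columns. Moving a bead inside a row (\<open>mv\<close>) is dual to moving it from
  \<open>X\<close> to \<open>Y\<close> inside a column.\<close>

definition pair_word :: "int set \<Rightarrow> int set \<Rightarrow> int \<Rightarrow> (node_sign \<times> bool) list" where
  "pair_word X Y j = bletter Y j True @ bletter X j False"

definition block :: "int set \<Rightarrow> int set \<Rightarrow> int \<Rightarrow> (node_sign \<times> int) list" where
  "block X Y j = dletter X Y j @ dletter X Y (j + 1)"

definition mv :: "bool \<Rightarrow> int \<Rightarrow> int set \<times> int set \<Rightarrow> int set \<times> int set" where
  "mv b j XY = (if b then (fst XY, move j (snd XY)) else (move j (fst XY), snd XY))"

definition dmv :: "int \<Rightarrow> int set \<times> int set \<Rightarrow> int set \<times> int set" where
  "dmv p XY = (fst XY - {p}, insert p (snd XY))"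

text \<open>Everything local happens at the four places formed by \<open>j\<close>,
  \<open>j + 1\<close> in \<open>X\<close> and in \<open>Y\<close>, so the sixteen occupations can
  be checked one by one.\<close>

lemma block_mv:
  assumes "rightmost_addable (pair_word X Y j) = Some b" "mv b j (X, Y) = (X1, Y1)"
  shows "phi_word (block X1 Y1 j) = phi_word (block X Y j)"
    "eps_word (block X1 Y1 j) = eps_word (block X Y j)"
  using assms
  by (cases "j \<in> X"; cases "j + 1 \<in> X"; cases "j \<in> Y"; cases "j + 1 \<in> Y"; cases b;
      auto simp: pair_word_def block_def mv_def move_def bletter_def dletter_def)+

lemma pair_word_dmv:
  assumes "rightmost_addable (block X Y j) = Some p" "dmv p (X, Y) = (X', Y')"
  shows "phi_word (pair_word X' Y' j) = phi_word (pair_word X Y j)"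
    "eps_word (pair_word X' Y' j) = eps_word (pair_word X Y j)"
  using assms
  by (cases "j \<in> X"; cases "j + 1 \<in> X"; cases "j \<in> Y"; cases "j + 1 \<in> Y";
      auto simp: pair_word_def block_def dmv_def move_def bletter_def dletter_def)+

text \<open>The two moves may interfere: after one of them the other may act on another bead or in
  another component. Only the final positions agree, hence the new witnesses \<open>p'\<close> and
  \<open>b'\<close>.\<close>

lemma mv_dmv_block:
  assumes "rightmost_addable (pair_word X Y j) = Some b" "mv b j (X, Y) = (X1, Y1)"
    "rightmost_addable (block X Y j) = Some p" "dmv p (X, Y) = (X', Y')"
  shows "\<exists>p' b'. rightmost_addable (block X1 Y1 j) = Some p' \<and>
     rightmost_addable (pair_word X' Y' j) = Some b' \<and> mv b' j (X', Y') = dmv p' (X1, Y1)"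
  using assms
  by (cases "j \<in> X"; cases "j + 1 \<in> X"; cases "j \<in> Y"; cases "j + 1 \<in> Y"; cases b;
      auto simp: pair_word_def block_def mv_def dmv_def move_def bletter_def dletter_def)

text \<open>Replacing a factor by one with the same counts leaves two possibilities: the action
  takes place outside the factor and is unchanged, or it takes place inside both factors.\<close>

lemma append3:
  assumes "phi_word v = phi_word v'" "eps_word v = eps_word v'"
  shows "phi_word (u @ v @ t) = phi_word (u @ v' @ t)"
    "eps_word (u @ v @ t) = eps_word (u @ v' @ t)"
    "rightmost_addable (u @ v @ t) = rightmost_addable (u @ v' @ t) \<and>
       (\<forall>p. rightmost_addable (u @ v @ t) = Some p \<longrightarrow> p \<in> snd ` (set u \<union> set t)) \<or>
     rightmost_addable (u @ v @ t) = rightmost_addable v \<and>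
     rightmost_addable (u @ v' @ t) = rightmost_addable v' \<and> 0 < phi_word v"
proof -
  show "phi_word (u @ v @ t) = phi_word (u @ v' @ t)" "eps_word (u @ v @ t) = eps_word (u @ v' @ t)"
    using assms by (simp_all add: phi_word_append eps_word_append)
  have "p \<in> snd ` (set u \<union> set t)"
    if "rightmost_addable u = Some p \<or> rightmost_addable t = Some p" for p
    using that rightmost_addable_in by force
  then show "rightmost_addable (u @ v @ t) = rightmost_addable (u @ v' @ t) \<and>
       (\<forall>p. rightmost_addable (u @ v @ t) = Some p \<longrightarrow> p \<in> snd ` (set u \<union> set t)) \<or>
     rightmost_addable (u @ v @ t) = rightmost_addable v \<and>
     rightmost_addable (u @ v' @ t) = rightmost_addable v' \<and> 0 < phi_word v"
    using assms by (auto simp: rightmost_addable_append phi_word_append)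
qed

lemma upto_split3:
  assumes "a \<le> j" "j + 1 \<le> (b::int)"
  shows "[a..b] = [a..j - 1] @ [j, j + 1] @ [j + 2..b]"
proof -
  have "[a..b] = [a..j - 1] @ [j..b]" using assms upto_split1[of a j b] by simp
  also have "[j..b] = j # (j + 1) # [j + 1 + 1..b]" using assms by (simp add: upto_rec1)
  finally show ?thesis by (simp add: add.commute)
qed

text \<open>A move inside a row at \<open>j\<close> changes the column word only in the factor
  \<open>block X Y j\<close>, and by \<open>block_mv\<close> not its counts. If the passing bead
  lies in that factor, \<open>mv_dmv_block\<close> applies; otherwise the two moves concern
  different positions.\<close>

lemma dword_commute:
  assumes "maya X" "maya Y" "rightmost_addable (dword X Y) = Some p" "dmv p (X, Y) = (X', Y')"
  shows "phi_word (pair_word X' Y' j) = phi_word (pair_word X Y j) \<and>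
      eps_word (pair_word X' Y' j) = eps_word (pair_word X Y j)" (is ?A)
    and "rightmost_addable (pair_word X Y j) = Some b \<Longrightarrow> mv b j (X, Y) = (X1, Y1) \<Longrightarrow>
      \<exists>p' b'. rightmost_addable (dword X1 Y1) = Some p' \<and>
        rightmost_addable (pair_word X' Y' j) = Some b' \<and> mv b' j (X', Y') = dmv p' (X1, Y1)"
      (is "?P \<Longrightarrow> ?Q \<Longrightarrow> ?B")
proof -
  obtain B where B: "(X - Y) \<union> (Y - X) \<subseteq> {-B..B}" "\<bar>j\<bar> + 2 \<le> B"
  proof -
    obtain a where "\<forall>b\<ge>a. (X - Y) \<union> (Y - X) \<subseteq> {-b..b}"
      using maya_diff_bounded[OF assms(1,2)] by blast
    then show ?thesis using that[of "max a (\<bar>j\<bar> + 2)"] by simp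
  qed
  define u v where "u = (\<lambda>X Y. concat (map (dletter X Y) [-B..j - 1]))"
    and "v = (\<lambda>X Y. concat (map (dletter X Y) [j + 2..B]))"
  have split: "dword X Y = u X Y @ block X Y j @ v X Y" if "(X - Y) \<union> (Y - X) \<subseteq> {-B..B}" for X Y
    unfolding dword_eq[OF that] using B(2) upto_split3[of "-B" j B]
    by (simp add: u_def v_def block_def)
  have out: "p \<notin> {j, j + 1}" if "p \<in> snd ` (set (u X Y) \<union> set (v X Y))"
    using that by (auto simp: u_def v_def dletter_def split: if_splits)
  have in_block: "rightmost_addable (block X Y j) = Some p \<or> p \<notin> {j, j + 1}"
    using append3(3)[of "block X Y j" "block X Y j" "u X Y" "v X Y"] out assms(3)
    unfolding split[OF B(1)] by auto
  show ?A
  proof (cases "p \<in> {j, j + 1}")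
    case True
    then show ?thesis using in_block pair_word_dmv[OF _ assms(4)] by blast
  next
    case False
    then show ?thesis using assms(4) by (auto simp: dmv_def pair_word_def bletter_def)
  qed
  assume b: ?P and m: ?Q
  have B1: "(X1 - Y1) \<union> (Y1 - X1) \<subseteq> {-B..B}"
    using B m by (auto simp: mv_def move_def split: if_splits)
  have same: "dletter X1 Y1 q = dletter X Y q" if "q \<noteq> j" "q \<noteq> j + 1" for q
    using m that by (auto simp: dletter_def mv_def move_def split: if_splits)
  have uv: "u X1 Y1 = u X Y" "v X1 Y1 = v X Y"
    by (auto simp: u_def v_def same intro!: arg_cong[of _ _ concat])
  note cases3 = append3(3)[OF block_mv[OF b m, symmetric], of "u X Y" "v X Y"]
  have w: "dword X Y = u X Y @ block X Y j @ v X Y" "dword X1 Y1 = u X Y @ block X1 Y1 j @ v X Y"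
    using split[OF B(1)] split[OF B1] uv by auto
  show ?B
    using cases3 unfolding w[symmetric]
  proof (elim disjE conjE)
    assume *: "rightmost_addable (dword X Y) = rightmost_addable (block X Y j)"
      "rightmost_addable (dword X1 Y1) = rightmost_addable (block X1 Y1 j)"
    then show ?B using mv_dmv_block[OF b m _ assms(4)] assms(3) by auto
  next
    assume *: "rightmost_addable (dword X Y) = rightmost_addable (dword X1 Y1)"
      "\<forall>q. rightmost_addable (dword X Y) = Some q \<longrightarrow> q \<in> snd ` (set (u X Y) \<union> set (v X Y))"
    then have p: "p \<noteq> j" "p \<noteq> j + 1" using out assms(3) by auto
    then have "pair_word X' Y' j = pair_word X Y j"
      using assms(4) by (auto simp: dmv_def pair_word_def bletter_def)
    moreover have "mv b j (X', Y') = dmv p (X1, Y1)"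
      using p m assms(4) by (auto simp: dmv_def mv_def move_def split: if_splits)
    moreover have "rightmost_addable (dword X1 Y1) = Some p" using *(1) assms(3) by simp
    ultimately show ?B using b by (intro exI[of _ p] exI[of _ b]) simp
  qed
qed

definition swap :: "nat \<Rightarrow> int \<Rightarrow> (nat \<Rightarrow> int set) \<Rightarrow> nat \<Rightarrow> int set" where
  "swap c p M = M(c := M c - {p}, Suc c := insert p (M (Suc c)))"

lemma col_split:
  assumes "Suc c < h"
  shows "col e h i M t =
    concat (map (\<lambda>c. cell e i M (t, c)) (rev [Suc (Suc c)..<h])) @
    map (apsnd (\<lambda>b. (t, if b then Suc c else c))) (pair_word (M c) (M (Suc c)) (i + int e * t)) @
    concat (map (\<lambda>c. cell e i M (t, c)) (rev [0..<c]))"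
proof -
  have "[0..<h] = [0..<c] @ [c..<h]" using assms upt_add_eq_append[of 0 c "h - c"] by simp
  also have "[c..<h] = c # Suc c # [Suc (Suc c)..<h]" using assms by (simp add: upt_rec)
  finally have "rev [0..<h] = rev [Suc (Suc c)..<h] @ [Suc c, c] @ rev [0..<c]" by simp
  moreover have "map (apsnd (\<lambda>b. (t, if b then Suc c else c))) (pair_word (M c) (M (Suc c)) (i + int e * t)) =
      cell e i M (t, Suc c) @ cell e i M (t, c)"
    by (auto simp: pair_word_def cell_def bletter_def)
  ultimately show ?thesis by (simp add: col_def)
qed

text \<open>In every column the components \<open>c + 1\<close> and \<open>c\<close> are read in
  succession, so their \<open>pair_word\<close> is a factor of the column. An exchange keeps all
  column counts; therefore the operator acts in the same column before and after it, and there
  either away from both components or inside the pair.\<close>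

lemma swap_commute:
  assumes "mayas h M" "e > 0" "Suc c < h" "rightmost_addable (dword (M c) (M (Suc c))) = Some p"
  shows "phi_word (site_word e h i (swap c p M)) = phi_word (site_word e h i M)"
    "eps_word (site_word e h i (swap c p M)) = eps_word (site_word e h i M)"
    "site_f e h i M = Some N \<Longrightarrow> \<exists>p'. rightmost_addable (dword (N c) (N (Suc c))) = Some p' \<and>
       site_f e h i (swap c p M) = Some (swap c p' N)"
proof -
  let ?M' = "swap c p M"
  have M': "mayas h ?M'"
    using assms(1) by (auto simp: mayas_def swap_def maya_insert_remove)
  have XY: "maya (M c)" "maya (M (Suc c))" using assms(1,3) by (auto simp: mayas_def)
  have dmv: "dmv p (M c, M (Suc c)) = (?M' c, ?M' (Suc c))" by (simp add: dmv_def swap_def)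
  define u v where "u = (\<lambda>t. concat (map (\<lambda>c. cell e i M (t, c)) (rev [Suc (Suc c)..<h])))"
    and "v = (\<lambda>t. concat (map (\<lambda>c. cell e i M (t, c)) (rev [0..<c])))"
  define g where "g = (\<lambda>t b. (t :: int, if b then Suc c else c))"
  let ?w = "\<lambda>M t. map (apsnd (g t)) (pair_word (M c) (M (Suc c)) (i + int e * t))"
  have "cell e i ?M' (t, c') = cell e i M (t, c')" if "c' \<noteq> c" "c' \<noteq> Suc c" for t c'
    using that by (simp add: cell_def swap_def)
  then have eqs: "map (\<lambda>c. cell e i ?M' (t, c)) (rev [Suc (Suc c)..<h]) =
        map (\<lambda>c. cell e i M (t, c)) (rev [Suc (Suc c)..<h])"
      "map (\<lambda>c. cell e i ?M' (t, c)) (rev [0..<c]) = map (\<lambda>c. cell e i M (t, c)) (rev [0..<c])" for t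
    by (auto intro!: map_cong)
  have cols: "col e h i ?M' t = u t @ ?w ?M' t @ v t" "col e h i M t = u t @ ?w M t @ v t" for t
    unfolding col_split[OF assms(3)] u_def v_def g_def by (simp_all only: eqs)
  have uv: "snd q \<noteq> c \<and> snd q \<noteq> Suc c \<and> fst q = t" if "q \<in> snd ` (set (u t) \<union> set (v t))" for q t
    using that by (auto simp: u_def v_def cell_def bletter_def split: if_splits)
  have w: "phi_word (?w ?M' t) = phi_word (?w M t)" "eps_word (?w ?M' t) = eps_word (?w M t)" for t
    using dword_commute(1)[OF XY assms(4) dmv] by simp_all
  have counts: "phi_word (col e h i ?M' t) = phi_word (col e h i M t)"
    "eps_word (col e h i ?M' t) = eps_word (col e h i M t)" for t
    unfolding cols using append3(1,2)[OF w] by auto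
  obtain K where K: "site_word e h i M = concat (map (col e h i M) (rev [-K..K]))"
    "site_word e h i ?M' = concat (map (col e h i ?M') (rev [-K..K]))"
    using site_word_windows[OF assms(1) M' assms(2)] by blast
  show "phi_word (site_word e h i ?M') = phi_word (site_word e h i M)"
    "eps_word (site_word e h i ?M') = eps_word (site_word e h i M)"
    unfolding K using blocks_rightmost_addable[of "rev [-K..K]" "col e h i M" "col e h i ?M'"] counts
    by auto
  assume N: "site_f e h i M = Some N"
  then have "phi_word (site_word e h i M) \<noteq> 0" using site_f_eq_None[of e h i M] by simp
  then obtain t where t: "rightmost_addable (site_word e h i M) = rightmost_addable (col e h i M t)"
    "rightmost_addable (site_word e h i ?M') = rightmost_addable (col e h i ?M' t)"
    unfolding K using blocks_rightmost_addable[of "rev [-K..K]" "col e h i M" "col e h i ?M'"] counts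
    by auto
  obtain t' c' where tc: "rightmost_addable (site_word e h i M) = Some (t', c')"
    "N = M(c' := move (i + int e * t') (M c'))"
    using N by (auto simp: site_f_def)
  let ?j = "i + int e * t"
  from append3(3)[OF w(1)[symmetric] w(2)[symmetric], of "u t" t "v t"]
  consider (out) "rightmost_addable (col e h i ?M' t) = Some (t', c')" "c' \<noteq> c" "c' \<noteq> Suc c" "t' = t"
    | (pair) "rightmost_addable (?w M t) = Some (t', c')"
      "rightmost_addable (col e h i ?M' t) = rightmost_addable (?w ?M' t)"
    using uv[of _ t] tc(1) unfolding t cols by fastforce
  then show "\<exists>p'. rightmost_addable (dword (N c) (N (Suc c))) = Some p' \<and>
       site_f e h i ?M' = Some (swap c p' N)"
  proof cases
    case out
    have r: "rightmost_addable (site_word e h i ?M') = Some (t', c')" using out(1) t(2) by simp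
    have "site_f e h i ?M' = Some (?M'(c' := move (i + int e * t') (?M' c')))"
      by (simp add: site_f_def r)
    also have "?M'(c' := move (i + int e * t') (?M' c')) = swap c p N"
      by (rule ext) (use out(2,3) in \<open>auto simp: swap_def tc(2)\<close>)
    finally have "site_f e h i ?M' = Some (swap c p N)" .
    moreover have "N c = M c" "N (Suc c) = M (Suc c)" using out(2,3) by (simp_all add: tc(2))
    ultimately show ?thesis using assms(4) by simp
  next
    case pair
    then obtain b where b: "rightmost_addable (pair_word (M c) (M (Suc c)) ?j) = Some b"
      "t' = t" "c' = (if b then Suc c else c)"
      by (auto simp: g_def)
    have mv: "mv b ?j (M c, M (Suc c)) = (N c, N (Suc c))"
      by (auto simp: mv_def tc(2) b)
    from dword_commute(2)[OF XY assms(4) dmv b(1) mv] obtain p' b' where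
      p': "rightmost_addable (dword (N c) (N (Suc c))) = Some p'"
      "rightmost_addable (pair_word (?M' c) (?M' (Suc c)) ?j) = Some b'"
      "mv b' ?j (?M' c, ?M' (Suc c)) = dmv p' (N c, N (Suc c))" by blast
    let ?c = "if b' then Suc c else c"
    have "site_f e h i ?M' = Some (?M'(?c := move ?j (?M' ?c)))"
      using pair(2) p'(2) by (simp add: site_f_def t(2) g_def)
    moreover have "?M'(?c := move ?j (?M' ?c)) = swap c p' N"
    proof
      fix d
      show "(?M'(?c := move ?j (?M' ?c))) d = swap c p' N d"
      proof (cases "d = c \<or> d = Suc c")
        case True
        then show ?thesis using p'(3) by (auto simp: mv_def dmv_def swap_def[of c p'] split: if_splits)
      next
        case False
        then show ?thesis by (auto simp: swap_def tc(2) b(3))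
      qed
    qed
    ultimately show ?thesis using p'(1) by auto
  qed
qed

section \<open>Rotation of the components\<close>

definition rot :: "nat \<Rightarrow> nat \<Rightarrow> (nat \<Rightarrow> int set) \<Rightarrow> nat \<Rightarrow> int set" where
  "rot e h M c = (if c < h then if c = 0 then (\<lambda>x. x + int e) ` M (h - 1) else M (c - 1) else M c)"

text \<open>The successor in the lexicographic order of the sites. The last component, shifted by
  \<open>e\<close>, becomes component 0 with \<open>t\<close> raised by one, so the order of reading
  is kept.\<close>

definition rot_site :: "nat \<Rightarrow> int \<times> nat \<Rightarrow> int \<times> nat" where
  "rot_site h n = (if Suc (snd n) < h then (fst n, Suc (snd n)) else (fst n + 1, 0))"

lemma shift_mem: "x \<in> (\<lambda>x. x + d) ` J \<longleftrightarrow> x - d \<in> J" for x d :: int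
  by (force simp: image_iff)

lemma cell_rot:
  assumes "snd n < h"
  shows "cell e i (rot e h M) (rot_site h n) = map (apsnd (rot_site h)) (cell e i M n)"
proof (cases "Suc (snd n) < h")
  case False
  then have "h - 1 = snd n" "h > 0" using assms by auto
  then show ?thesis using False
    by (auto simp: cell_def rot_def rot_site_def bletter_def shift_mem algebra_simps)
qed (auto simp: cell_def rot_def rot_site_def bletter_def)

lemma sites_rot:
  assumes "h > 0"
  shows "sites e h i (rot e h M) = rot_site h ` sites e h i M"
proof (intro equalityI subsetI)
  fix n assume n: "n \<in> sites e h i (rot e h M)"
  define n' where "n' = (if snd n = 0 then (fst n - 1, h - 1) else (fst n, snd n - 1))"
  have "rot_site h n' = n" "snd n' < h"
    using n assms by (auto simp: n'_def rot_site_def sites_def prod_eq_iff)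
  then show "n \<in> rot_site h ` sites e h i M"
    using n cell_rot[of n' h e i M] by (intro image_eqI[of _ _ n']) (auto simp: sites_def)
next
  fix n assume "n \<in> rot_site h ` sites e h i M"
  then obtain n' where n': "n' \<in> sites e h i M" "n = rot_site h n'" by blast
  then show "n \<in> sites e h i (rot e h M)"
    using cell_rot[of n' h e i M] assms by (auto simp: sites_def rot_site_def)
qed

lemma finite_sites:
  assumes "mayas h M" "e > 0" shows "finite (sites e h i M)"
proof -
  obtain K where K: "\<forall>n\<in>sites e h i M. \<bar>fst n\<bar> \<le> K" using sites_bounded[OF assms] by blast
  have "sites e h i M \<subseteq> {-K..K} \<times> {..<h}"
  proof
    fix n assume n: "n \<in> sites e h i M"
    then have "\<bar>fst n\<bar> \<le> K" using K by blast
    then show "n \<in> {-K..K} \<times> {..<h}" using n by (auto simp: sites_def mem_Times_iff)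
  qed
  then show ?thesis by (rule finite_subset) simp
qed

lemma site_word_rot:
  assumes "mayas h M" "e > 0" "h > 0"
  shows "site_word e h i (rot e h M) = map (apsnd (rot_site h)) (site_word e h i M)"
proof -
  let ?S = "sites e h i M" and ?r = "rot_site h"
  have mono: "?r n < ?r n'" if "n < n'" "snd n < h" "snd n' < h" for n n'
    using that by (auto simp: rot_site_def less_prod_def)
  have set: "set (sorted_list_of_set ?S) = ?S" using finite_sites[OF assms(1,2)] by simp
  have "sorted_wrt (<) (map ?r (sorted_list_of_set ?S))"
    unfolding sorted_wrt_map
    by (rule sorted_wrt_mono_rel[of _ "(<)"]) (use mono set in \<open>auto simp: sites_def\<close>)
  then have "sorted (map ?r (sorted_list_of_set ?S))" "distinct (map ?r (sorted_list_of_set ?S))"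
    by (simp_all add: strict_sorted_iff)
  then have sl: "sorted_list_of_set (?r ` ?S) = map ?r (sorted_list_of_set ?S)"
    using sorted_list_of_set.idem_if_sorted_distinct[of "map ?r (sorted_list_of_set ?S)"] set by simp
  have "site_word e h i (rot e h M) =
      concat (map (\<lambda>n. cell e i (rot e h M) (?r n)) (rev (sorted_list_of_set ?S)))"
    unfolding site_word_def sites_rot[OF assms(3)] sl by (simp add: rev_map comp_def)
  also have "\<dots> = concat (map (\<lambda>n. map (apsnd ?r) (cell e i M n)) (rev (sorted_list_of_set ?S)))"
    using set cell_rot by (intro arg_cong[of _ _ concat] map_cong) (auto simp: sites_def)
  finally show ?thesis by (simp add: site_word_def map_concat comp_def)
qed

lemma move_shift: "(\<lambda>x. x + d) ` move j J = move (j + d) ((\<lambda>x. x + d) ` J)" for d :: int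
  by (auto simp: move_def shift_mem)

lemma rot_commute:
  assumes "mayas h M" "e > 0" "h > 0"
  shows "site_f e h i (rot e h M) = map_option (rot e h) (site_f e h i M)"
proof (cases "rightmost_addable (site_word e h i M)")
  case (Some n)
  obtain t c where n: "n = (t, c)" by (cases n)
  have c: "c < h"
    using rightmost_addable_in[OF Some] finite_sites[OF assms(1,2)]
    by (auto simp: site_word_def cell_def bletter_def sites_def n split: if_splits)
  obtain t' c' where r: "rot_site h (t, c) = (t', c')" by fastforce
  have "(rot e h M)(c' := move (i + int e * t') (rot e h M c')) =
      rot e h (M(c := move (i + int e * t) (M c)))"
  proof
    fix d
    show "((rot e h M)(c' := move (i + int e * t') (rot e h M c'))) d =
        rot e h (M(c := move (i + int e * t) (M c))) d"
    proof (cases "Suc c < h")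
      case True
      then show ?thesis using r by (auto simp: rot_def rot_site_def)
    next
      case False
      then have "h - 1 = c" "t' = t + 1" "c' = 0" using r c by (auto simp: rot_site_def)
      then show ?thesis using c by (auto simp: rot_def move_shift algebra_simps)
    qed
  qed
  then show ?thesis using Some r by (simp add: site_f_def site_word_rot[OF assms] n)
qed (simp add: site_f_def site_word_rot[OF assms])

section \<open>Transferring relations between words\<close>

fun site_fs :: "nat \<Rightarrow> nat \<Rightarrow> int list \<Rightarrow> (nat \<Rightarrow> int set) \<Rightarrow> (nat \<Rightarrow> int set) option" where
  "site_fs e h [] M = Some M"
| "site_fs e h (i # w) M = Option.bind (site_f e h i M) (site_fs e h w)"

text \<open>Relations between words in the operators, and the string lengths along them, carry over from
  \<open>M\<close> to \<open>M'\<close>.\<close>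

definition dominates :: "nat \<Rightarrow> nat \<Rightarrow> (nat \<Rightarrow> int set) \<Rightarrow> (nat \<Rightarrow> int set) \<Rightarrow> bool" where
  "dominates e h M M' \<longleftrightarrow> (\<forall>w. (site_fs e h w M = None \<longleftrightarrow> site_fs e h w M' = None) \<and>
     (\<forall>v. site_fs e h w M = site_fs e h v M \<longrightarrow> site_fs e h w M' = site_fs e h v M') \<and>
     (\<forall>N N' i. site_fs e h w M = Some N \<longrightarrow> site_fs e h w M' = Some N' \<longrightarrow>
        phi_word (site_word e h i N) = phi_word (site_word e h i N') \<and>
        eps_word (site_word e h i N) = eps_word (site_word e h i N')))"

lemma dominates_refl: "dominates e h M M"
  by (simp add: dominates_def)

lemma dominatesD:
  assumes "dominates e h M M'"
  shows "site_fs e h w M = None \<longleftrightarrow> site_fs e h w M' = None"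
    "site_fs e h w M = site_fs e h v M \<Longrightarrow> site_fs e h w M' = site_fs e h v M'"
    "site_fs e h w M = Some N \<Longrightarrow> site_fs e h w M' = Some N' \<Longrightarrow>
       phi_word (site_word e h i N) = phi_word (site_word e h i N') \<and>
       eps_word (site_word e h i N) = eps_word (site_word e h i N')"
  using assms unfolding dominates_def by blast+

lemma dominates_trans:
  assumes "dominates e h M M'" "dominates e h M' M''" shows "dominates e h M M''"
  unfolding dominates_def
proof (intro allI conjI impI)
  fix w
  show "site_fs e h w M = None \<longleftrightarrow> site_fs e h w M'' = None"
    using dominatesD(1)[OF assms(1)] dominatesD(1)[OF assms(2)] by simp
next
  fix w v assume "site_fs e h w M = site_fs e h v M"
  then show "site_fs e h w M'' = site_fs e h v M''" by (intro dominatesD(2)[OF assms(2)] dominatesD(2)[OF assms(1)])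
next
  fix w N N'' i assume *: "site_fs e h w M = Some N" "site_fs e h w M'' = Some N''"
  then obtain N' where N': "site_fs e h w M' = Some N'"
    using dominatesD(1)[OF assms(1), of w] by fastforce
  show "phi_word (site_word e h i N) = phi_word (site_word e h i N'')"
    "eps_word (site_word e h i N) = eps_word (site_word e h i N'')"
    using dominatesD(3)[OF assms(1) *(1) N'] dominatesD(3)[OF assms(2) N' *(2)] by simp_all
qed

text \<open>A simulation \<open>R\<close> along the operators suffices. As \<open>R\<close> is
  functional, equal results on the side of \<open>M\<close> force equal results on the side of
  \<open>M'\<close>.\<close>

lemma dominatesI:
  assumes "R M M'"
    and counts: "\<And>M M' i. R M M' \<Longrightarrow> phi_word (site_word e h i M) = phi_word (site_word e h i M') \<and>
        eps_word (site_word e h i M) = eps_word (site_word e h i M')"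
    and step: "\<And>M M' i N. R M M' \<Longrightarrow> site_f e h i M = Some N \<Longrightarrow> \<exists>N'. site_f e h i M' = Some N' \<and> R N N'"
    and fn: "\<And>M M' M''. R M M' \<Longrightarrow> R M M'' \<Longrightarrow> M' = M''"
  shows "dominates e h M M'"
proof -
  have *: "(site_fs e h w M = None \<and> site_fs e h w M' = None) \<or>
      (\<exists>N N'. site_fs e h w M = Some N \<and> site_fs e h w M' = Some N' \<and> R N N')" if "R M M'" for w M M'
    using that
  proof (induction w arbitrary: M M')
    case (Cons i w)
    show ?case
    proof (cases "site_f e h i M")
      case None
      then have "site_f e h i M' = None" using counts[OF Cons.prems] site_f_eq_None by metis
      then show ?thesis using None by simp
    next
      case (Some N)
      then obtain N' where N': "site_f e h i M' = Some N'" "R N N'" using step[OF Cons.prems] by blast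
      then show ?thesis using Cons.IH[OF N'(2)] Some by simp
    qed
  qed simp
  show ?thesis unfolding dominates_def
  proof (intro allI conjI impI)
    fix w v
    show "site_fs e h w M = None \<longleftrightarrow> site_fs e h w M' = None" using *[OF assms(1), of w] by auto
    assume "site_fs e h w M = site_fs e h v M"
    then show "site_fs e h w M' = site_fs e h v M'" using *[OF assms(1), of w] *[OF assms(1), of v] fn by auto
  next
    fix w N N' i assume "site_fs e h w M = Some N" "site_fs e h w M' = Some N'"
    then have "R N N'" using *[OF assms(1), of w] by auto
    then show "phi_word (site_word e h i N) = phi_word (site_word e h i N')"
      "eps_word (site_word e h i N) = eps_word (site_word e h i N')" using counts by auto
  qed
qed

text \<open>The bead that passes may change with every step, but it is determined by the current
  configuration, which makes the relation functional.\<close>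

lemma dominates_swap:
  assumes "mayas h M" "e > 0" "Suc c < h" "rightmost_addable (dword (M c) (M (Suc c))) = Some p"
  shows "dominates e h M (swap c p M)"
proof (rule dominatesI[where R = "\<lambda>M M'. mayas h M \<and>
    (\<exists>p. rightmost_addable (dword (M c) (M (Suc c))) = Some p \<and> M' = swap c p M)"], goal_cases)
  case (2 M M' i)
  then show ?case using swap_commute(1,2)[OF _ assms(2,3)] by metis
next
  case (3 M M' i N)
  then obtain p where p: "rightmost_addable (dword (M c) (M (Suc c))) = Some p" "M' = swap c p M"
    by blast
  then show ?case
    using swap_commute(3)[OF _ assms(2,3) p(1) 3(2)] site_f_mayas[OF _ 3(2)] 3(1) by blast
qed (use assms in auto)

lemma dominates_rot:
  assumes "mayas h M" "e > 0" "h > 0"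
  shows "dominates e h M (rot e h M)"
proof (rule dominatesI[where R = "\<lambda>M M'. mayas h M \<and> M' = rot e h M"], goal_cases)
  case (2 M M' i)
  then show ?case by (simp add: site_word_rot[OF _ assms(2,3)])
next
  case (3 M M' i N)
  then show ?case using rot_commute[OF _ assms(2,3), of M i] site_f_mayas[of h M e i N] by auto
qed (use assms in auto)

section \<open>Separating the charges of vacua\<close>

lemma all_Addable:
  "\<forall>x\<in>set w. fst x = Addable \<Longrightarrow> phi_word w = length w \<and> eps_word w = 0"
  by (induction w rule: word_induct) auto

lemma all_Removable:
  "\<forall>x\<in>set w. fst x = Removable \<Longrightarrow> phi_word w = 0 \<and> eps_word w = length w"
  by (induction w rule: word_induct) auto

text \<open>The entries of \<open>xs\<close> are the first free positions, that is, the charges plus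
  one; see \<open>beta_empty\<close>.\<close>

definition vacua :: "int list \<Rightarrow> nat \<Rightarrow> int set" where
  "vacua xs c = (if c < length xs then {..<xs ! c} else {})"

lemma maya_lessThan: "maya {..<s}"
  unfolding maya_def by (intro exI[of _ "\<bar>s\<bar>"]) auto

lemma mayas_vacua: "mayas (length xs) (vacua xs)"
  by (simp add: mayas_def vacua_def maya_lessThan)

text \<open>The intermediate state of an exchange of two vacua: the beads from \<open>u\<close> to
  \<open>s - 1\<close> have already passed. They are read as \<open>R\<close>s after the
  \<open>A\<close>s from \<open>t\<close> to \<open>u - 1\<close>, so nothing cancels and
  \<open>u - 1\<close> passes next.\<close>

lemma dword_vacua:
  fixes s t u :: int
  assumes "t < u" "u \<le> s"
  shows "rightmost_addable (dword {..<u} ({..<t} \<union> {u..<s})) = Some (u - 1)"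
proof -
  let ?X = "{..<u}" and ?Y = "{..<t} \<union> {u..<s}"
  let ?d = "dletter ?X ?Y"
  have "(?X - ?Y) \<union> (?Y - ?X) \<subseteq> {t..s - 1}" using assms by auto
  moreover have "[t..s - 1] = [t..u - 2] @ (u - 1) # [u..s - 1]"
    using assms upto_split1[of t "u - 1" "s - 1"] upto_rec1[of "u - 1" "s - 1"] by simp
  ultimately have "dword ?X ?Y = concat (map ?d [t..u - 2]) @ ?d (u - 1) @ concat (map ?d [u..s - 1])"
    using dword_eq[of ?X ?Y t "s - 1"] by simp
  moreover have "?d (u - 1) = [(Addable, u - 1)]" using assms by (simp add: dletter_def)
  moreover have "\<forall>x\<in>set (concat (map ?d [t..u - 2])). fst x = Addable"
    by (auto simp: dletter_def)
  moreover have "\<forall>x\<in>set (concat (map ?d [u..s - 1])). fst x = Removable"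
    using assms by (auto simp: dletter_def)
  ultimately show ?thesis
    using all_Addable[of "concat (map ?d [t..u - 2])"] all_Removable[of "concat (map ?d [u..s - 1])"]
    by (simp add: rightmost_addable_append)
qed

text \<open>Beads pass only from \<open>c\<close> to \<open>c + 1\<close>, so the larger entry has
  to stand on the left. The number of beads that pass is the difference of the two entries.\<close>

lemma dominates_vacua_swap:
  assumes "Suc c < length xs" "xs ! Suc c \<le> xs ! c" "e > 0"
  shows "dominates e (length xs) (vacua xs) (vacua (xs[c := xs ! Suc c, Suc c := xs ! c]))"
proof -
  define s t where "s = xs ! c" and "t = xs ! Suc c"
  \<comment> \<open>The \<open>k\<close> topmost beads of component \<open>c\<close> have passed to
    the next one.\<close>
  define M where "M = (\<lambda>k. (vacua xs)(c := {..<s - int k}, Suc c := {..<t} \<union> {s - int k..<s}))"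
  have mM: "mayas (length xs) (M k)" for k
  proof -
    have "maya ({..<t} \<union> {s - int k..<s})"
      unfolding maya_def by (intro exI[of _ "\<bar>s\<bar> + \<bar>t\<bar>"]) auto
    then show ?thesis using mayas_vacua[of xs] by (auto simp: mayas_def M_def maya_lessThan)
  qed
  have "dominates e (length xs) (vacua xs) (M k)" if "k \<le> nat (s - t)" for k
    using that
  proof (induction k)
    case 0
    have "M 0 = vacua xs" by (rule ext) (use assms(1) in \<open>auto simp: M_def s_def t_def vacua_def\<close>)
    then show ?case by (simp add: dominates_refl)
  next
    case (Suc k)
    then have "int k < s - t" by auto
    then have "rightmost_addable (dword (M k c) (M k (Suc c))) = Some (s - int k - 1)"
      using dword_vacua[of t "s - int k" s] by (simp add: M_def)
    from dominates_swap[of "length xs" "M k", OF mM assms(3,1) this]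
    have "dominates e (length xs) (M k) (swap c (s - int k - 1) (M k))" .
    moreover have "swap c (s - int k - 1) (M k) = M (Suc k)"
      by (rule ext) (auto simp: swap_def M_def)
    ultimately show ?case using Suc dominates_trans by auto
  qed
  moreover have "M (nat (s - t)) = vacua (xs[c := t, Suc c := s])"
    using assms(1,2) unfolding s_def[symmetric] t_def[symmetric]
    by (intro ext) (auto simp: M_def vacua_def nth_list_update)
  ultimately show ?thesis unfolding s_def t_def by (metis order_refl)
qed

text \<open>Insertion sort, carried out by exchanges of neighbours. The prefix \<open>us\<close>
  stays in place and is there for the induction.\<close>

lemma dominates_vacua_insort:
  assumes "e > 0"
  shows "dominates e (length us + Suc (length ys)) (vacua (us @ x # ys)) (vacua (us @ insort x ys))"
proof (induction ys arbitrary: us)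
  case (Cons y ys)
  show ?case
  proof (cases "x \<le> y")
    case True
    then show ?thesis by (simp add: dominates_refl)
  next
    case False
    have "dominates e (length us + Suc (length (y # ys))) (vacua (us @ x # y # ys)) (vacua (us @ y # x # ys))"
      using dominates_vacua_swap[of "length us" "us @ x # y # ys" e] False assms
      by (simp add: nth_append list_update_append)
    then show ?thesis using Cons[of "us @ [y]"] False by (auto intro: dominates_trans)
  qed
qed (simp add: dominates_refl)

lemma dominates_vacua_sort:
  assumes "e > 0"
  shows "dominates e (length us + length xs) (vacua (us @ xs)) (vacua (us @ sort xs))"
proof (induction xs arbitrary: us)
  case (Cons x xs)
  then show ?case
    using Cons[of "us @ [x]"] dominates_vacua_insort[OF assms, of us "sort xs" x]
    by (auto intro: dominates_trans)
qed (simp add: dominates_refl)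

lemma dominates_vacua_rot:
  assumes "xs \<noteq> []" "e > 0"
  shows "dominates e (length xs) (vacua xs) (vacua ((last xs + int e) # butlast xs))"
proof -
  have "rot e (length xs) (vacua xs) = vacua ((last xs + int e) # butlast xs)"
    by (rule ext) (use assms in \<open>auto simp: rot_def vacua_def last_conv_nth nth_butlast shift_mem nth_Cons'\<close>)
  then show ?thesis
    using dominates_rot[OF mayas_vacua[of xs] assms(2)] assms(1) by simp
qed

lemma dominates_vacua_rots:
  assumes "s \<le> length xs" "e > 0"
  shows "dominates e (length xs) (vacua xs)
    (vacua (map (\<lambda>x. x + int e) (drop (length xs - s) xs) @ take (length xs - s) xs))"
  using assms(1)
proof (induction s)
  case (Suc s)
  let ?L = "\<lambda>s. map (\<lambda>x. x + int e) (drop (length xs - s) xs) @ take (length xs - s) xs"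
  let ?k = "length xs - Suc s"
  have k: "length xs - s = Suc ?k" "?k < length xs" using Suc.prems by auto
  have "?L s = map (\<lambda>x. x + int e) (drop (Suc ?k) xs) @ take ?k xs @ [xs ! ?k]"
    by (simp only: k(1) take_Suc_conv_app_nth[OF k(2)])
  then have "(last (?L s) + int e) # butlast (?L s) = ?L (Suc s)"
    using Cons_nth_drop_Suc[OF k(2)] by (simp add: butlast_append) (metis list.simps(9))
  moreover have "?L s \<noteq> []" "length (?L s) = length xs" using Suc.prems by auto
  ultimately have "dominates e (length xs) (vacua (?L s)) (vacua (?L (Suc s)))"
    using dominates_vacua_rot[of "?L s" e] assms(2) by simp
  then show ?case using Suc by (auto intro: dominates_trans)
qed (simp add: dominates_refl)

definition tops :: "nat \<Rightarrow> nat \<Rightarrow> int \<Rightarrow> (nat \<Rightarrow> nat) \<Rightarrow> int list" where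
  "tops e h m g = map (\<lambda>c. m + int e * int (g c)) [0..<h]"

text \<open>After \<open>s\<close> rotations the last \<open>s\<close> entries are raised by
  \<open>e\<close> and stand in front. Sorting puts them back at the end, because \<open>g\<close>
  is monotone and they are still the largest.\<close>

lemma dominates_tops_step:
  assumes "mono g" "e > 0" "s \<le> h"
  shows "dominates e h (vacua (tops e h m g)) (vacua (tops e h m (\<lambda>c. g c + of_bool (h - s \<le> c))))"
proof -
  let ?x = "tops e h m g" and ?y = "tops e h m (\<lambda>c. g c + of_bool (h - s \<le> c))"
  let ?L = "map (\<lambda>x. x + int e) (drop (h - s) ?x) @ take (h - s) ?x"
  have [simp]: "length ?x = h" by (simp add: tops_def)
  have y: "?y = take (h - s) ?x @ map (\<lambda>x. x + int e) (drop (h - s) ?x)"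
    by (rule nth_equalityI) (use assms(3) in \<open>auto simp: tops_def nth_append algebra_simps\<close>)
  have "mset ?y = mset ?L" unfolding y mset_append by (rule add.commute)
  moreover have "g i + of_bool (h - s \<le> i) \<le> g j + of_bool (h - s \<le> j)" if "i \<le> j" for i j
    using monoD[OF assms(1) that] that by auto
  then have "int e * int (g i + of_bool (h - s \<le> i)) \<le> int e * int (g j + of_bool (h - s \<le> j))"
    if "i < j" for i j
    using that by (intro mult_left_mono) (simp_all only: of_nat_le_iff less_imp_le of_nat_0_le_iff)
  then have "sorted ?y"
    unfolding tops_def sorted_iff_nth_mono_less by simp
  ultimately have "sort ?L = ?y" by (metis properties_for_sort)
  then show ?thesis
    using dominates_vacua_rots[of s ?x e] dominates_vacua_sort[of e "[]" ?L] assms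
    by (auto intro: dominates_trans)
qed

text \<open>Raising the last component, then the last two, up to the last \<open>s\<close>, adds up
  to \<open>c - (h - 1 - s)\<close> in component \<open>c\<close>. A full round with
  \<open>s = h - 1\<close> raises component \<open>c\<close> by \<open>c\<close>, which makes all
  charges different.\<close>

lemma dominates_tops_round:
  assumes "mono g" "e > 0" "s < h"
  shows "dominates e h (vacua (tops e h m g)) (vacua (tops e h m (\<lambda>c. g c + (c - (h - 1 - s)))))"
  using assms(3)
proof (induction s)
  case 0
  have "tops e h m (\<lambda>c. g c + (c - (h - 1 - 0))) = tops e h m g" by (auto simp: tops_def)
  then show ?case by (simp add: dominates_refl)
next
  case (Suc s)
  let ?g = "\<lambda>c. g c + (c - (h - 1 - s))"
  have "mono ?g" using assms(1) by (auto simp: mono_def intro!: add_mono diff_le_mono)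
  from dominates_tops_step[OF this assms(2), of "Suc s" h m]
  have "dominates e h (vacua (tops e h m ?g))
      (vacua (tops e h m (\<lambda>c. ?g c + of_bool (h - Suc s \<le> c))))" using Suc.prems by simp
  moreover have "(\<lambda>c. ?g c + of_bool (h - Suc s \<le> c)) = (\<lambda>c. g c + (c - (h - 1 - Suc s)))"
    using Suc.prems by (auto simp: fun_eq_iff)
  ultimately show ?case using Suc by (auto intro: dominates_trans)
qed

lemma dominates_tops:
  assumes "e > 0"
  shows "dominates e h (vacua (tops e h m (\<lambda>_. 0))) (vacua (tops e h m (\<lambda>c. N * c)))"
proof (cases "h = 0")
  case False
  show ?thesis
  proof (induction N)
    case (Suc N)
    have "mono (\<lambda>c. N * c)" by (auto simp: mono_def)
    from dominates_tops_round[OF this assms, of "h - 1" h m]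
    have "dominates e h (vacua (tops e h m (\<lambda>c. N * c))) (vacua (tops e h m (\<lambda>c. Suc N * c)))"
      using False by (simp add: add.commute)
    then show ?case using Suc by (auto intro: dominates_trans)
  qed (simp add: dominates_refl)
qed (simp add: tops_def dominates_refl)

section \<open>Signatures in terms of beta numbers\<close>

lemma word_map_sign:
  "phi_word (map (\<lambda>(s, a). (s, g s a)) w) = phi_word w"
  "eps_word (map (\<lambda>(s, a). (s, g s a)) w) = eps_word w"
  "rightmost_addable (map (\<lambda>(s, a). (s, g s a)) w) = map_option (g Addable) (rightmost_addable w)"
proof -
  have *: "phi_word (map (\<lambda>(s, a). (s, g s a)) w) = phi_word w" for w
    by (induction w rule: word_induct) auto
  show "phi_word (map (\<lambda>(s, a). (s, g s a)) w) = phi_word w" by (fact *)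
  show "eps_word (map (\<lambda>(s, a). (s, g s a)) w) = eps_word w"
    by (induction w rule: word_induct) (auto simp: *)
  show "rightmost_addable (map (\<lambda>(s, a). (s, g s a)) w) = map_option (g Addable) (rightmost_addable w)"
    by (induction w rule: word_induct) (auto simp: *)
qed

lemma beta_strict:
  assumes "is_partition l" "a < b"
  shows "int (l b) + m - int b < int (l a) + m - int a"
  using is_partitionD[OF assms(1), of a b] assms(2) by linarith

lemma beta_inj:
  assumes "is_partition l" "is_partition l'" "beta m l = beta m l'"
  shows "l = l'"
proof
  fix k show "l k = l' k"
  proof (induction k rule: less_induct)
    case (less k)
    have *: "int (l k) \<le> int (l' k)" if l: "is_partition l" "is_partition l'"
      "beta m l = beta m l'" "\<And>j. j < k \<Longrightarrow> l j = l' j" for l l' :: "nat \<Rightarrow> nat"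
    proof -
      obtain j where j: "int (l k) + m - int k = int (l' j) + m - int j"
        using l(3) unfolding beta_def by blast
      have "\<not> j < k" using j l(4)[of j] beta_strict[OF l(1), of j k m] by auto
      then show ?thesis using j beta_strict[OF l(2), of k j m] by (cases "j = k") auto
    qed
    have "int (l k) \<le> int (l' k)" by (rule *) (use assms less in auto)
    moreover have "int (l' k) \<le> int (l k)" by (rule *) (use assms less in auto)
    ultimately show ?case by simp
  qed
qed

lemma beta_empty: "beta m empty_partition = {..<m + 1}"
proof -
  have "x \<in> beta m empty_partition" if "x < m + 1" for x
    using that by (auto simp: beta_def empty_partition_def image_iff intro!: exI[of _ "nat (m - x)"])
  then show ?thesis by (auto simp: beta_def empty_partition_def)
qed

lemma maya_beta: assumes "is_partition l" shows "maya (beta m l)"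
proof -
  have "x \<in> beta m l" if x: "x < m - int (rows l)" for x
  proof -
    have "l (nat (m - x)) = 0" using x partition_eq_0_iff[OF assms] by simp
    then show ?thesis using x by (auto simp: beta_def image_iff intro!: exI[of _ "nat (m - x)"])
  qed
  moreover have "x \<le> m + int (l 0)" if x: "x \<in> beta m l" for x
  proof -
    obtain k where "x = int (l k) + m - int k" using x by (auto simp: beta_def)
    then show ?thesis using is_partitionD[OF assms, of 0 k] by simp
  qed
  ultimately show ?thesis
    unfolding maya_def by (intro exI[of _ "\<bar>m\<bar> + int (rows l) + int (l 0) + 1"]) force
qed

lemma beta_add_node:
  assumes "is_partition l" "addable e m' i l a"
  shows "beta m (add_node a l) = move (int (l a) + m - int a) (beta m l)"
proof -
  have ne: "int (l k) + m - int k \<noteq> int (l a) + m - int a" if "k \<noteq> a" for k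
    using that beta_strict[OF assms(1), of k a m] beta_strict[OF assms(1), of a k m]
    by (cases "k < a") auto
  have "x \<in> beta m (add_node a l) \<longleftrightarrow> x \<in> move (int (l a) + m - int a) (beta m l)" for x
  proof -
    have "x \<in> beta m (add_node a l) \<longleftrightarrow>
        x = int (l a) + m - int a + 1 \<or> (\<exists>k. k \<noteq> a \<and> x = int (l k) + m - int k)"
      by (auto simp: beta_def add_node_def image_iff)
    also have "\<dots> \<longleftrightarrow> x \<in> move (int (l a) + m - int a) (beta m l)"
    proof -
      have "x \<in> beta m l - {int (l a) + m - int a} \<longleftrightarrow> (\<exists>k. k \<noteq> a \<and> x = int (l k) + m - int k)"
      proof
        assume "x \<in> beta m l - {int (l a) + m - int a}"
        then have "x \<in> beta m l" "x \<noteq> int (l a) + m - int a" by simp_all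
        moreover from this obtain k where "x = int (l k) + m - int k" unfolding beta_def by (elim rangeE)
        ultimately obtain k where k: "x = int (l k) + m - int k" "x \<noteq> int (l a) + m - int a" by metis
        then show "\<exists>k. k \<noteq> a \<and> x = int (l k) + m - int k"
          by (intro exI[of _ k]) auto
      next
        assume "\<exists>k. k \<noteq> a \<and> x = int (l k) + m - int k"
        then obtain k where k: "k \<noteq> a" "x = int (l k) + m - int k" by blast
        then have "x \<in> beta m l" unfolding beta_def by (intro image_eqI[of _ _ k]) simp_all
        moreover have "x \<noteq> int (l a) + m - int a" using ne[OF k(1)] k(2) by simp
        ultimately show "x \<in> beta m l - {int (l a) + m - int a}" by simp
      qed
      then show ?thesis by (simp only: move_def insert_iff)
    qed
    finally show ?thesis .
  qed
  then show ?thesis by blast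
qed

text \<open>The left one of the two positions between which the bead of the node moves. The bead of
  a removable node stands on the right one, hence the correction by one.\<close>

definition node_pos :: "(nat \<Rightarrow> nat) \<Rightarrow> int \<Rightarrow> node_sign \<Rightarrow> nat \<Rightarrow> int" where
  "node_pos l m s a = int (l a) + m - int a - of_bool (s = Removable)"

lemma node_pos_letter:
  assumes "is_partition l"
  shows "addable e m i l a \<Longrightarrow> bletter (beta m l) (node_pos l m Addable a) p = [(Addable, p)]"
    "removable e m i l a \<Longrightarrow> bletter (beta m l) (node_pos l m Removable a) p = [(Removable, p)]"
proof -
  have in_beta: "int (l a) + m - int a \<in> beta m l" for a by (auto simp: beta_def)
  { assume ad: "addable e m i l a"
    have "int (l k) + m - int k \<noteq> int (l a) + m - int a + 1" for k
    proof (cases "k < a")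
      case True
      then have "l a < l (a - 1)" "l (a - 1) \<le> l k"
        using ad is_partitionD[OF assms, of k "a - 1"] by (auto simp: addable_def)
      then show ?thesis using True by linarith
    next
      case False
      then show ?thesis using is_partitionD[OF assms, of a k] by simp
    qed
    then have "int (l a) + m - int a + 1 \<notin> beta m l" by (force simp: beta_def)
    then show "bletter (beta m l) (node_pos l m Addable a) p = [(Addable, p)]"
      using in_beta[of a] by (simp add: bletter_def node_pos_def) }
  { assume re: "removable e m i l a"
    have "int (l k) + m - int k \<noteq> int (l a) + m - int a - 1" for k
    proof (cases "k \<le> a")
      case True
      then show ?thesis using is_partitionD[OF assms, of k a] by simp
    next
      case False
      then have "l k \<le> l (Suc a)" "l (Suc a) < l a"
        using re is_partitionD[OF assms, of "Suc a" k] by (auto simp: removable_def)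
      then show ?thesis using False by linarith
    qed
    then have "int (l a) + m - int a - 1 \<notin> beta m l" by (force simp: beta_def)
    then show "bletter (beta m l) (node_pos l m Removable a) p = [(Removable, p)]"
      using in_beta[of a] by (simp add: bletter_def node_pos_def) }
qed

lemma letter_node_pos:
  assumes "is_partition l" "bletter (beta m l) j p \<noteq> []" "j mod int e = i mod int e"
  shows "\<exists>s a. (s, a) \<in> set (signature e m i l) \<and> node_pos l m s a = j"
proof (cases "j \<in> beta m l")
  case True
  then obtain a where a: "j = int (l a) + m - int a" by (auto simp: beta_def)
  have j1: "j + 1 \<notin> beta m l" using assms(2) True by (auto simp: bletter_def split: if_splits)
  have "a = 0 \<or> l a < l (a - 1)"
  proof (rule ccontr)
    assume "\<not> (a = 0 \<or> l a < l (a - 1))"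
    then have "a > 0" "l (a - 1) = l a" using is_partitionD[OF assms(1), of "a - 1" a] by auto
    then have "j + 1 = int (l (a - 1)) + m - int (a - 1)" using a by (simp add: of_nat_diff)
    then show False using j1 by (auto simp: beta_def)
  qed
  then have "addable e m i l a" using assms(3) a by (simp add: addable_res algebra_simps)
  then show ?thesis using a set_signature[OF assms(1)] by (auto simp: node_pos_def)
next
  case False
  then have "j + 1 \<in> beta m l" using assms(2) by (auto simp: bletter_def split: if_splits)
  then obtain a where a: "j + 1 = int (l a) + m - int a" by (auto simp: beta_def)
  have "l (Suc a) < l a"
  proof (rule ccontr)
    assume "\<not> l (Suc a) < l a"
    then have "l (Suc a) = l a" using is_partition_Suc[OF assms(1), of a] by simp
    then have "j = int (l (Suc a)) + m - int (Suc a)" using a by simp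
    then have "j \<in> beta m l" unfolding beta_def by (rule image_eqI) simp
    then show False using False by simp
  qed
  moreover have "m - int a + int (l a) - 1 = j" using a by simp
  ultimately have "removable e m i l a" using assms(3) by (simp add: removable_res)
  then show ?thesis using a set_signature[OF assms(1)]
    by (intro exI[of _ Removable] exI[of _ a]) (auto simp: node_pos_def)
qed

text \<open>The signature of a partition, with the nodes replaced by the indices \<open>t\<close> of the sites
  \<open>i + e t, i + e t + 1\<close> of its set of beta numbers.\<close>

lemma signature_window:
  assumes "is_partition l" "e \<ge> 2"
  shows "\<exists>K0. \<forall>K\<ge>K0. concat (map (\<lambda>t. bletter (beta m l) (i + int e * t) t) (rev [-K..K])) =
    map (\<lambda>(s, a). (s, (node_pos l m s a - i) div int e)) (signature e m i l)"
proof -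
  let ?b = "\<lambda>t. bletter (beta m l) (i + int e * t) t"
  let ?w = "map (\<lambda>(s, a). (s, (node_pos l m s a - i) div int e)) (signature e m i l)"
  let ?ts = "map snd ?w"
  have e0: "0 < int e" using assms(2) by simp
  have pos: "i + int e * ((node_pos l m s a - i) div int e) = node_pos l m s a"
    if "(s, a) \<in> set (signature e m i l)" for s a
  proof -
    have "node_pos l m s a mod int e = i mod int e"
      using that unfolding set_signature[OF assms(1)] node_pos_def
      by (auto simp: addable_res removable_res algebra_simps)
    then have "int e dvd node_pos l m s a - i" by (simp add: mod_eq_dvd_iff)
    then show ?thesis by simp
  qed
  have w: "?b t = [(s, t)]" if st: "(s, t) \<in> set ?w" for s t
  proof -
    obtain a where a: "(s, a) \<in> set (signature e m i l)" "t = (node_pos l m s a - i) div int e"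
      using st by auto
    then show ?thesis
      using pos[OF a(1)] node_pos_letter[OF assms(1)] set_signature[OF assms(1), of s a e m i] by auto
  qed
  have set_ts: "t \<in> set ?ts \<longleftrightarrow> ?b t \<noteq> []" for t
  proof
    assume "t \<in> set ?ts"
    then obtain x where "x \<in> set ?w" "t = snd x" unfolding set_map[of snd] by blast
    then have "(fst x, t) \<in> set ?w" by simp
    then show "?b t \<noteq> []" using w by simp
  next
    assume "?b t \<noteq> []"
    then obtain s a where sa: "(s, a) \<in> set (signature e m i l)" "node_pos l m s a = i + int e * t"
      using letter_node_pos[OF assms(1), of m "i + int e * t" t e i] by auto
    then have "(node_pos l m s a - i) div int e = t" using e0 by simp
    then show "t \<in> set ?ts" using sa(1) by force
  qed
  have strict: "node_pos l m s' b < node_pos l m s a"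
    if "a < b" "(s, a) \<in> set (signature e m i l)" "(s', b) \<in> set (signature e m i l)" for a b s s'
  proof (cases "s = Removable \<and> s' = Addable")
    case True
    \<comment> \<open>Here the position in row \<open>a\<close> is one lower than its bead, and
      \<open>beta_strict\<close> is not enough; the missing unit comes from the addability in row
      \<open>b\<close>.\<close>
    then have "l b < l (b - 1)" "l (b - 1) \<le> l a"
      using that set_signature[OF assms(1)] is_partitionD[OF assms(1), of a "b - 1"]
      by (auto simp: addable_def)
    then show ?thesis using True that(1) by (simp add: node_pos_def)
  next
    case False
    then show ?thesis using beta_strict[OF assms(1) that(1), of m]
      by (cases s; cases s') (auto simp: node_pos_def)
  qed
  have "sorted_wrt (\<lambda>x y. (node_pos l m (fst y) (snd y) - i) div int e <
      (node_pos l m (fst x) (snd x) - i) div int e) (signature e m i l)"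
  proof (rule sorted_wrt_mono_rel[OF _ sorted_signature[OF assms, of m i]])
    fix x y assume xy: "x \<in> set (signature e m i l)" "y \<in> set (signature e m i l)" "snd x < snd y"
    have "i + int e * ((node_pos l m (fst y) (snd y) - i) div int e) <
        i + int e * ((node_pos l m (fst x) (snd x) - i) div int e)"
      using strict[OF xy(3), of "fst x" "fst y"] xy(1,2) pos[of "fst x" "snd x"] pos[of "fst y" "snd y"]
      by simp
    then show "(node_pos l m (fst y) (snd y) - i) div int e <
        (node_pos l m (fst x) (snd x) - i) div int e" using e0 by simp
  qed
  then have sorted: "sorted_wrt (>) ?ts"
    by (simp add: sorted_wrt_map split_beta comp_def)
  have w_ts: "?w = concat (map ?b ?ts)"
  proof -
    have *: "concat (map ?b (map snd v)) = v" if "set v \<subseteq> set ?w" for v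
      using that
    proof (induction v)
      case (Cons x v)
      from Cons.prems have "x \<in> set ?w" "set v \<subseteq> set ?w" by (simp_all only: set_simps insert_subset)
      moreover from this have "?b (snd x) = [x]" using w[of "fst x" "snd x"] by (simp only: prod.collapse)
      ultimately show ?case using Cons.IH by (simp only: list.map concat.simps append_Cons append_Nil)
    qed simp
    show ?thesis by (rule *[OF order_refl, symmetric])
  qed
  show ?thesis
  proof (intro exI allI impI)
    fix K assume K: "K \<ge> Max (insert 0 (abs ` set ?ts))"
    have "t \<in> {-K..K}" if "t \<in> set ?ts" for t
    proof -
      have "\<bar>t\<bar> \<le> Max (insert 0 (abs ` set ?ts))" by (rule Max_ge) (use that in auto)
      then have "\<bar>t\<bar> \<le> K" using K by (rule order_trans)
      then show ?thesis by auto
    qed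
    then have "t \<in> set (filter (\<lambda>t. ?b t \<noteq> []) (rev [-K..K])) \<longleftrightarrow> t \<in> set ?ts" for t
      using set_ts[of t] by (simp only: set_filter mem_Collect_eq set_rev set_upto) blast
    then have "set (filter (\<lambda>t. ?b t \<noteq> []) (rev [-K..K])) = set ?ts" by (rule set_eqI)
    moreover have "sorted_wrt (>) (filter (\<lambda>t. ?b t \<noteq> []) (rev [-K..K]))"
      by (rule sorted_wrt_filter[OF sorted_rev_upto])
    ultimately have ts: "filter (\<lambda>t. ?b t \<noteq> []) (rev [-K..K]) = ?ts"
      using sorted_list_unique[of "filter (\<lambda>t. ?b t \<noteq> []) (rev [-K..K])"]
        sorted_list_unique[OF sorted] by (simp only:)
    show "concat (map ?b (rev [-K..K])) = ?w"
      using concat_map_filter[of ?b "rev [-K..K]"] unfolding ts w_ts[symmetric] by (rule sym)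
  qed
qed

lemma eventually_both:
  fixes P Q :: "int \<Rightarrow> bool"
  assumes "\<exists>K0. \<forall>K\<ge>K0. P K" "\<exists>K0. \<forall>K\<ge>K0. Q K"
  shows "\<exists>K. P K \<and> Q K"
proof -
  obtain a b where "\<forall>K\<ge>a. P K" "\<forall>K\<ge>b. Q K" using assms by blast
  then show ?thesis by (intro exI[of _ "max a b"]) auto
qed

section \<open>Configurations with equal components\<close>

definition copies :: "nat \<Rightarrow> int set \<Rightarrow> nat \<Rightarrow> int set" where
  "copies h J c = (if c < h then J else {})"

lemma mayas_copies: "maya J \<Longrightarrow> mayas h (copies h J)"
  by (simp add: mayas_def copies_def)

lemma phi_eps_scaled_blocks:
  assumes "\<And>t. t \<in> set ts \<Longrightarrow> phi_word (W t) = h * phi_word (b t) \<and> eps_word (W t) = h * eps_word (b t)"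
  shows "phi_word (concat (map W ts)) = h * phi_word (concat (map b ts)) \<and>
    eps_word (concat (map W ts)) = h * eps_word (concat (map b ts))"
  using assms
  by (induction ts) (auto simp: phi_word_append eps_word_append algebra_simps diff_mult_distrib2)

text \<open>After \<open>k\<close> of the \<open>h\<close> letters at \<open>t\<^sub>0\<close> have been changed, the next change still happens at
  \<open>t\<^sub>0\<close>: all other contributions are multiples of \<open>h\<close>.\<close>

lemma rightmost_addable_scaled_blocks:
  assumes "\<And>t. t \<in> set ts \<Longrightarrow> t \<noteq> t0 \<Longrightarrow>
      phi_word (W t) = h * phi_word (b t) \<and> eps_word (W t) = h * eps_word (b t)"
    and "\<And>t. t \<in> set ts \<Longrightarrow> \<exists>s. b t = [(s, t)] \<or> b t = []"
    and "rightmost_addable (concat (map b ts)) = Some t0" "distinct ts" "b t0 = [(Addable, t0)]"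
    and "phi_word (W t0) = h - k" "eps_word (W t0) = k" "k < h"
  shows "rightmost_addable (concat (map W ts)) = rightmost_addable (W t0) \<and>
    phi_word (concat (map W ts)) + k = h * phi_word (concat (map b ts))"
  using assms(1-4)
proof (induction ts)
  case (Cons t ts)
  show ?case
  proof (cases "t = t0")
    case True
    let ?w = "concat (map b ts)" and ?W = "concat (map W ts)"
    have "t0 \<notin> snd ` set ?w"
      using Cons.prems(2,4) True by fastforce
    then have "rightmost_addable ?w \<noteq> Some t0" using rightmost_addable_in by force
    then have 0: "phi_word ?w = 0" using Cons.prems(3) True assms(5) by (auto split: if_splits)
    have "phi_word ?W = h * phi_word ?w"
      using phi_eps_scaled_blocks[of ts W h b] Cons.prems(1,4) True by auto
    then show ?thesis using 0 True assms(5-8)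
      by (auto simp: rightmost_addable_append phi_word_append)
  next
    case False
    let ?w = "concat (map b ts)" and ?W = "concat (map W ts)"
    obtain s where s: "b t = [(s, t)] \<or> b t = []" using Cons.prems(2) by force
    have ra: "rightmost_addable ?w = Some t0" "phi_word ?w > eps_word (b t)"
      using s Cons.prems(3) False rightmost_addable_eq_None[of ?w]
      by (cases s; auto split: if_splits)+
    have IH: "rightmost_addable ?W = rightmost_addable (W t0)" "phi_word ?W + k = h * phi_word ?w"
      using Cons.IH[OF _ _ ra(1)] Cons.prems by auto
    have W: "phi_word (W t) = h * phi_word (b t)" "eps_word (W t) = h * eps_word (b t)"
      using Cons.prems(1) False by auto
    \<comment> \<open>A surplus of one letter in \<open>?w\<close> is a surplus of \<open>h\<close>
      letters in \<open>?W\<close>, of which fewer than \<open>h\<close> are lost by the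
      \<open>k\<close> changed ones.\<close>
    have "h * Suc (eps_word (b t)) \<le> h * phi_word ?w" using ra(2) by (intro mult_le_mono2) simp
    then have lt: "eps_word (W t) < phi_word ?W" using IH(2) W(2) assms(8) by simp
    have "phi_word (concat (map W (t # ts))) + k = h * phi_word (b t) + (phi_word ?W + k - h * eps_word (b t))"
      using lt W by (simp add: phi_word_append)
    also have "\<dots> = h * phi_word (concat (map b (t # ts)))"
      unfolding IH(2) by (simp add: phi_word_append algebra_simps diff_mult_distrib2)
    finally show ?thesis using lt IH(1) by (simp add: rightmost_addable_append)
  qed
qed simp

lemma letters_eq:
  "concat (map (\<lambda>c. [(s, (t, c))]) cs) = map (\<lambda>c. (s, (t, c))) cs"
  by (induction cs) auto

text \<open>The label \<open>()\<close> makes letters of different components comparable regardless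
  of their labels. Equal letters in one column do not cancel each other, so all counts are
  multiplied by \<open>h\<close>.\<close>

lemma col_copies:
  assumes "\<And>c. c < h \<Longrightarrow> bletter (M c) (i + int e * t) () = bletter J (i + int e * t) ()"
  shows "phi_word (col e h i M t) = h * phi_word (bletter J (i + int e * t) t)"
    "eps_word (col e h i M t) = h * eps_word (bletter J (i + int e * t) t)"
proof -
  let ?j = "i + int e * t"
  have "cell e i M (t, c) = bletter J ?j (t, c)" if "c < h" for c
    using assms[OF that] by (auto simp: cell_def bletter_def split: if_splits)
  then have col: "col e h i M t = concat (map (\<lambda>c. bletter J ?j (t, c)) (rev [0..<h]))"
    unfolding col_def by (intro arg_cong[of _ _ concat] map_cong) auto
  consider "bletter J ?j = (\<lambda>p. [(Addable, p)] :: (node_sign \<times> (int \<times> nat)) list)" "bletter J ?j t = [(Addable, t)]"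
    | "bletter J ?j = (\<lambda>p. [(Removable, p)] :: (node_sign \<times> (int \<times> nat)) list)" "bletter J ?j t = [(Removable, t)]"
    | "bletter J ?j = (\<lambda>p. [] :: (node_sign \<times> (int \<times> nat)) list)" "bletter J ?j t = []"
    unfolding bletter_def fun_eq_iff by (cases "?j \<in> J"; cases "?j + 1 \<in> J"; simp)
  then have "phi_word (col e h i M t) = h * phi_word (bletter J ?j t) \<and>
      eps_word (col e h i M t) = h * eps_word (bletter J ?j t)"
  proof cases
    case 1
    then show ?thesis
      using all_Addable[of "map (\<lambda>c. (Addable, (t, c))) (rev [0..<h])"]
      unfolding col 1 letters_eq by auto
  next
    case 2
    then show ?thesis
      using all_Removable[of "map (\<lambda>c. (Removable, (t, c))) (rev [0..<h])"]
      unfolding col 2 letters_eq by auto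
  next
    case 3
    have nil: "concat (map (\<lambda>c. [] :: (node_sign \<times> (int \<times> nat)) list) cs) = []" for cs :: "nat list"
      by (induction cs) auto
    show ?thesis unfolding col 3 nil by simp
  qed
  then show "phi_word (col e h i M t) = h * phi_word (bletter J ?j t)"
    "eps_word (col e h i M t) = h * eps_word (bletter J ?j t)" by auto
qed

lemma site_word_copies_counts:
  assumes "is_partition l" "e \<ge> 2"
  shows "phi_word (site_word e h i (copies h (beta m l))) = h * phi e m i l"
    "eps_word (site_word e h i (copies h (beta m l))) = h * eps e m i l"
proof -
  let ?J = "beta m l"
  have e0: "e > 0" using assms(2) by simp
  obtain K where K: "site_word e h i (copies h ?J) = concat (map (col e h i (copies h ?J)) (rev [-K..K]))"
    "concat (map (\<lambda>t. bletter ?J (i + int e * t) t) (rev [-K..K])) =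
      map (\<lambda>(s, a). (s, (node_pos l m s a - i) div int e)) (signature e m i l)"
    using eventually_both[OF site_word_window[OF mayas_copies[OF maya_beta[OF assms(1), of m], of h] e0, of i]
      signature_window[OF assms, of m i]] by (elim exE conjE)
  have "phi_word (concat (map (col e h i (copies h ?J)) (rev [-K..K]))) =
      h * phi_word (concat (map (\<lambda>t. bletter ?J (i + int e * t) t) (rev [-K..K]))) \<and>
    eps_word (concat (map (col e h i (copies h ?J)) (rev [-K..K]))) =
      h * eps_word (concat (map (\<lambda>t. bletter ?J (i + int e * t) t) (rev [-K..K])))"
    by (intro phi_eps_scaled_blocks conjI col_copies) (simp_all add: copies_def)
  then show "phi_word (site_word e h i (copies h (beta m l))) = h * phi e m i l"
    "eps_word (site_word e h i (copies h (beta m l))) = h * eps e m i l"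
    unfolding K by (simp_all add: word_map_sign)
qed

text \<open>When the first \<open>k\<close> components have been changed, the column of the site
  \<open>t0\<close> reads \<open>h - k\<close> letters \<open>A\<close> followed by \<open>k\<close>
  letters \<open>R\<close>, because components are read downwards. The rightmost \<open>A\<close>
  therefore belongs to component \<open>k\<close>.\<close>

lemma site_f_copies:
  assumes "is_partition l" "e \<ge> 2" "f_op e m i l = Some l'" "k < h"
  defines "M \<equiv> \<lambda>k c. if c < k then beta m l' else if c < h then beta m l else {}"
  shows "site_f e h i (M k) = Some (M (Suc k))"
proof -
  let ?J = "beta m l" and ?J' = "beta m l'"
  obtain a where a: "rightmost_addable (signature e m i l) = Some a" "addable e m i l a"
    "l' = add_node a l" "is_partition l'"
    using f_opE[OF assms(1-3)] by metis
  define t0 where "t0 = (node_pos l m Addable a - i) div int e"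
  define j where "j = int (l a) + m - int a"
  have "(node_pos l m Addable a) mod int e = i mod int e"
    using a(2) by (simp add: node_pos_def addable_res algebra_simps)
  then have "int e dvd node_pos l m Addable a - i" by (simp add: mod_eq_dvd_iff)
  then have t0: "i + int e * t0 = j" by (simp add: t0_def j_def node_pos_def)
  have J': "?J' = move j ?J" unfolding a(3) j_def by (rule beta_add_node[OF assms(1) a(2)])
  have Jj: "j \<in> ?J" "j + 1 \<notin> ?J"
    using node_pos_letter(1)[OF assms(1) a(2), where p = "()"]
    by (auto simp: bletter_def node_pos_def j_def split: if_splits)
  have e0: "e > 0" using assms(2) by simp
  have mM: "mayas h (M k)" for k
    using maya_beta[OF assms(1)] maya_beta[OF a(4)] by (auto simp: mayas_def M_def)
  obtain K where K: "site_word e h i (M k) = concat (map (col e h i (M k)) (rev [-K..K]))"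
    "concat (map (\<lambda>t. bletter ?J (i + int e * t) t) (rev [-K..K])) =
      map (\<lambda>(s, a). (s, (node_pos l m s a - i) div int e)) (signature e m i l)"
    using eventually_both[OF site_word_window[OF mM[of k] e0, of i] signature_window[OF assms(1,2), of m i]]
    by (elim exE conjE)
  have ra: "rightmost_addable (concat (map (\<lambda>t. bletter ?J (i + int e * t) t) (rev [-K..K]))) = Some t0"
    unfolding K(2) by (simp add: word_map_sign a t0_def)
  have other: "bletter (M k c) (i + int e * t) () = bletter ?J (i + int e * t) ()"
    if "t \<noteq> t0" "c < h" for t c
  proof -
    \<comment> \<open>Different sites of one component are at least \<open>e\<close> apart, so none
      of the others meets \<open>j\<close> or \<open>j + 1\<close>.\<close>
    have "\<bar>(i + int e * t) - j\<bar> \<ge> 2"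
    proof -
      have "(i + int e * t) - j = int e * (t - t0)" using t0 by (simp add: algebra_simps)
      moreover have "\<bar>int e * (t - t0)\<bar> \<ge> 2 * 1"
        unfolding abs_mult using that(1) assms(2) by (intro mult_mono) auto
      ultimately show ?thesis by simp
    qed
    then show ?thesis using that(2) by (auto simp: M_def J' move_def bletter_def)
  qed
  have "[0..<h] = [0..<k] @ k # [Suc k..<h]"
    using assms(4) upt_add_eq_append[of 0 k "h - k"] by (simp add: upt_rec)
  then have rev: "rev [0..<h] = rev [Suc k..<h] @ k # rev [0..<k]" by simp
  have cells: "cell e i (M k) (t0, c) = [(if c < k then Removable else Addable, (t0, c))]" if "c < h" for c
    using that Jj by (auto simp: cell_def t0 M_def J' move_def bletter_def)
  let ?A = "map (\<lambda>c. (Addable, (t0, c))) (rev [Suc k..<h])"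
    and ?R = "map (\<lambda>c. (Removable, (t0, c))) (rev [0..<k])"
  have "concat (map (\<lambda>c. cell e i (M k) (t0, c)) (rev [Suc k..<h])) = ?A"
    unfolding letters_eq[symmetric] using cells
    by (intro arg_cong[of _ _ concat] map_cong) auto
  moreover have "concat (map (\<lambda>c. cell e i (M k) (t0, c)) (rev [0..<k])) = ?R"
    unfolding letters_eq[symmetric] using cells assms(4)
    by (intro arg_cong[of _ _ concat] map_cong) auto
  ultimately have col0: "col e h i (M k) t0 = ?A @ (Addable, (t0, k)) # ?R"
    unfolding col_def rev using cells[OF assms(4)] by simp
  have A: "phi_word ?A = h - Suc k" "eps_word ?A = 0" using all_Addable[of ?A] by auto
  have R: "phi_word ?R = 0" "eps_word ?R = k" using all_Removable[of ?R] by auto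
  have c0: "phi_word (col e h i (M k) t0) = h - k" "eps_word (col e h i (M k) t0) = k"
    "rightmost_addable (col e h i (M k) t0) = Some (t0, k)"
    unfolding col0 using A R assms(4)
    by (simp_all add: phi_word_append eps_word_append rightmost_addable_append)
  have b0: "bletter ?J (i + int e * t0) t0 = [(Addable, t0)]"
    using Jj by (simp add: t0 bletter_def)
  have "rightmost_addable (site_word e h i (M k)) = rightmost_addable (col e h i (M k) t0)"
    unfolding K(1)
  proof (rule conjunct1[OF rightmost_addable_scaled_blocks])
    show "\<exists>s. bletter ?J (i + int e * t) t = [(s, t)] \<or> bletter ?J (i + int e * t) t = []" for t
      by (auto simp: bletter_def)
    show "phi_word (col e h i (M k) t) = h * phi_word (bletter ?J (i + int e * t) t) \<and>
       eps_word (col e h i (M k) t) = h * eps_word (bletter ?J (i + int e * t) t)" if "t \<noteq> t0" for t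
      using col_copies[of h "M k" i e t ?J] other[OF that] by simp
  qed (use ra b0 c0 assms(4) in auto)
  then have "site_f e h i (M k) = Some ((M k)(k := move j (M k k)))"
    by (simp add: site_f_def c0 t0)
  also have "(M k)(k := move j (M k k)) = M (Suc k)"
    by (rule ext) (use assms(4) in \<open>auto simp: M_def J'\<close>)
  finally show ?thesis .
qed

lemma site_fs_append: "site_fs e h (w @ v) M = Option.bind (site_fs e h w M) (site_fs e h v)"
  by (induction w arbitrary: M) (auto split: Option.bind_split)

lemma site_fs_copies_step:
  assumes "is_partition l" "e \<ge> 2" "f_op e m i l = Some l'"
  shows "site_fs e h (replicate h i) (copies h (beta m l)) = Some (copies h (beta m l'))"
proof -
  let ?M = "\<lambda>k c. if c < k then beta m l' else if c < h then beta m l else {}"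
  have "site_fs e h (replicate k i) (?M 0) = Some (?M k)" if "k \<le> h" for k
    using that
  proof (induction k)
    case (Suc k)
    have "replicate (Suc k) i = replicate k i @ [i]" by (simp add: replicate_append_same)
    then show ?case using Suc site_f_copies[OF assms, of k h] by (simp add: site_fs_append)
  qed simp
  then have "site_fs e h (replicate h i) (?M 0) = Some (?M h)" by blast
  moreover have "?M 0 = copies h (beta m l)" "?M h = copies h (beta m l')"
    by (auto simp: copies_def fun_eq_iff)
  ultimately show ?thesis by simp
qed

fun f_ops :: "nat \<Rightarrow> int \<Rightarrow> int list \<Rightarrow> (nat \<Rightarrow> nat) \<Rightarrow> (nat \<Rightarrow> nat) option" where
  "f_ops e m [] l = Some l"
| "f_ops e m (i # w) l = Option.bind (f_op e m i l) (f_ops e m w)"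

fun f_tensors :: "nat \<Rightarrow> int \<Rightarrow> int list \<Rightarrow> (nat \<Rightarrow> nat) list \<Rightarrow> (nat \<Rightarrow> nat) list option" where
  "f_tensors e m [] bs = Some bs"
| "f_tensors e m (i # w) bs = Option.bind (f_tensor e m i bs) (f_tensors e m w)"

definition stretch :: "nat \<Rightarrow> 'a list \<Rightarrow> 'a list" where
  "stretch h xs = concat (map (replicate h) xs)"

lemma site_fs_copies:
  assumes "is_partition l" "e \<ge> 2" "f_ops e m w l = Some l'"
  shows "site_fs e h (stretch h w) (copies h (beta m l)) = Some (copies h (beta m l'))"
  using assms(1,3)
proof (induction w arbitrary: l)
  case (Cons i w)
  then obtain l1 where l1: "f_op e m i l = Some l1" "f_ops e m w l1 = Some l'"
    by (auto split: Option.bind_splits)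
  have "is_partition l1" using f_opE[OF Cons.prems(1) assms(2) l1(1)] by metis
  then have "site_fs e h (stretch h w) (copies h (beta m l1)) = Some (copies h (beta m l'))"
    using Cons.IH l1(2) by blast
  then show ?case
    using site_fs_copies_step[OF Cons.prems(1) assms(2) l1(1), of h]
    by (simp add: stretch_def site_fs_append)
qed (simp add: stretch_def)

section \<open>Configurations with separated charges\<close>

lemma concat_append_sorted:
  fixes ts :: "'a::linorder list"
  assumes "sorted_wrt (>) ts"
    and "\<And>t t'. t \<in> set ts \<Longrightarrow> t' \<in> set ts \<Longrightarrow> A t \<noteq> [] \<Longrightarrow> B t' \<noteq> [] \<Longrightarrow> t' < t"
  shows "concat (map (\<lambda>t. A t @ B t) ts) = concat (map A ts) @ concat (map B ts)"
  using assms
proof (induction ts)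
  case (Cons t ts)
  have "B t @ concat (map A ts) = concat (map A ts) @ B t"
  proof (cases "B t = []")
    case False
    then have "A t' = []" if "t' \<in> set ts" for t'
      using Cons.prems(1) Cons.prems(2)[of t' t] that by force
    then have nil: "concat (map A ts) = []" by simp
    show ?thesis unfolding nil by simp
  qed simp
  then have "A t @ B t @ concat (map A ts) @ concat (map B ts) =
      A t @ concat (map A ts) @ B t @ concat (map B ts)"
    by (metis append_assoc)
  then show ?case using Cons by simp
qed simp

text \<open>Columns and components may be interchanged in the order of reading because the letters
  of different components do not interleave.\<close>

lemma concat_transpose:
  fixes ts :: "'a::linorder list"
  assumes "sorted_wrt (>) ts"
    and "sorted_wrt (\<lambda>c c'. \<forall>t\<in>set ts. \<forall>t'\<in>set ts. L t c \<noteq> [] \<longrightarrow> L t' c' \<noteq> [] \<longrightarrow> t' < t) cs"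
  shows "concat (map (\<lambda>t. concat (map (L t) cs)) ts) = concat (map (\<lambda>c. concat (map (\<lambda>t. L t c) ts)) cs)"
  using assms(2)
proof (induction cs)
  case (Cons c cs)
  have "concat (map (\<lambda>t. L t c @ concat (map (L t) cs)) ts) =
      concat (map (\<lambda>t. L t c) ts) @ concat (map (\<lambda>t. concat (map (L t) cs)) ts)"
    by (rule concat_append_sorted[OF assms(1)]) (use Cons.prems in auto)
  then show ?case using Cons by simp
qed simp

text \<open>For large \<open>N\<close> the components do not interact, and their sites are read one component after
  the other, as in the tensor product.\<close>

definition encode :: "nat \<Rightarrow> nat \<Rightarrow> int \<Rightarrow> (nat \<Rightarrow> nat) list \<Rightarrow> nat \<Rightarrow> int set" where
  "encode e N m bs c = (if c < length bs then beta (m + int e * int (N * c)) (bs ! c) else {})"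

text \<open>The partitions fit into an \<open>s\<close> by \<open>s\<close> square. Their letters
  then lie within distance \<open>s\<close> of the charge, and one step of \<open>f_tensor\<close>
  enlarges the square by at most one.\<close>

definition bounded :: "nat \<Rightarrow> (nat \<Rightarrow> nat) list \<Rightarrow> bool" where
  "bounded s bs \<longleftrightarrow> (\<forall>l\<in>set bs. is_partition l \<and> l 0 \<le> s \<and> l s = 0)"

lemma letter_bounded:
  assumes "is_partition l" "l 0 \<le> s" "l s = 0" "bletter (beta m l) j p \<noteq> []"
  shows "m - int s \<le> j" "j \<le> m + int s"
proof -
  have "x \<in> beta m l" if x: "x \<le> m - int s" for x
  proof -
    have "l (nat (m - x)) = 0"
      using is_partitionD[OF assms(1), of s "nat (m - x)"] assms(3) x by simp
    then have "x = int (l (nat (m - x))) + m - int (nat (m - x))" using x by simp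
    then show ?thesis unfolding beta_def by (rule image_eqI) simp
  qed
  then have "\<not> j < m - int s" using assms(4) by (auto simp: bletter_def split: if_splits)
  then show "m - int s \<le> j" by simp
  have "x \<le> m + int s" if x: "x \<in> beta m l" for x
  proof -
    obtain k where "x = int (l k) + m - int k" using x by (auto simp: beta_def)
    then show ?thesis using is_partitionD[OF assms(1), of 0 k] assms(2) by simp
  qed
  moreover have "j \<in> beta m l \<or> j + 1 \<in> beta m l"
    using assms(4) by (auto simp: bletter_def split: if_splits)
  ultimately show "j \<le> m + int s" by force
qed

lemma res_shift: "res e (m + int e * n) a b = res e m a b"
proof -
  have "m + int e * n - int a + int b = m - int a + int b + int e * n" by simp
  then show ?thesis unfolding res_def by (simp only: mod_mult_self2)
qed

lemma signature_shift: "signature e (m + int e * n) i l = signature e m i l"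
  by (simp add: signature_def addable_def removable_def res_shift)

lemma eventually_all_less:
  fixes P :: "nat \<Rightarrow> int \<Rightarrow> bool"
  assumes "\<And>c. c < h \<Longrightarrow> \<exists>K0. \<forall>K\<ge>K0. P c K"
  shows "\<exists>K0. \<forall>K\<ge>K0. \<forall>c<h. P c K"
  using assms
proof (induction h)
  case (Suc h)
  obtain a where a: "\<forall>K\<ge>a. \<forall>c<h. P c K" using Suc.IH Suc.prems less_SucI by blast
  obtain b where b: "\<forall>K\<ge>b. P h K" using Suc.prems[OF lessI] by blast
  show ?case
  proof (intro exI[of _ "max a b"] allI impI)
    fix K c assume "max a b \<le> K" "c < Suc h"
    then show "P c K" using a b by (cases "c = h") auto
  qed
qed simp

lemma boundedD: "bounded s bs \<Longrightarrow> k < length bs \<Longrightarrow> is_partition (bs ! k) \<and> (bs ! k) 0 \<le> s \<and> (bs ! k) s = 0"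
  by (simp add: bounded_def)

lemma bounded_partitions: "bounded s bs \<Longrightarrow> partitions bs"
  by (simp add: bounded_def partitions_def)

text \<open>The charges of two components differ by at least \<open>e * N\<close>, which exceeds
  \<open>2 * s\<close>, so all letters of a component lie above those of the components with smaller
  index.\<close>

lemma site_word_encode:
  assumes "bounded s bs" "2 * s < N" "e \<ge> 2"
  defines "h \<equiv> length bs"
  shows "site_word e h i (encode e N m bs) =
    map (\<lambda>(r, ka). (r, (\<lambda>r (k, a). ((node_pos (bs ! k) (m + int e * int (N * k)) r a - i) div int e, k)) r ka))
      (tensor_signature e m i bs)"
proof -
  let ?m = "\<lambda>c. m + int e * int (N * c)"
  have e0: "e > 0" using assms(3) by simp
  have encode: "encode e N m bs c = beta (?m c) (bs ! c)" if "c < h" for c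
    using that by (simp add: encode_def h_def)
  have "mayas h (encode e N m bs)"
    using boundedD[OF assms(1)] maya_beta by (auto simp: mayas_def encode h_def)
  note win = site_word_window[OF this e0, of i]
  have "\<exists>K0. \<forall>K\<ge>K0. \<forall>c<h. concat (map (\<lambda>t. bletter (beta (?m c) (bs ! c)) (i + int e * t) t) (rev [-K..K])) =
    map (\<lambda>(r, a). (r, (node_pos (bs ! c) (?m c) r a - i) div int e)) (signature e (?m c) i (bs ! c))"
    by (rule eventually_all_less, rule signature_window[OF _ assms(3)])
      (use boundedD[OF assms(1)] in \<open>simp add: h_def\<close>)
  from eventually_both[OF win this] obtain K where
    K: "site_word e h i (encode e N m bs) = concat (map (col e h i (encode e N m bs)) (rev [-K..K]))" and
    K2: "\<forall>c<h. concat (map (\<lambda>t. bletter (beta (?m c) (bs ! c)) (i + int e * t) t) (rev [-K..K])) =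
    map (\<lambda>(r, a). (r, (node_pos (bs ! c) (?m c) r a - i) div int e)) (signature e (?m c) i (bs ! c))"
    by (elim exE conjE)
  let ?L = "\<lambda>t c. cell e i (encode e N m bs) (t, c)"
  have lt: "t' < t" if c: "c' < c" "c < h" and ne: "?L t c \<noteq> []" "?L t' c' \<noteq> []" for t t' c c'
  proof -
    have c': "c' < h" using c by simp
    note bc = boundedD[OF assms(1) c(2)[unfolded h_def]] boundedD[OF assms(1) c'[unfolded h_def]]
    have "bletter (beta (?m c) (bs ! c)) (i + int e * t) (t, c) \<noteq> []"
      using ne(1) by (simp add: cell_def encode[OF c(2)])
    from letter_bounded(1)[OF _ _ _ this, of s] bc have lb: "?m c - int s \<le> i + int e * t" by simp
    have "bletter (beta (?m c') (bs ! c')) (i + int e * t') (t', c') \<noteq> []"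
      using ne(2) by (simp add: cell_def encode[OF c'])
    from letter_bounded(2)[OF _ _ _ this, of s] bc have ub: "i + int e * t' \<le> ?m c' + int s" by simp
    have "?m c' + int s < ?m c - int s"
    proof -
      have "int N * 1 \<le> int N * (int c - int c')" using c by (intro mult_left_mono) auto
      then have "2 * int s < int N * (int c - int c')" using assms(2) by linarith
      also have "\<dots> = 1 * (int N * (int c - int c'))" by simp
      also have "\<dots> \<le> int e * (int N * (int c - int c'))"
        using c e0 by (intro mult_right_mono mult_nonneg_nonneg) auto
      finally show ?thesis by (simp add: algebra_simps)
    qed
    then have "int e * t' < int e * t" using lb ub by linarith
    then show ?thesis using e0 by simp
  qed
  have "site_word e h i (encode e N m bs) = concat (map (\<lambda>c. concat (map (\<lambda>t. ?L t c) (rev [-K..K]))) (rev [0..<h]))"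
    unfolding K col_def[abs_def]
  proof (rule concat_transpose[OF sorted_rev_upto])
    show "sorted_wrt (\<lambda>c c'. \<forall>t\<in>set (rev [-K..K]). \<forall>t'\<in>set (rev [-K..K]).
        ?L t c \<noteq> [] \<longrightarrow> ?L t' c' \<noteq> [] \<longrightarrow> t' < t) (rev [0..<h])"
      by (rule sorted_wrt_mono_rel[OF _ sorted_rev_upt]) (use lt in auto)
  qed
  also have "\<dots> = concat (map (\<lambda>k. map (\<lambda>(r, a). (r, ((node_pos (bs ! k) (?m k) r a - i) div int e, k)))
      (signature e m i (bs ! k))) (rev [0..<h]))"
  proof (intro arg_cong[of _ _ concat] map_cong refl)
    fix c assume "c \<in> set (rev [0..<h])"
    then have c: "c < h" by simp
    have "?L t c = map (apsnd (\<lambda>t. (t, c))) (bletter (beta (?m c) (bs ! c)) (i + int e * t) t)" for t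
      by (simp add: cell_def encode[OF c] bletter_def)
    then have "concat (map (\<lambda>t. ?L t c) (rev [-K..K])) = map (apsnd (\<lambda>t. (t, c)))
        (concat (map (\<lambda>t. bletter (beta (?m c) (bs ! c)) (i + int e * t) t) (rev [-K..K])))"
      by (simp only: map_concat map_map comp_def)
    also have "\<dots> = map (\<lambda>(r, a). (r, ((node_pos (bs ! c) (?m c) r a - i) div int e, c)))
      (signature e m i (bs ! c))"
      unfolding K2[rule_format, OF c] signature_shift map_map by (intro map_cong) auto
    finally show "concat (map (\<lambda>t. ?L t c) (rev [-K..K])) = map (\<lambda>(r, a).
      (r, ((node_pos (bs ! c) (?m c) r a - i) div int e, c))) (signature e m i (bs ! c))" .
  qed
  also have "\<dots> = map (\<lambda>(r, ka). (r, (\<lambda>r (k, a). ((node_pos (bs ! k) (?m k) r a - i) div int e, k)) r ka))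
      (tensor_signature e m i bs)"
    unfolding tensor_signature_def map_concat map_map h_def
    by (intro arg_cong[of _ _ concat] map_cong) auto
  finally show ?thesis .
qed

lemma site_f_encode:
  assumes "bounded s bs" "2 * s < N" "e \<ge> 2"
  defines "h \<equiv> length bs"
  shows "site_f e h i (encode e N m bs) = map_option (encode e N m) (f_tensor e m i bs)"
    "phi_word (site_word e h i (encode e N m bs)) = phi_tensor e m i bs"
    "eps_word (site_word e h i (encode e N m bs)) = eps_tensor e m i bs"
proof -
  note w = site_word_encode[OF assms(1-3), of i m, folded h_def]
  show "phi_word (site_word e h i (encode e N m bs)) = phi_tensor e m i bs"
    "eps_word (site_word e h i (encode e N m bs)) = eps_tensor e m i bs"
    unfolding w word_map_sign phi_tensor_def eps_tensor_def by simp_all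
  note part = bounded_partitions[OF assms(1)]
  show "site_f e h i (encode e N m bs) = map_option (encode e N m) (f_tensor e m i bs)"
  proof (cases "f_tensor e m i bs")
    case None
    then show ?thesis by (auto simp: site_f_def w word_map_sign f_tensor_def)
  next
    case (Some bs')
    obtain k a where ka: "rightmost_addable (tensor_signature e m i bs) = Some (k, a)"
      "k < length bs" "addable e m i (bs ! k) a" "bs' = bs[k := add_node a (bs ! k)]"
      using f_tensorE[OF part assms(3) Some] by metis
    let ?m = "m + int e * int (N * k)"
    let ?p = "node_pos (bs ! k) ?m Addable a"
    have "(m - int a + int ((bs ! k) a)) mod int e = i mod int e"
      using ka(3) by (simp add: addable_res)
    moreover have "?p = (m - int a + int ((bs ! k) a)) + int e * int (N * k)"
      by (simp add: node_pos_def)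
    ultimately have "?p mod int e = i mod int e" by (simp only: mod_mult_self2)
    then have "int e dvd ?p - i" by (simp add: mod_eq_dvd_iff)
    then have p: "i + int e * ((?p - i) div int e) = ?p" by simp
    have "site_f e h i (encode e N m bs) = Some ((encode e N m bs)(k := move ?p (encode e N m bs k)))"
      by (simp add: site_f_def w word_map_sign ka(1) p del: of_nat_mult)
    moreover have "(encode e N m bs)(k := move ?p (encode e N m bs k)) = encode e N m bs'"
    proof
      fix c
      have "is_partition (bs ! k)" using part ka(2) by (auto simp: partitions_def)
      then have "beta ?m (add_node a (bs ! k)) = move ?p (beta ?m (bs ! k))"
        using beta_add_node[OF _ ka(3), of ?m] by (simp add: node_pos_def)
      then show "((encode e N m bs)(k := move ?p (encode e N m bs k))) c = encode e N m bs' c"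
        using ka(2) by (auto simp: encode_def ka(4))
    qed
    ultimately show ?thesis using Some by simp
  qed
qed

lemma f_tensor_bounded:
  assumes "bounded s bs" "e \<ge> 2" "f_tensor e m i bs = Some bs'"
  shows "bounded (Suc s) bs'"
proof -
  obtain k a where ka: "k < length bs" "addable e m i (bs ! k) a" "bs' = bs[k := add_node a (bs ! k)]"
    using f_tensorE[OF bounded_partitions[OF assms(1)] assms(2,3)] by metis
  note b = boundedD[OF assms(1) ka(1)]
  have "a \<le> s"
  proof (rule ccontr)
    assume "\<not> a \<le> s"
    then have "(bs ! k) (a - 1) \<le> (bs ! k) s" using b is_partitionD[of "bs ! k" s "a - 1"] by auto
    then show False using ka(2) b \<open>\<not> a \<le> s\<close> by (auto simp: addable_def)
  qed
  moreover have "(bs ! k) (Suc s) = 0" using b is_partition_Suc[of "bs ! k" s] by simp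
  ultimately have "add_node a (bs ! k) 0 \<le> Suc s" "add_node a (bs ! k) (Suc s) = 0"
    using b by (auto simp: add_node_def)
  moreover have "is_partition (add_node a (bs ! k))" using b ka(2) is_partition_add_node by blast
  moreover have "l 0 \<le> Suc s \<and> l (Suc s) = 0 \<and> is_partition l" if "l \<in> set bs" for l
    using assms(1) that is_partition_Suc[of l s] by (auto simp: bounded_def)
  ultimately show ?thesis
    unfolding bounded_def ka(3) using set_update_subset_insert[of bs k "add_node a (bs ! k)"] by blast
qed

lemma f_tensors_bounded:
  assumes "bounded s bs" "e \<ge> 2" "f_tensors e m w bs = Some bs'"
  shows "bounded (s + length w) bs'" "length bs' = length bs"
proof -
  have "bounded (s + length w) bs' \<and> length bs' = length bs"
    using assms(1,3)
  proof (induction w arbitrary: s bs)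
    case (Cons i w)
    then obtain bs1 where 1: "f_tensor e m i bs = Some bs1" "f_tensors e m w bs1 = Some bs'"
      by (auto split: Option.bind_splits)
    then show ?case
      using Cons.IH[OF f_tensor_bounded[OF Cons.prems(1) assms(2) 1(1)] 1(2)]
        f_tensor_partitions(2)[OF bounded_partitions[OF Cons.prems(1)] assms(2) 1(1)] by simp
  qed simp
  then show "bounded (s + length w) bs'" "length bs' = length bs" by auto
qed

text \<open>The required separation grows with the length of the word, as each letter may enlarge
  the partitions. This is why \<open>dominates_tops\<close> is stated for every
  \<open>N\<close>.\<close>

lemma site_fs_encode:
  assumes "bounded s bs" "2 * (s + length w) < N" "e \<ge> 2"
  shows "site_fs e (length bs) w (encode e N m bs) = map_option (encode e N m) (f_tensors e m w bs)"
  using assms(1,2)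
proof (induction w arbitrary: s bs)
  case (Cons i w)
  show ?case
  proof (cases "f_tensor e m i bs")
    case None
    then show ?thesis using site_f_encode(1)[OF Cons.prems(1) _ assms(3), of N i m] Cons.prems(2) by simp
  next
    case (Some bs1)
    then show ?thesis
      using site_f_encode(1)[OF Cons.prems(1) _ assms(3), of N i m] Cons.prems(2)
        Cons.IH[OF f_tensor_bounded[OF Cons.prems(1) assms(3) Some]]
        f_tensor_partitions(2)[OF bounded_partitions[OF Cons.prems(1)] assms(3) Some] by simp
  qed
qed simp

lemma encode_inj:
  assumes "partitions bs" "partitions bs'" "length bs = length bs'" "encode e N m bs = encode e N m bs'"
  shows "bs = bs'"
proof (rule nth_equalityI)
  fix c assume c: "c < length bs"
  have "beta (m + int e * int (N * c)) (bs ! c) = beta (m + int e * int (N * c)) (bs' ! c)"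
    using fun_cong[OF assms(4), of c] c assms(3) by (simp add: encode_def)
  then show "bs ! c = bs' ! c"
    by (rule beta_inj[rotated 2]) (use assms(1-3) c in \<open>auto simp: partitions_def\<close>)
qed (rule assms(3))

abbreviation vacuum :: "nat \<Rightarrow> (nat \<Rightarrow> nat) list" where
  "vacuum h \<equiv> replicate h empty_partition"

lemma bounded_vacuum: "bounded 0 (vacuum h)"
  by (auto simp: bounded_def) (simp add: empty_partition_def)+

text \<open>On \<open>copies\<close> the result of a stretched word depends only on the partition
  that the word reaches. \<open>dominates\<close> carries this to separated charges, where
  \<open>encode\<close> is injective; so it holds in the tensor product as well, together with the
  string lengths.\<close>

lemma f_tensors_stretch:
  assumes "e \<ge> 2" "f_ops e m w empty_partition = Some l"
  shows "\<exists>bs. f_tensors e m (stretch h w) (vacuum h) = Some bs \<and>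
    (\<forall>i. phi_tensor e m i bs = h * phi e m i l \<and> eps_tensor e m i bs = h * eps e m i l) \<and>
    (\<forall>v. f_ops e m v empty_partition = Some l \<longrightarrow> f_tensors e m (stretch h v) (vacuum h) = Some bs)"
proof -
  let ?w = "stretch h w"
  let ?M = "copies h (beta m empty_partition)"
  have e0: "e > 0" using assms(1) by simp
  \<comment> \<open>\<open>tops\<close> lists first free positions, hence
    \<open>m + 1\<close>.\<close>
  have dom: "dominates e h ?M (encode e N m (vacuum h))" for N
  proof -
    have "vacua (tops e h (m + 1) (\<lambda>_. 0)) = ?M"
      by (rule ext) (simp add: vacua_def tops_def copies_def beta_empty)
    moreover have "vacua (tops e h (m + 1) (\<lambda>c. N * c)) = encode e N m (vacuum h)"
      by (rule ext) (simp add: vacua_def tops_def encode_def beta_empty add_ac)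
    ultimately show ?thesis using dominates_tops[OF e0, of h "m + 1" N] by simp
  qed
  have l: "is_partition l"
    using assms(2) is_partition_empty
  proof (induction w arbitrary: l rule: rev_induct)
    case (snoc i w)
    have app: "f_ops e m (w @ v) b = Option.bind (f_ops e m w b) (f_ops e m v)" for v b
      by (induction w arbitrary: b) (auto split: Option.bind_split)
    obtain l1 where l1: "f_ops e m w empty_partition = Some l1" "f_op e m i l1 = Some l"
      using snoc.prems(1) by (auto simp: app split: Option.bind_splits)
    then show ?case using snoc.IH[OF l1(1)] f_opE[OF _ assms(1) l1(2)] is_partition_empty by metis
  qed simp
  have fin: "\<exists>N. 2 * (0 + length u) < N \<and> 2 * (0 + length u') < N" for u u' :: "int list"
    by (intro exI[of _ "2 * (length u + length u') + 1"]) simp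
  have cM: "site_fs e h (stretch h v) ?M = Some (copies h (beta m l))"
    if "f_ops e m v empty_partition = Some l" for v
    by (rule site_fs_copies[OF is_partition_empty assms(1) that])
  have cE: "site_fs e h u (encode e N m (vacuum h)) = map_option (encode e N m) (f_tensors e m u (vacuum h))"
    if "2 * (0 + length u) < N" for u N
    using site_fs_encode[OF bounded_vacuum that assms(1), where m = m] by simp
  obtain N where N: "2 * (0 + length ?w) < N" using fin by blast
  obtain bs where bs: "f_tensors e m ?w (vacuum h) = Some bs"
    using dominatesD(1)[OF dom[of N], of ?w] cM[OF assms(2)] cE[OF N] by fastforce
  note b = f_tensors_bounded[OF bounded_vacuum assms(1) bs]
  have "phi_tensor e m i bs = h * phi e m i l \<and> eps_tensor e m i bs = h * eps e m i l" for i
  proof -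
    have "site_fs e h ?w (encode e N m (vacuum h)) = Some (encode e N m bs)" using cE[OF N] bs by simp
    from dominatesD(3)[OF dom cM[OF assms(2)] this, of i]
    show ?thesis
      using site_word_copies_counts[OF l assms(1), where h = h and i = i and m = m]
        site_f_encode(2,3)[OF b(1) N assms(1), where i = i and m = m] b(2)
      by simp
  qed
  moreover have "f_tensors e m (stretch h v) (vacuum h) = Some bs"
    if v: "f_ops e m v empty_partition = Some l" for v
  proof -
    \<comment> \<open>A separation large enough for both words, so that both results are encoded by
      the same injective map.\<close>
    obtain N where N: "2 * (0 + length ?w) < N" "2 * (0 + length (stretch h v)) < N" using fin by blast
    have "site_fs e h ?w (encode e N m (vacuum h)) = site_fs e h (stretch h v) (encode e N m (vacuum h))"
      by (rule dominatesD(2)[OF dom]) (simp add: cM[OF v] cM[OF assms(2)])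
    then obtain bs' where bs': "f_tensors e m (stretch h v) (vacuum h) = Some bs'"
      "encode e N m bs = encode e N m bs'"
      unfolding cE[OF N(1)] cE[OF N(2)] bs by (auto simp: option.map_sel dest: sym)
    note b' = f_tensors_bounded[OF bounded_vacuum assms(1) bs'(1)]
    show ?thesis
      using encode_inj[OF bounded_partitions[OF b(1)] bounded_partitions[OF b'(1)] _ bs'(2)] b(2) b'(2) bs'(1)
      by simp
  qed
  ultimately show ?thesis using bs by blast
qed

section \<open>The morphism of amplitude h\<close>

definition word_of :: "nat \<Rightarrow> int \<Rightarrow> (nat \<Rightarrow> nat) \<Rightarrow> int list" where
  "word_of e m l = (SOME w. f_ops e m w empty_partition = Some l)"

text \<open>The candidate for \<open>S_map\<close>, defined by an arbitrary word leading to
  \<open>l\<close>; the choice does not matter by \<open>amplify_eq\<close>.\<close>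

definition amplify :: "nat \<Rightarrow> int \<Rightarrow> nat \<Rightarrow> (nat \<Rightarrow> nat) \<Rightarrow> (nat \<Rightarrow> nat) list" where
  "amplify e m h l = the (f_tensors e m (stretch h (word_of e m l)) (vacuum h))"

lemma f_ops_append: "f_ops e m (w @ v) b = Option.bind (f_ops e m w b) (f_ops e m v)"
  by (induction w arbitrary: b) (auto split: Option.bind_split)

lemma f_tensors_append: "f_tensors e m (w @ v) b = Option.bind (f_tensors e m w b) (f_tensors e m v)"
  by (induction w arbitrary: b) (auto split: Option.bind_split)

lemma f_tensors_replicate: "f_tensors e m (replicate h i) bs = iter (f_tensor e m i) h bs"
proof (induction h arbitrary: bs)
  case (Suc h)
  then show ?case by (cases "f_tensor e m i bs") (simp_all add: iter_Suc')
qed simp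

lemma f_ops_word_of:
  assumes "l \<in> restricted_partitions e" "e \<ge> 2"
  shows "f_ops e m (word_of e m l) empty_partition = Some l"
proof -
  have "\<exists>w. f_ops e m w empty_partition = Some l" using assms
  proof (induction l rule: restricted_induct[where m = m])
    case empty
    show ?case by (intro exI[of _ "[]"]) simp
  next
    case (f_op l i l')
    then obtain w where "f_ops e m w empty_partition = Some l" by blast
    then show ?case using f_op.hyps(2) by (intro exI[of _ "w @ [i]"]) (simp add: f_ops_append)
  qed
  then show ?thesis unfolding word_of_def by (rule someI_ex)
qed

lemma amplify_eq:
  assumes "e \<ge> 2" "l \<in> restricted_partitions e" "f_ops e m w empty_partition = Some l"
  shows "f_tensors e m (stretch h w) (vacuum h) = Some (amplify e m h l)"
proof -
  obtain bs where bs: "f_tensors e m (stretch h (word_of e m l)) (vacuum h) = Some bs"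
    "\<And>v. f_ops e m v empty_partition = Some l \<Longrightarrow> f_tensors e m (stretch h v) (vacuum h) = Some bs"
    using f_tensors_stretch[OF assms(1) f_ops_word_of[OF assms(2,1)]] by blast
  then show ?thesis using assms(3) by (simp add: amplify_def)
qed

lemma amplify_counts:
  assumes "e \<ge> 2" "l \<in> restricted_partitions e"
  shows "phi_tensor e m i (amplify e m h l) = h * phi e m i l"
    "eps_tensor e m i (amplify e m h l) = h * eps e m i l"
  using f_tensors_stretch[OF assms(1) f_ops_word_of[OF assms(2,1)], of m h]
  by (auto simp: amplify_def)

lemma amplify_empty: "e \<ge> 2 \<Longrightarrow> amplify e m h empty_partition = vacuum h"
  using amplify_eq[of e empty_partition m "[]" h] restricted_empty[of e] by (simp add: stretch_def)

lemma amplify_f_op: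
  assumes "e \<ge> 2" "l \<in> restricted_partitions e" "f_op e m i l = Some l'"
  shows "iter (f_tensor e m i) h (amplify e m h l) = Some (amplify e m h l')"
proof -
  let ?w = "word_of e m l"
  note w = f_ops_word_of[OF assms(2,1), of m]
  have "f_ops e m (?w @ [i]) empty_partition = Some l'" using w assms(3) by (simp add: f_ops_append)
  note eq = amplify_eq[OF assms(1) f_op_restricted[OF assms(2,1,3)] this, of h]
  have "stretch h (?w @ [i]) = stretch h ?w @ replicate h i" by (simp add: stretch_def)
  then show ?thesis
    using eq amplify_eq[OF assms(1,2) w, of h] by (simp add: f_tensors_append f_tensors_replicate)
qed

lemma vacuum_tensor_power: "e \<ge> 2 \<Longrightarrow> vacuum h \<in> tensor_power e h"
  using restricted_empty[of e] by (auto simp: tensor_power_def)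

lemma iter_f_tensor_component:
  assumes "bs \<in> tensor_power e h" "bs \<in> highest_component e m h" "e \<ge> 2"
    "iter (f_tensor e m i) n bs = Some bs'"
  shows "bs' \<in> tensor_power e h \<and> bs' \<in> highest_component e m h"
  using assms(4)
proof (induction n arbitrary: bs')
  case (Suc n)
  then obtain z where z: "iter (f_tensor e m i) n bs = Some z" "f_tensor e m i z = Some bs'"
    by (cases "iter (f_tensor e m i) n bs") (auto simp: iter_Suc)
  then have IH: "z \<in> tensor_power e h" "z \<in> highest_component e m h" using Suc.IH by auto
  have "bs' \<in> tensor_power e h" by (rule f_tensor_restricted[OF IH(1) assms(3) z(2)])
  then show ?case
    using IH z(2) unfolding highest_component_def by (auto intro: rtrancl.rtrancl_into_rtrancl)
qed (use assms(1,2) in simp)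

lemma amplify_component:
  assumes "l \<in> restricted_partitions e" "e \<ge> 2"
  shows "amplify e m h l \<in> tensor_power e h \<and> amplify e m h l \<in> highest_component e m h"
  using assms
proof (induction l rule: restricted_induct[where m = m])
  case empty
  show ?case
    using vacuum_tensor_power[OF assms(2), of h] amplify_empty[OF assms(2)]
    by (simp add: highest_component_def)
next
  case (f_op l i l')
  then show ?case
    using iter_f_tensor_component[OF _ _ assms(2) amplify_f_op[OF assms(2) f_op.hyps(1,2)]] by blast
qed

lemma tensor_power_partitions: "bs \<in> tensor_power e h \<Longrightarrow> partitions bs"
  using restricted_is_partition by (auto simp: tensor_power_def partitions_def)

lemma amplify_partitions:
  "l \<in> restricted_partitions e \<Longrightarrow> e \<ge> 2 \<Longrightarrow> partitions (amplify e m h l)"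
  using amplify_component tensor_power_partitions by blast

lemma iter_e_tensor:
  assumes "partitions bs" "e \<ge> 2" "iter (f_tensor e m i) n bs = Some bs'"
  shows "iter (e_tensor e m i) n bs' = Some bs"
  using assms(3)
proof (induction n arbitrary: bs')
  case (Suc n)
  then obtain z where z: "iter (f_tensor e m i) n bs = Some z" "f_tensor e m i z = Some bs'"
    by (cases "iter (f_tensor e m i) n bs") (auto simp: iter_Suc)
  have pz: "partitions z" using iter_f_tensor_count(1)[OF assms(1,2) z(1)] .
  have "partitions bs'" using f_tensor_partitions(1)[OF pz assms(2) z(2)] .
  then have "e_tensor e m i bs' = Some z" using e_tensor_iff_f_tensor[OF _ assms(2) pz] z(2) by blast
  then show ?case using Suc.IH[OF z(1)] by (simp add: iter_Suc')
qed simp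

section \<open>Weights and uniqueness of the morphism\<close>

definition node_weight :: "nat \<Rightarrow> int \<Rightarrow> cartan_basis \<Rightarrow> int" where
  "node_weight e i x = (case x of Coroot j \<Rightarrow> cartan e j i | Scaling \<Rightarrow> of_bool (i mod int e = 0))"

lemma finite_diagram:
  assumes "is_partition l" shows "finite {(a, b). b < l a}"
proof -
  have "{(a, b). b < l a} \<subseteq> {..<rows l} \<times> {..<l 0}"
  proof
    fix x assume "x \<in> {(a, b). b < l a}"
    then obtain a b where x: "x = (a, b)" "b < l a" by auto
    then have "l a \<noteq> 0" by simp
    then show "x \<in> {..<rows l} \<times> {..<l 0}"
      using x partition_eq_0_iff[OF assms, of a] is_partitionD[OF assms, of 0 a] by auto
  qed
  then show ?thesis by (rule finite_subset) simp
qed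

lemma content_add_node:
  assumes "is_partition l" "addable e m i l a"
  shows "int (content e m (add_node a l) j) = int (content e m l j) + of_bool (i mod int e = j mod int e)"
proof -
  let ?S = "\<lambda>l. {(a, b). b < l a \<and> res e m a b = j mod int e}"
  have res: "res e m a (l a) = i mod int e" using assms(2) by (simp add: addable_def)
  have fin: "finite (?S l)" by (rule finite_subset[OF _ finite_diagram[OF assms(1)]]) auto
  show ?thesis
  proof (cases "i mod int e = j mod int e")
    case True
    have "?S (add_node a l) = insert (a, l a) (?S l)"
      using res True by (auto simp: add_node_def split: if_splits)
    then show ?thesis using fin True by (simp add: content_def)
  next
    case False
    have "?S (add_node a l) = ?S l"
      using res False by (auto simp: add_node_def less_Suc_eq split: if_splits)
    then show ?thesis using False by (simp add: content_def)
  qed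
qed

text \<open>\<open>node_weight\<close> is the simple root \<open>\<alpha>\<^sub>i\<close>; by
  \<open>content_add_node\<close> only the content of residue \<open>i\<close> changes.\<close>

lemma wt_add_node:
  assumes "is_partition l" "addable e m i l a" "e \<ge> 2"
  shows "wt e m (add_node a l) x = wt e m l x - node_weight e i x"
proof (cases x)
  case (Coroot j)
  have "(\<Sum>k\<in>{0..<int e}. int (content e m (add_node a l) k) * cartan e j k) =
      (\<Sum>k\<in>{0..<int e}. int (content e m l k) * cartan e j k) +
      (\<Sum>k\<in>{0..<int e}. of_bool (i mod int e = k mod int e) * cartan e j k)"
    unfolding content_add_node[OF assms(1,2)] by (simp only: distrib_right sum.distrib)
  also have "(\<Sum>k\<in>{0..<int e}. of_bool (i mod int e = k mod int e) * cartan e j k) =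
      (\<Sum>k\<in>{0..<int e}. if k = i mod int e then cartan e j (i mod int e) else 0)"
    by (intro sum.cong) auto
  also have "\<dots> = cartan e j i"
    using assms(3) by (simp add: cartan_def mod_simps)
  finally show ?thesis by (simp add: Coroot node_weight_def)
next
  case Scaling
  then show ?thesis by (simp add: node_weight_def content_add_node[OF assms(1,2)])
qed

lemma wt_f_op:
  assumes "is_partition l" "e \<ge> 2" "f_op e m i l = Some l'"
  shows "wt e m l' x = wt e m l x - node_weight e i x"
  using f_opE[OF assms] wt_add_node[OF assms(1) _ assms(2)] by metis

lemma wt_f_tensor:
  assumes "partitions bs" "e \<ge> 2" "f_tensor e m i bs = Some bs'"
  shows "wt_tensor e m bs' x = wt_tensor e m bs x - node_weight e i x"
proof -
  obtain k a where ka: "k < length bs" "addable e m i (bs ! k) a" "bs' = bs[k := add_node a (bs ! k)]"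
    using f_tensorE[OF assms] by metis
  have "is_partition (bs ! k)" using assms(1) ka(1) by (auto simp: partitions_def)
  then have w: "wt e m (add_node a (bs ! k)) x = wt e m (bs ! k) x - node_weight e i x"
    using wt_add_node ka(2) assms(2) by blast
  have bs: "bs = take k bs @ bs ! k # drop (Suc k) bs" using ka(1) by (rule id_take_nth_drop)
  have "bs' = take k bs @ add_node a (bs ! k) # drop (Suc k) bs"
    using ka(1,3) by (simp add: upd_conv_take_nth_drop)
  then have "wt_tensor e m bs' x = wt_tensor e m (take k bs @ bs ! k # drop (Suc k) bs) x - node_weight e i x"
    by (simp add: wt_tensor_def w)
  then show ?thesis using bs by metis
qed

lemma wt_iter_f_tensor:
  assumes "partitions bs" "e \<ge> 2" "iter (f_tensor e m i) n bs = Some bs'"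
  shows "wt_tensor e m bs' x = wt_tensor e m bs x - int n * node_weight e i x"
  using assms(3)
proof (induction n arbitrary: bs')
  case (Suc n)
  then obtain z where z: "iter (f_tensor e m i) n bs = Some z" "f_tensor e m i z = Some bs'"
    by (cases "iter (f_tensor e m i) n bs") (auto simp: iter_Suc)
  have "wt_tensor e m bs' x = wt_tensor e m z x - node_weight e i x"
    by (rule wt_f_tensor[OF iter_f_tensor_count(1)[OF assms(1,2) z(1)] assms(2) z(2)])
  then show ?case unfolding Suc.IH[OF z(1)] by (simp add: distrib_right)
qed simp

lemma wt_amplify:
  assumes "l \<in> restricted_partitions e" "e \<ge> 2"
  shows "wt_tensor e m (amplify e m h l) x = int h * wt e m l x"
  using assms
proof (induction l rule: restricted_induct[where m = m])
  case empty
  then show ?case by (simp add: amplify_empty[OF assms(2)] wt_tensor_def sum_list_replicate)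
next
  case (f_op l i l')
  have "wt_tensor e m (amplify e m h l') x = wt_tensor e m (amplify e m h l) x - int h * node_weight e i x"
    by (rule wt_iter_f_tensor[OF amplify_partitions[OF f_op.hyps(1) assms(2)] assms(2)
        amplify_f_op[OF assms(2) f_op.hyps(1,2)]])
  moreover have "wt e m l' x = wt e m l x - node_weight e i x"
    by (rule wt_f_op[OF restricted_is_partition[OF f_op.hyps(1)] assms(2) f_op.hyps(2)])
  ultimately show ?case using f_op.IH by (simp only: right_diff_distrib)
qed

lemma amplify_morphism:
  assumes "e \<ge> 2" "h \<ge> 1"
  shows "amplitude_morphism e m h (restrict (amplify e m h) (restricted_partitions e))"
proof -
  let ?R = "restricted_partitions e"
  let ?S = "restrict (amplify e m h) ?R"
  have "map_option ?S (f_op e m i b) = iter (f_tensor e m i) h (?S b)" if b: "b \<in> ?R" for b i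
  proof (cases "f_op e m i b")
    case None
    then have "f_tensor e m i (amplify e m h b) = None"
      using amplify_counts(1)[OF assms(1) b, of m i h]
      by (simp add: f_op_eq_None f_tensor_eq_None)
    then have "iter (f_tensor e m i) h (amplify e m h b) = None"
      using assms(2) iter_Suc'[of "f_tensor e m i" "h - 1" "amplify e m h b"] by simp
    then show ?thesis using None b by simp
  next
    case (Some b')
    then show ?thesis using b amplify_f_op[OF assms(1) b Some, of h] f_op_restricted[OF b assms(1) Some]
      by simp
  qed
  moreover have "map_option ?S (e_op e m i b) = iter (e_tensor e m i) h (?S b)" if b: "b \<in> ?R" for b i
  proof (cases "e_op e m i b")
    case None
    then have "e_tensor e m i (amplify e m h b) = None"
      using amplify_counts(2)[OF assms(1) b, of m i h]
      by (simp add: e_op_eq_None e_tensor_eq_None)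
    then have "iter (e_tensor e m i) h (amplify e m h b) = None"
      using assms(2) iter_Suc'[of "e_tensor e m i" "h - 1" "amplify e m h b"] by simp
    then show ?thesis using None b by simp
  next
    case (Some b')
    note b' = e_op_restricted[OF b assms(1) Some]
    have "f_op e m i b' = Some b"
      using e_op_iff_f_op[OF restricted_is_partition[OF b] assms(1) restricted_is_partition[OF b']] Some
      by blast
    from iter_e_tensor[OF amplify_partitions[OF b' assms(1)] assms(1) amplify_f_op[OF assms(1) b' this]]
    show ?thesis using Some b b' by simp
  qed
  moreover have "string_length (e_tensor e m i) (?S b) = h * string_length (e_op e m i) b \<and>
      string_length (f_tensor e m i) (?S b) = h * string_length (f_op e m i) b" if b: "b \<in> ?R" for b i
    using b string_length_f_op[OF restricted_is_partition[OF b] assms(1)]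
      string_length_e_op[OF restricted_is_partition[OF b] assms(1)]
      string_length_f_tensor[OF amplify_partitions[OF b assms(1)] assms(1)]
      string_length_e_tensor[OF amplify_partitions[OF b assms(1)] assms(1)]
      amplify_counts[OF assms(1) b] by simp
  ultimately show ?thesis
    unfolding amplitude_morphism_def using wt_amplify[OF _ assms(1)] amplify_component[OF _ assms(1)]
    by simp
qed

lemma partition_eq_emptyI:
  assumes "is_partition l" "\<And>i. content e m l i = 0"
  shows "l = empty_partition"
proof (rule ccontr)
  assume "l \<noteq> empty_partition"
  then have "l 0 \<noteq> 0" using partition_eq_0_iff[OF assms(1), of 0] partition_rows_0[OF assms(1)] by auto
  then have "(0, 0) \<in> {(a, b). b < l a \<and> res e m a b = m mod int e}" by (simp add: res_def)
  moreover have "finite {(a, b). b < l a \<and> res e m a b = m mod int e}"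
    by (rule finite_subset[OF _ finite_diagram[OF assms(1)]]) auto
  ultimately have "content e m l m \<noteq> 0" by (auto simp: content_def)
  then show False using assms(2) by simp
qed

text \<open>The total content \<open>C\<close> satisfies \<open>2 C j = C (j - 1) + C (j + 1)\<close> and \<open>C 0 = 0\<close>.\<close>

lemma wt_tensor_eq_vacuum:
  assumes "partitions bs" "e \<ge> 2" "\<And>x. wt_tensor e m bs x = int (length bs) * wt e m empty_partition x"
  shows "bs = vacuum (length bs)"
proof -
  define C where "C = (\<lambda>j. \<Sum>b\<leftarrow>bs. int (content e m b j))"
  have C_nonneg: "C j \<ge> 0" for j unfolding C_def by (rule sum_list_nonneg) auto
  have content_mod: "content e m b j = content e m b (j mod int e)" for b j by (simp add: content_def)
  then have C_mod: "C j = C (j mod int e)" for j unfolding C_def by metis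
  have empty: "content e m empty_partition j = 0" for j
    by (simp add: content_def empty_partition_def)
  have "wt_tensor e m bs Scaling = - C 0"
    by (simp add: wt_tensor_def C_def uminus_sum_list_map comp_def)
  \<comment> \<open>The coroots vanish on constant \<open>C\<close>; it is the scaling element that
    excludes a nonzero constant.\<close>
  then have C0: "C 0 = 0" using assms(3)[of Scaling] by (simp add: empty)
  have "(\<Sum>b\<leftarrow>bs. \<Sum>i\<in>{0..<int e}. int (content e m b i) * cartan e j i) =
      (\<Sum>i\<in>{0..<int e}. C i * cartan e j i)" for j
    unfolding C_def by (induction bs) (simp_all add: sum.distrib distrib_right)
  moreover have "wt_tensor e m bs (Coroot j) = int (length bs) * of_bool (j mod int e = m mod int e) -
      (\<Sum>b\<leftarrow>bs. \<Sum>i\<in>{0..<int e}. int (content e m b i) * cartan e j i)" for j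
    unfolding wt_tensor_def by (induction bs) (simp_all add: algebra_simps)
  ultimately have "(\<Sum>i\<in>{0..<int e}. C i * cartan e j i) = 0" for j
    using assms(3)[of "Coroot j"] by (simp add: empty)
  moreover have "(\<Sum>i\<in>{0..<int e}. C i * cartan e j i) = 2 * C j - C (j - 1) - C (j + 1)" for j
  proof -
    have d: "(\<Sum>i\<in>{0..<int e}. C i * of_bool (d mod int e = i mod int e)) = C d" for d
    proof -
      have "(\<Sum>i\<in>{0..<int e}. C i * of_bool (d mod int e = i mod int e)) =
          (\<Sum>i\<in>{0..<int e}. if i = d mod int e then C (d mod int e) else 0)"
        by (intro sum.cong) auto
      then show ?thesis using assms(2) C_mod[of d] by simp
    qed
    have "cartan e j i = 2 * of_bool (j mod int e = i mod int e) -
        of_bool ((j - 1) mod int e = i mod int e) - of_bool ((j + 1) mod int e = i mod int e)" for i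
    proof -
      have "j mod int e = (i + 1) mod int e \<longleftrightarrow> (j - 1) mod int e = i mod int e"
        by (simp add: mod_eq_dvd_iff algebra_simps)
      moreover have "j mod int e = (i - 1) mod int e \<longleftrightarrow> (j + 1) mod int e = i mod int e"
        by (simp add: mod_eq_dvd_iff algebra_simps)
      ultimately show ?thesis by (simp add: cartan_def)
    qed
    then have "(\<Sum>i\<in>{0..<int e}. C i * cartan e j i) =
        2 * (\<Sum>i\<in>{0..<int e}. C i * of_bool (j mod int e = i mod int e)) -
        (\<Sum>i\<in>{0..<int e}. C i * of_bool ((j - 1) mod int e = i mod int e)) -
        (\<Sum>i\<in>{0..<int e}. C i * of_bool ((j + 1) mod int e = i mod int e))"
      by (simp only: right_diff_distrib sum_subtractf sum_distrib_left mult.left_commute)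
    then show ?thesis unfolding d .
  qed
  ultimately have harm: "2 * C j = C (j - 1) + C (j + 1)" for j by (metis add.commute diff_diff_eq eq_iff_diff_eq_0)
  \<comment> \<open>A zero of a nonnegative function with the mean value property forces both
    neighbours to vanish.\<close>
  have Cn: "C (int n) = 0" for n
  proof (induction n)
    case (Suc n)
    then show ?case using harm[of "int n"] C_nonneg[of "int n - 1"] C_nonneg[of "int n + 1"]
      by (simp add: add.commute)
  qed (simp add: C0)
  have "C j = 0" for j
  proof -
    have "j mod int e \<ge> 0" using assms(2) by simp
    then show ?thesis using Cn[of "nat (j mod int e)"] C_mod[of j] by simp
  qed
  then have "content e m b j = 0" if "b \<in> set bs" for b j
  proof -
    have "int (content e m b j) \<le> C j"
      unfolding C_def by (rule member_le_sum_list) (use that in auto)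
    then show ?thesis using \<open>C j = 0\<close> by simp
  qed
  then have "\<forall>b\<in>set bs. b = empty_partition"
    using assms(1) partition_eq_emptyI by (fastforce simp: partitions_def)
  then show ?thesis by (simp add: list_eq_iff_nth_eq)
qed

text \<open>A second morphism agrees with \<open>amplify\<close> on the empty partition, since its
  image there has the weight of the vacuum, which no other element has. From there the commutation
  with the operators decides all other values.\<close>

lemma S_map_eq:
  assumes "e \<ge> 2" "h \<ge> 1" "l \<in> restricted_partitions e"
  shows "S_map e m h l = amplify e m h l"
proof -
  let ?R = "restricted_partitions e"
  let ?S = "restrict (amplify e m h) ?R"
  have "T = ?S" if T: "T \<in> extensional ?R" "amplitude_morphism e m h T" for T
  proof (rule extensionalityI[OF T(1)])
    fix b assume "b \<in> ?R"
    then have "T b = amplify e m h b" using assms(1)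
    proof (induction b rule: restricted_induct[where m = m])
      case empty
      have R: "empty_partition \<in> ?R" using restricted_empty assms(1) by simp
      then have "T empty_partition \<in> highest_component e m h"
        and wt: "wt_tensor e m (T empty_partition) x = int h * wt e m empty_partition x" for x
        using T(2) by (auto simp: amplitude_morphism_def)
      \<comment> \<open>A path in the component is either empty, so that it ends in the vacuum, or
        its last edge ends in the tensor power.\<close>
      then have tp: "T empty_partition \<in> tensor_power e h"
        unfolding highest_component_def mem_Collect_eq
        by (cases rule: rtrancl.cases) (use vacuum_tensor_power[OF assms(1)] in auto)
      then have "length (T empty_partition) = h" by (simp add: tensor_power_def)
      moreover from this have "T empty_partition = vacuum (length (T empty_partition))"
        by (intro wt_tensor_eq_vacuum[OF tensor_power_partitions[OF tp] assms(1), of m]) (simp add: wt)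
      ultimately show ?case by (simp add: amplify_empty[OF assms(1)])
    next
      case (f_op l i l')
      have "map_option T (f_op e m i l) = iter (f_tensor e m i) h (T l)"
        using T(2) f_op.hyps(1) by (simp add: amplitude_morphism_def)
      then show ?case using f_op.IH f_op.hyps(2) amplify_f_op[OF assms(1) f_op.hyps(1,2)] by simp
    qed
    then show "T b = ?S b" using \<open>b \<in> ?R\<close> by simp
  qed simp
  then have "S_map e m h = ?S"
    unfolding S_map_def using amplify_morphism[OF assms(1,2)] by (intro the_equality) auto
  then show ?thesis using assms(3) by simp
qed

section \<open>The base as an iterated attachment of beads\<close>

text \<open>For a core \<open>c\<close> and a bead \<open>x\<close> above it, \<open>attach e x c\<close> is the base of \<open>c \<union> {x}\<close>: the bead \<open>x\<close>
  falls along its runner, and in each window \<open>[w, w + e)\<close> below \<open>x\<close>, \<open>w \<equiv> x\<close>, the smallest bead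
  is moved to \<open>w\<close>.\<close>

definition attach :: "nat \<Rightarrow> int \<Rightarrow> int set \<Rightarrow> int set" where
  "attach e x c = {y. (y \<le> x \<and> int e dvd y - x) \<or>
     (y \<in> c \<and> (\<exists>w y'. int e dvd w - x \<and> w \<le> y' \<and> y' \<in> c \<and> y' < y \<and> y < w + int e))}"

text \<open>The addition of all addable \<open>i\<close>-nodes at once, on the level of beads: a
  bead congruent to \<open>i\<close> advances if the next position is free. Beads congruent to
  \<open>i + 1\<close> stay where they are.\<close>

definition add_all :: "nat \<Rightarrow> int \<Rightarrow> int set \<Rightarrow> int set" where
  "add_all e i c = {y. (y \<in> c \<and> (int e dvd y - i \<longrightarrow> y + 1 \<in> c)) \<or> (int e dvd y - 1 - i \<and> y - 1 \<in> c)}"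

definition core :: "nat \<Rightarrow> int set \<Rightarrow> bool" where
  "core e c \<longleftrightarrow> (\<forall>y\<in>c. y - int e \<in> c)"

section \<open>Attachment of a bead and addition of nodes\<close>

lemma dvd_close:
  assumes "int e dvd w - w'" "w < w' + int e" "w' < w + int e"
  shows "w = w'"
proof (rule ccontr)
  assume "w \<noteq> w'"
  then have "\<bar>int e\<bar> \<le> \<bar>w - w'\<bar>" using assms(1) dvd_imp_le_int[of "w - w'" "int e"] by simp
  then show False using assms(2,3) by linarith
qed

lemma dvd_trans_diff:
  "int e dvd a - b \<Longrightarrow> int e dvd b - c \<Longrightarrow> int e dvd a - c"
  "int e dvd a - c \<Longrightarrow> int e dvd b - c \<Longrightarrow> int e dvd a - b"
  "int e dvd c - a \<Longrightarrow> int e dvd c - b \<Longrightarrow> int e dvd a - b"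
proof -
  show "int e dvd a - b \<Longrightarrow> int e dvd b - c \<Longrightarrow> int e dvd a - c"
    using dvd_add[of "int e" "a - b" "b - c"] by simp
  show "int e dvd a - c \<Longrightarrow> int e dvd b - c \<Longrightarrow> int e dvd a - b"
    using dvd_diff[of "int e" "a - c" "b - c"] by simp
  show "int e dvd c - a \<Longrightarrow> int e dvd c - b \<Longrightarrow> int e dvd a - b"
    using dvd_diff[of "int e" "c - b" "c - a"] by simp
qed

lemma window_exists:
  assumes "e > 0" shows "\<exists>w. int e dvd w - x \<and> w \<le> y \<and> y < w + int e"
proof (intro exI conjI)
  let ?w = "y - (y - x) mod int e"
  have "?w - x = (y - x) - (y - x) mod int e" by simp
  then show "int e dvd ?w - x" by (metis dvd_minus_mod)
  show "?w \<le> y" "y < ?w + int e" using assms by auto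
qed

text \<open>The windows beginning at positions congruent to \<open>x\<close> tile the integers. So
  \<open>y\<close> can be judged in the one window containing it, where just the smallest bead is
  dropped and the left end \<open>w\<close> is filled if \<open>w \<le> x\<close>.\<close>

lemma mem_attach:
  assumes "int e dvd w - x" "w \<le> y" "y < w + int e"
  shows "y \<in> attach e x c \<longleftrightarrow> (y = w \<and> w \<le> x) \<or> (y \<in> c \<and> (\<exists>y'\<in>c. w \<le> y' \<and> y' < y))"
proof -
  have e: "y = w" if "int e dvd y - x"
    using dvd_close[of e y w] dvd_trans_diff(2)[OF that assms(1)] assms(2,3) by simp
  have w: "v = w" if "int e dvd v - x" "v \<le> y" "y < v + int e" for v
    using dvd_close[of e v w] dvd_trans_diff(2)[OF that(1) assms(1)] assms(2,3) that by simp
  show ?thesis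
  proof
    assume "y \<in> attach e x c"
    then consider "y \<le> x" "int e dvd y - x"
      | v y' where "y \<in> c" "int e dvd v - x" "v \<le> y'" "y' \<in> c" "y' < y" "y < v + int e"
      unfolding attach_def by blast
    then show "(y = w \<and> w \<le> x) \<or> (y \<in> c \<and> (\<exists>y'\<in>c. w \<le> y' \<and> y' < y))"
    proof cases
      case 1
      then show ?thesis using e by auto
    next
      case 2
      then have "v = w" using w by simp
      then show ?thesis using 2 by auto
    qed
  next
    assume "(y = w \<and> w \<le> x) \<or> (y \<in> c \<and> (\<exists>y'\<in>c. w \<le> y' \<and> y' < y))"
    then show "y \<in> attach e x c" unfolding attach_def using assms by blast
  qed
qed

lemma dvd_neighbours:
  assumes "e \<ge> 2" shows "int e dvd y - i \<Longrightarrow> \<not> int e dvd y - 1 - i" "int e dvd y - i \<Longrightarrow> \<not> int e dvd y + 1 - i"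
proof -
  have "\<not> int e dvd 1" using assms by auto
  moreover have "(y - i) - (y - 1 - i) = 1" "(y + 1 - i) - (y - i) = 1" by simp_all
  ultimately show "int e dvd y - i \<Longrightarrow> \<not> int e dvd y - 1 - i"
    "int e dvd y - i \<Longrightarrow> \<not> int e dvd y + 1 - i" by (metis dvd_diff)+
qed

lemma mem_add_all:
  assumes "e \<ge> 2"
  shows "int e dvd y - i \<Longrightarrow> y \<in> add_all e i c \<longleftrightarrow> y \<in> c \<and> y + 1 \<in> c"
    "int e dvd y - 1 - i \<Longrightarrow> y \<in> add_all e i c \<longleftrightarrow> y \<in> c \<or> y - 1 \<in> c"
    "\<not> int e dvd y - i \<Longrightarrow> \<not> int e dvd y - 1 - i \<Longrightarrow> y \<in> add_all e i c \<longleftrightarrow> y \<in> c"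
  using dvd_neighbours[OF assms, of y i] by (auto simp: add_all_def)

lemma add_all_id_iff:
  assumes "e \<ge> 2"
  shows "add_all e i c = c \<longleftrightarrow> (\<forall>a\<in>c. int e dvd a - i \<longrightarrow> a + 1 \<in> c)"
proof
  assume "add_all e i c = c"
  then show "\<forall>a\<in>c. int e dvd a - i \<longrightarrow> a + 1 \<in> c" using mem_add_all(1)[OF assms] by blast
next
  assume *: "\<forall>a\<in>c. int e dvd a - i \<longrightarrow> a + 1 \<in> c"
  have "y \<in> add_all e i c \<longleftrightarrow> y \<in> c" for y
  proof -
    have "y \<in> c" if "int e dvd y - 1 - i" "y - 1 \<in> c" using * that by force
    then show ?thesis using * by (auto simp: add_all_def)
  qed
  then show "add_all e i c = c" by blast
qed

lemma attach_add_all_neutral: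
  assumes "e \<ge> 2" "\<not> int e dvd x - i" "\<not> int e dvd x - 1 - i"
  shows "attach e x (add_all e i c) = add_all e i (attach e x c)"
proof -
  have "y \<in> attach e x (add_all e i c) \<longleftrightarrow> y \<in> add_all e i (attach e x c)" for y
  proof -
    obtain w where w: "int e dvd w - x" "w \<le> y" "y < w + int e" using window_exists[of e x y] assms(1) by auto
    have wi: "\<not> int e dvd w - i" "\<not> int e dvd w - 1 - i"
      using w(1) assms(2,3) dvd_trans_diff(3)[of e w x i] dvd_trans_diff(3)[of e w x "i + 1"]
      by (auto simp: algebra_simps)
    have "w + int e - i = (w - i) + int e" "w + int e - 1 - i = (w - 1 - i) + int e" by simp_all
    then have wi': "\<not> int e dvd w + int e - i" "\<not> int e dvd w + int e - 1 - i"
      using wi by (simp_all only: dvd_add_triv_right_iff not_False_eq_True)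
    note mA = mem_attach[OF w(1)]
    let ?s = "add_all e i c"
    consider (l) "int e dvd y - i" | (r) "int e dvd y - 1 - i"
      | (n) "\<not> int e dvd y - i" "\<not> int e dvd y - 1 - i" by blast
    then show ?thesis
    proof cases
      case l
      have "w \<noteq> y" using l wi(1) by blast
      moreover have "y \<noteq> w + int e - 1" using l wi'(2) by blast
      ultimately have wy: "w < y" "y + 1 < w + int e" using w(2,3) by linarith+
      have same: "z \<in> ?s \<longleftrightarrow> z \<in> c" if "w \<le> z" "z < y" for z
      proof (rule mem_add_all(3)[OF assms(1)])
        show "\<not> int e dvd z - i"
          using dvd_close[of e z y] dvd_trans_diff(2)[of e z i y] l that w wy by auto
        show "\<not> int e dvd z - 1 - i"
          using dvd_close[of e "z - 1" y] dvd_trans_diff(2)[of e "z - 1" i y] l that w wy by auto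
      qed
      have "y \<in> attach e x ?s \<longleftrightarrow> y \<in> c \<and> y + 1 \<in> c \<and> (\<exists>y'\<in>c. w \<le> y' \<and> y' < y)"
        using mA[of y ?s] w wy mem_add_all(1)[OF assms(1) l] same by auto
      moreover have "y \<in> add_all e i (attach e x c) \<longleftrightarrow> y \<in> attach e x c \<and> y + 1 \<in> attach e x c"
        by (rule mem_add_all(1)[OF assms(1) l])
      moreover have "y \<in> attach e x c \<longleftrightarrow> y \<in> c \<and> (\<exists>y'\<in>c. w \<le> y' \<and> y' < y)"
        using mA[of y c] w wy by simp
      moreover have "y + 1 \<in> attach e x c \<longleftrightarrow> y + 1 \<in> c \<and> (\<exists>y'\<in>c. w \<le> y' \<and> y' < y + 1)"
        using mA[of "y + 1" c] w wy by simp
      moreover have "\<exists>y'\<in>c. w \<le> y' \<and> y' < y + 1" if "y \<in> c"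
        using that wy by (intro bexI[of _ y]) auto
      ultimately show ?thesis by blast
    next
      case r
      have wy: "w < y - 1"
      proof (rule ccontr)
        assume "\<not> w < y - 1"
        then have "w = y - 1 \<or> w = y" using w by auto
        moreover have "w \<noteq> y - 1" using wi(1) r by blast
        moreover have "w \<noteq> y" using wi(2) r by blast
        ultimately show False by blast
      qed
      have same: "z \<in> ?s \<longleftrightarrow> z \<in> c" if "w \<le> z" "z < y - 1" for z
      proof (rule mem_add_all(3)[OF assms(1)])
        show "\<not> int e dvd z - i"
          using dvd_close[of e z "y - 1"] dvd_trans_diff(2)[of e z i "y - 1"] r that w wy by auto
        show "\<not> int e dvd z - 1 - i"
          using dvd_close[of e "z - 1" "y - 1"] dvd_trans_diff(2)[of e "z - 1" i "y - 1"] r that w wy by auto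
      qed
      have ys: "y - 1 \<in> ?s \<longleftrightarrow> y - 1 \<in> c \<and> y \<in> c" using mem_add_all(1)[OF assms(1) r, of c] by simp
      have split: "(\<exists>y'\<in>d. w \<le> y' \<and> y' < y) \<longleftrightarrow> y - 1 \<in> d \<or> (\<exists>y'\<in>d. w \<le> y' \<and> y' < y - 1)" for d
      proof
        assume "\<exists>y'\<in>d. w \<le> y' \<and> y' < y"
        then obtain y' where y': "y' \<in> d" "w \<le> y'" "y' < y" by blast
        then show "y - 1 \<in> d \<or> (\<exists>y'\<in>d. w \<le> y' \<and> y' < y - 1)" by (cases "y' = y - 1") auto
      next
        assume "y - 1 \<in> d \<or> (\<exists>y'\<in>d. w \<le> y' \<and> y' < y - 1)"
        then show "\<exists>y'\<in>d. w \<le> y' \<and> y' < y"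
        proof
          assume "y - 1 \<in> d"
          then show ?thesis using wy by (intro bexI[of _ "y - 1"]) auto
        next
          assume "\<exists>y'\<in>d. w \<le> y' \<and> y' < y - 1"
          then show ?thesis by force
        qed
      qed
      have ex: "(\<exists>y'\<in>?s. w \<le> y' \<and> y' < y - 1) \<longleftrightarrow> (\<exists>y'\<in>c. w \<le> y' \<and> y' < y - 1)"
        using same by auto
      have "y \<in> attach e x ?s \<longleftrightarrow> (y \<in> c \<or> y - 1 \<in> c) \<and>
          (y - 1 \<in> c \<and> y \<in> c \<or> (\<exists>y'\<in>c. w \<le> y' \<and> y' < y - 1))"
        using mA[of y ?s] w wy mem_add_all(2)[OF assms(1) r] unfolding split ex ys by auto
      moreover have "y \<in> add_all e i (attach e x c) \<longleftrightarrow> y \<in> attach e x c \<or> y - 1 \<in> attach e x c"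
        by (rule mem_add_all(2)[OF assms(1) r])
      moreover have "y \<in> attach e x c \<longleftrightarrow> y \<in> c \<and> (y - 1 \<in> c \<or> (\<exists>y'\<in>c. w \<le> y' \<and> y' < y - 1))"
        using mA[of y c] w wy unfolding split by auto
      moreover have "y - 1 \<in> attach e x c \<longleftrightarrow> y - 1 \<in> c \<and> (\<exists>y'\<in>c. w \<le> y' \<and> y' < y - 1)"
        using mA[of "y - 1" c] w wy by auto
      ultimately show ?thesis by blast
    next
      case n
      have "(\<exists>y'\<in>?s. w \<le> y' \<and> y' < y) \<longleftrightarrow> (\<exists>y'\<in>c. w \<le> y' \<and> y' < y)"
      proof
        assume "\<exists>y'\<in>?s. w \<le> y' \<and> y' < y"
        then obtain y' where y': "y' \<in> ?s" "w \<le> y'" "y' < y" by blast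
        then have "y' \<in> c \<or> (y' - 1 \<in> c \<and> int e dvd y' - 1 - i)" by (auto simp: add_all_def)
        moreover have "w \<noteq> y'" if "int e dvd y' - 1 - i" using that wi by auto
        ultimately consider "y' \<in> c" | "y' - 1 \<in> c" "w \<noteq> y'" by blast
        then show "\<exists>y'\<in>c. w \<le> y' \<and> y' < y"
        proof cases
          case 2
          then show ?thesis using y'(2,3) by (intro bexI[of _ "y' - 1"]) auto
        qed (use y' in blast)
      next
        assume "\<exists>y'\<in>c. w \<le> y' \<and> y' < y"
        then obtain y' where y': "y' \<in> c" "w \<le> y'" "y' < y" by blast
        show "\<exists>y'\<in>?s. w \<le> y' \<and> y' < y"
        proof (cases "y' \<in> ?s")
          case False
          then have d: "int e dvd y' - i" using y'(1) by (auto simp: add_all_def)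
          then have "y' + 1 \<noteq> y" using n(2) by auto
          moreover have "y' + 1 \<in> ?s" using d y'(1) by (simp add: add_all_def)
          ultimately show ?thesis using y' by (intro bexI[of _ "y' + 1"]) auto
        qed (use y' in blast)
      qed
      then show ?thesis
        using mA[of y ?s] mA[of y c] w mem_add_all(3)[OF assms(1) n] by auto
    qed
  qed
  then show ?thesis by blast
qed

text \<open>Here the pairs are the first two positions of the windows. A bead that advances from
  \<open>w\<close> to \<open>w + 1\<close> is the smallest one of its window before and after, and
  \<open>attach\<close> drops the smallest bead anyway.\<close>

lemma attach_add_all_addable:
  assumes "e \<ge> 2" "int e dvd x - i"
  shows "attach e x (add_all e i c) = attach e x c"
proof -
  let ?s = "add_all e i c"
  have "y \<in> attach e x ?s \<longleftrightarrow> y \<in> attach e x c" for y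
  proof -
    obtain w where w: "int e dvd w - x" "w \<le> y" "y < w + int e" using window_exists[of e x y] assms(1) by auto
    note mA = mem_attach[OF w]
    have wi: "int e dvd w - i" using dvd_trans_diff(1)[OF w(1) assms(2)] .
    have same: "z \<in> ?s \<longleftrightarrow> z \<in> c" if "w + 1 < z" "z < w + int e" for z
    proof (rule mem_add_all(3)[OF assms(1)])
      show "\<not> int e dvd z - i"
        using dvd_close[of e z w] dvd_trans_diff(2)[of e z i w] wi that by auto
      show "\<not> int e dvd z - 1 - i"
        using dvd_close[of e "z - 1" w] dvd_trans_diff(2)[of e "z - 1" i w] wi that by auto
    qed
    have ws: "w \<in> ?s \<longleftrightarrow> w \<in> c \<and> w + 1 \<in> c" by (rule mem_add_all(1)[OF assms(1) wi])
    have ws1: "w + 1 \<in> ?s \<longleftrightarrow> w \<in> c \<or> w + 1 \<in> c"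
      using mem_add_all(2)[OF assms(1), of "w + 1" i c] wi by auto
    have "(y \<in> ?s \<and> (\<exists>y'\<in>?s. w \<le> y' \<and> y' < y)) \<longleftrightarrow> (y \<in> c \<and> (\<exists>y'\<in>c. w \<le> y' \<and> y' < y))"
    proof -
      consider "y = w" | "y = w + 1" | "y > w + 1" using w(2) by linarith
      then show ?thesis
      proof cases
        case 1
        then show ?thesis by auto
      next
        case 2
        have "(\<exists>y'\<in>d. w \<le> y' \<and> y' < y) \<longleftrightarrow> w \<in> d" for d
          using 2 by (auto intro: bexI[of _ w])
        then show ?thesis using 2 ws ws1 by auto
      next
        case 3
        have *: "(\<exists>y'\<in>d. w \<le> y' \<and> y' < y) \<longleftrightarrow> w \<in> d \<or> w + 1 \<in> d \<or> (\<exists>y'\<in>d. w + 1 < y' \<and> y' < y)" for d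
        proof
          assume "\<exists>y'\<in>d. w \<le> y' \<and> y' < y"
          then obtain y' where y': "y' \<in> d" "w \<le> y'" "y' < y" by blast
          consider "y' = w" | "y' = w + 1" | "y' > w + 1" using y'(2) by linarith
          then show "w \<in> d \<or> w + 1 \<in> d \<or> (\<exists>y'\<in>d. w + 1 < y' \<and> y' < y)" using y' by cases auto
        next
          assume "w \<in> d \<or> w + 1 \<in> d \<or> (\<exists>y'\<in>d. w + 1 < y' \<and> y' < y)"
          then show "\<exists>y'\<in>d. w \<le> y' \<and> y' < y"
          proof (elim disjE bexE)
            assume "w \<in> d" then show ?thesis using 3 by (intro bexI[of _ w]) auto
          next
            assume "w + 1 \<in> d" then show ?thesis using 3 by (intro bexI[of _ "w + 1"]) auto
          next
            fix y' assume "y' \<in> d" "w + 1 < y' \<and> y' < y"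
            then show ?thesis by (intro bexI[of _ y']) auto
          qed
        qed
        have "(\<exists>y'\<in>?s. w + 1 < y' \<and> y' < y) \<longleftrightarrow> (\<exists>y'\<in>c. w + 1 < y' \<and> y' < y)"
          using same w(3) by (meson order_less_trans)
        then show ?thesis unfolding * ws ws1 using same[of y] 3 w(3) by auto
      qed
    qed
    then show ?thesis unfolding mA by simp
  qed
  then show ?thesis by blast
qed

text \<open>Raising the bead by one shifts all windows by one position. Since a bead of
  \<open>c\<close> at a left end \<open>w\<close> always has a neighbour at \<open>w + 1\<close>,
  both families of windows keep the same beads beyond \<open>w + 1\<close>; at \<open>w\<close> and
  \<open>w + 1\<close> the sets differ by the advance of the bead that \<open>attach\<close> puts at
  \<open>w\<close>.\<close>

lemma attach_Suc:
  assumes "e \<ge> 2" "core e c" "add_all e x c = c" "c \<subseteq> {..<x}"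
  shows "attach e (x + 1) c = add_all e x (attach e x c)"
proof -
  have up: "a + 1 \<in> c" if "a \<in> c" "int e dvd a - x" for a
    using add_all_id_iff[OF assms(1), of x c] assms(3) that by blast
  have "y \<in> attach e (x + 1) c \<longleftrightarrow> y \<in> add_all e x (attach e x c)" for y
  proof -
    obtain w where w: "int e dvd w - x" "w \<le> y" "y < w + int e" using window_exists[of e x y] assms(1) by auto
    have e2: "int e \<ge> 2" using assms(1) by simp
    note mA = mem_attach[OF w(1)]
    have w1: "int e dvd (w + 1) - (x + 1)" using w(1) by simp
    have wx: "w \<le> x \<longleftrightarrow> w + 1 \<le> x + 1" by simp
    have wA: "w \<in> attach e x c \<longleftrightarrow> w \<le> x" using mA[of w c] e2 by auto
    have w1A: "w + 1 \<in> attach e x c \<longleftrightarrow> w + 1 \<in> c \<and> w \<in> c"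
    proof -
      have "(\<exists>y'\<in>c. w \<le> y' \<and> y' < w + 1) \<longleftrightarrow> w \<in> c"
        by (auto intro: bexI[of _ w])
      then show ?thesis using mA[of "w + 1" c] e2 by auto
    qed
    consider "y = w" | "y = w + 1" | "y > w + 1" using w(2) by linarith
    then show ?thesis
    proof cases
      case 1
      have we: "int e dvd (w + 1 - int e) - (x + 1)"
        using dvd_diff[OF w1 dvd_refl] by (simp add: algebra_simps)
      have "w \<in> attach e (x + 1) c \<longleftrightarrow> w \<in> c"
      proof -
        have "w - int e + 1 \<in> c" if "w \<in> c"
        proof (rule up)
          show "w - int e \<in> c" using assms(2) that by (simp add: core_def)
          show "int e dvd w - int e - x" using dvd_diff[OF w(1) dvd_refl] by (simp add: algebra_simps)
        qed
        then show ?thesis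
          using mem_attach[OF we, of w c] e2 by (auto intro!: bexI[of _ "w - int e + 1"])
      qed
      moreover have "w \<in> add_all e x (attach e x c) \<longleftrightarrow> w \<le> x \<and> w + 1 \<in> c \<and> w \<in> c"
        using mem_add_all(1)[OF assms(1) w(1)] wA w1A by simp
      moreover have "w + 1 \<in> c" if "w \<in> c" using up[OF that w(1)] .
      moreover have "w \<le> x" if "w \<in> c" using that assms(4) by auto
      ultimately show ?thesis using 1 by blast
    next
      case 2
      have "w + 1 \<in> attach e (x + 1) c \<longleftrightarrow> w \<le> x"
        using mem_attach[OF w1, of "w + 1" c] e2 by auto
      moreover have "w + 1 \<in> add_all e x (attach e x c) \<longleftrightarrow> (w + 1 \<in> c \<and> w \<in> c) \<or> w \<le> x"
        using mem_add_all(2)[OF assms(1), of "w + 1" x] w(1) wA w1A by auto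
      moreover have "w \<le> x" if "w \<in> c" using that assms(4) by auto
      ultimately show ?thesis using 2 by blast
    next
      case 3
      have "y \<in> attach e (x + 1) c \<longleftrightarrow> y \<in> c \<and> (\<exists>y'\<in>c. w + 1 \<le> y' \<and> y' < y)"
        using mem_attach[OF w1, of y c] 3 w by auto
      moreover have "y \<in> attach e x c \<longleftrightarrow> y \<in> c \<and> (\<exists>y'\<in>c. w \<le> y' \<and> y' < y)"
        using mA[of y c] 3 w by auto
      moreover have "y \<in> add_all e x (attach e x c) \<longleftrightarrow> y \<in> attach e x c"
      proof (rule mem_add_all(3)[OF assms(1)])
        show "\<not> int e dvd y - x"
          using dvd_close[of e y w] dvd_trans_diff(2)[of e y x w] w 3 by auto
        show "\<not> int e dvd y - 1 - x"
          using dvd_close[of e "y - 1" w] dvd_trans_diff(2)[of e "y - 1" x w] w 3 by auto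
      qed
      moreover have "(\<exists>y'\<in>c. w \<le> y' \<and> y' < y) \<longleftrightarrow> (\<exists>y'\<in>c. w + 1 \<le> y' \<and> y' < y)"
      proof
        assume "\<exists>y'\<in>c. w \<le> y' \<and> y' < y"
        then obtain y' where y': "y' \<in> c" "w \<le> y'" "y' < y" by blast
        show "\<exists>y'\<in>c. w + 1 \<le> y' \<and> y' < y"
        proof (cases "y' = w")
          case True
          then have "w + 1 \<in> c" using up[of w] y' w(1) by blast
          then show ?thesis using 3 by (intro bexI[of _ "w + 1"]) auto
        next
          case False
          then show ?thesis using y' by (intro bexI[of _ y']) auto
        qed
      next
        assume "\<exists>y'\<in>c. w + 1 \<le> y' \<and> y' < y"
        then obtain y' where "y' \<in> c" "w + 1 \<le> y'" "y' < y" by blast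
        then show "\<exists>y'\<in>c. w \<le> y' \<and> y' < y" by (intro bexI[of _ y']) auto
      qed
      ultimately show ?thesis by blast
    qed
  qed
  then show ?thesis by blast
qed

text \<open>All positions up to \<open>x\<close> that are congruent to \<open>x\<close> are occupied
  after the attachment. A bead congruent to \<open>i\<close> lies below \<open>x\<close>, so it is
  blocked by one of them.\<close>

lemma attach_removable:
  assumes "e \<ge> 2" "int e dvd x - 1 - i" "c \<subseteq> {..<x}"
  shows "add_all e i (attach e x c) = attach e x c"
  unfolding add_all_id_iff[OF assms(1)]
proof (intro ballI impI)
  fix a assume a: "a \<in> attach e x c" "int e dvd a - i"
  have "\<not> int e dvd a - x"
  proof
    assume "int e dvd a - x"
    then have "int e dvd x - a" by (metis dvd_minus_iff minus_diff_eq)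
    from dvd_trans_diff(1)[OF this a(2)] have "int e dvd x - i" .
    then show False using dvd_neighbours(1)[OF assms(1), of x i] assms(2) by blast
  qed
  then have "a < x" using a(1) assms(3) by (auto simp: attach_def)
  moreover have "int e dvd (a + 1) - x"
    using dvd_trans_diff(2)[OF a(2) assms(2)] by (simp add: algebra_simps)
  ultimately show "a + 1 \<in> attach e x c" by (simp add: attach_def)
qed

lemma core_lessThan: "core e {..<x}"
  by (simp add: core_def)

lemma core_down:
  assumes "core e c" "y \<in> c" "int e dvd y - w" "w \<le> y" "e > 0"
  shows "w \<in> c"
proof -
  have *: "y - int e * int k \<in> c" for k
  proof (induction k)
    case (Suc k)
    then have "y - int e * int k - int e \<in> c" using assms(1) by (simp add: core_def)
    then show ?case by (simp add: algebra_simps)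
  qed (use assms(2) in simp)
  obtain k where k: "y - w = int e * k" using assms(3) by (auto simp: dvd_def)
  have "k \<ge> 0"
  proof (rule ccontr)
    assume "\<not> k \<ge> 0"
    then have "int e * k < 0" using assms(5) by (simp add: mult_pos_neg)
    then show False using k assms(4) by simp
  qed
  moreover have "w = y - int e * k" using k by simp
  ultimately show ?thesis using *[of "nat k"] by simp
qed

lemma dvd_gap: "int e dvd w - x \<Longrightarrow> x < w \<Longrightarrow> x + int e \<le> w"
  using zdvd_imp_le[of "int e" "w - x"] by simp

lemma window_cong:
  assumes "\<And>z. w \<le> z \<Longrightarrow> z < y \<Longrightarrow> z \<in> c \<longleftrightarrow> z \<in> c'"
  shows "(\<exists>z\<in>c. w \<le> z \<and> z < y) \<longleftrightarrow> (\<exists>z\<in>c'. w \<le> z \<and> z < y)"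
  using assms by blast

lemma attach_core:
  assumes "core e c" shows "core e (attach e x c)"
  unfolding core_def
proof
  fix y assume "y \<in> attach e x c"
  then consider "y \<le> x" "int e dvd y - x"
    | w y' where "y \<in> c" "int e dvd w - x" "w \<le> y'" "y' \<in> c" "y' < y" "y < w + int e"
    unfolding attach_def by blast
  then show "y - int e \<in> attach e x c"
  proof cases
    case 1
    then have "int e dvd y - int e - x" using dvd_diff[OF 1(2) dvd_refl] by (simp add: algebra_simps)
    then show ?thesis using 1 by (simp add: attach_def)
  next
    case 2
    have "int e dvd w - int e - x" using dvd_diff[OF 2(2) dvd_refl] by (simp add: algebra_simps)
    moreover have "y - int e \<in> c" "y' - int e \<in> c" using assms 2 by (simp_all add: core_def)
    ultimately show ?thesis using 2 unfolding attach_def mem_Collect_eq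
      by (intro disjI2 conjI exI[of _ "w - int e"] exI[of _ "y' - int e"]) auto
  qed
qed

lemma attach_subset: "c \<subseteq> {..<x + 1} \<Longrightarrow> attach e x c \<subseteq> {..<x + 1}"
  by (auto simp: attach_def)

lemma mem_attach_self: "x \<in> attach e x c"
  by (simp add: attach_def)

text \<open>If \<open>x\<close> rests on a bead at \<open>x - e\<close>, all left ends below
  \<open>x\<close> are already occupied because \<open>c\<close> is a core. Each of them is the
  smallest bead of its window, so nothing moves.\<close>

lemma attach_trivial:
  assumes "core e c" "x - int e \<in> c" "c \<subseteq> {..<x}" "e > 0"
  shows "attach e x c = insert x c"
proof -
  have "y \<in> attach e x c \<longleftrightarrow> y \<in> insert x c" for y
  proof -
    obtain w where w: "int e dvd w - x" "w \<le> y" "y < w + int e" using window_exists[OF assms(4)] by blast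
    have wc: "w \<in> c" if "w < x"
    proof -
      have xw: "int e dvd x - w" using dvd_diff[OF dvd_0_right w(1)] by simp
      then have "int e dvd x - int e - w" using dvd_diff[OF xw dvd_refl] by (simp add: algebra_simps)
      moreover have "w \<le> x - int e" using dvd_gap[OF xw that] by simp
      ultimately show ?thesis by (rule core_down[OF assms(1,2) _ _ assms(4)])
    qed
    have "y \<in> insert x c \<longleftrightarrow> (y = w \<and> w \<le> x) \<or> (y \<in> c \<and> (\<exists>y'\<in>c. w \<le> y' \<and> y' < y))"
    proof
      assume y: "y \<in> insert x c"
      show "(y = w \<and> w \<le> x) \<or> (y \<in> c \<and> (\<exists>y'\<in>c. w \<le> y' \<and> y' < y))"
      proof (cases "y = w")
        case True
        then show ?thesis using y assms(3) by auto
      next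
        case False
        then have "y \<noteq> x" using w dvd_close[OF w(1)] assms(4) by auto
        then have "y \<in> c" "y < x" using y assms(3) by auto
        then show ?thesis using False w(2) wc by (intro disjI2 conjI bexI[of _ w]) auto
      qed
    next
      assume "(y = w \<and> w \<le> x) \<or> (y \<in> c \<and> (\<exists>y'\<in>c. w \<le> y' \<and> y' < y))"
      then show "y \<in> insert x c" using wc by (cases "w = x") auto
    qed
    then show ?thesis using mem_attach[OF w] by simp
  qed
  then show ?thesis by blast
qed

lemma attach_lessThan:
  assumes "e > 0" shows "attach e x {..<x} = {..<x + 1}"
proof -
  have "attach e x {..<x} = insert x {..<x}"
    by (rule attach_trivial) (use assms in \<open>simp_all add: core_lessThan\<close>)
  also have "\<dots> = {..<x + 1}" by auto
  finally show ?thesis .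
qed

definition attach_all :: "nat \<Rightarrow> int set \<Rightarrow> int list \<Rightarrow> int set" where
  "attach_all e c xs = foldl (\<lambda>c x. attach e x c) c xs"

lemma attach_all_simps [simp]:
  "attach_all e c [] = c" "attach_all e c (x # xs) = attach_all e (attach e x c) xs"
  "attach_all e c (xs @ ys) = attach_all e (attach_all e c xs) ys"
  by (simp_all add: attach_all_def)

lemma attach_all_core: "core e c \<Longrightarrow> core e (attach_all e c xs)"
  by (induction xs arbitrary: c) (simp_all add: attach_core)

lemma attach_all_subset:
  assumes "c \<subseteq> {..<u}" "\<forall>x\<in>set xs. x < u" shows "attach_all e c xs \<subseteq> {..<u}"
  using assms
proof (induction xs arbitrary: c)
  case (Cons x xs)
  have "attach e x c \<subseteq> {..<u}" using Cons.prems by (auto simp: attach_def)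
  then show ?case using Cons.IH Cons.prems by simp
qed simp

definition attach_beads :: "nat \<Rightarrow> int \<Rightarrow> (nat \<Rightarrow> nat) \<Rightarrow> int set" where
  "attach_beads e m l = attach_all e {..<m - int (rows l) + 1} (map (\<lambda>k. int (l k) + m - int k) (rev [0..<rows l]))"

text \<open>The bead of the first row is the largest and is attached last. For the empty partition
  the step adds one more bead to the vacuum, so the formula needs no case distinction.\<close>

lemma attach_beads_step:
  assumes "is_partition l" "e > 0"
  shows "attach_beads e m l = attach e (m + int (l 0)) (attach_beads e (m - 1) (tail l))"
proof (cases "rows l")
  case 0
  then have l: "l = empty_partition" using partition_rows_0[OF assms(1)] by blast
  then have "tail l = empty_partition" by (auto simp: empty_partition_def tail_def)
  moreover have "rows empty_partition = 0" by (simp add: rows_def empty_partition_def)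
  moreover have "l 0 = 0" by (simp add: l empty_partition_def)
  ultimately show ?thesis using l attach_lessThan[OF assms(2), of m]
    by (simp add: attach_beads_def add.commute)
next
  case (Suc n)
  have "[0..<Suc n] = 0 # map Suc [0..<n]"
    using upt_rec[of 0 "Suc n"] by (simp add: map_Suc_upt del: upt_Suc)
  then have "map (\<lambda>k. int (l k) + m - int k) (rev [0..<Suc n]) =
      map (\<lambda>k. int (tail l k) + (m - 1) - int k) (rev [0..<n]) @ [m + int (l 0)]"
    by (simp add: rev_map comp_def algebra_simps del: upt_Suc)
  then show ?thesis
    using rows_tail[OF assms(1)] Suc by (simp add: attach_beads_def del: upt_Suc)
qed

lemma attach_beads_core: "core e (attach_beads e m l)"
  by (simp add: attach_beads_def attach_all_core core_lessThan)

lemma attach_beads_subset: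
  assumes "is_partition l" shows "attach_beads e m l \<subseteq> {..<m + int (l 0) + 1}"
  unfolding attach_beads_def
proof (rule attach_all_subset)
  show "\<forall>x\<in>set (map (\<lambda>k. int (l k) + m - int k) (rev [0..<rows l])). x < m + int (l 0) + 1"
  proof
    fix x assume "x \<in> set (map (\<lambda>k. int (l k) + m - int k) (rev [0..<rows l]))"
    then obtain k where k: "x = int (l k) + m - int k" by (auto simp: rev_map)
    have "l k \<le> l 0" using is_partitionD[OF assms, of 0 k] by simp
    then show "x < m + int (l 0) + 1" using k by simp
  qed
qed auto

lemma add_all_cong: "x mod int e = i mod int e \<Longrightarrow> add_all e x c = add_all e i c"
proof -
  assume "x mod int e = i mod int e"
  then have *: "int e dvd x - i" by (simp add: mod_eq_dvd_iff)
  have "int e dvd y - x \<longleftrightarrow> int e dvd y - i" for y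
    using dvd_trans_diff(1)[of e y x i] * dvd_trans_diff(2)[of e y i x] by blast
  moreover have "int e dvd y - 1 - x \<longleftrightarrow> int e dvd y - 1 - i" for y
    using dvd_trans_diff(1)[of e "y - 1" x i] * dvd_trans_diff(2)[of e "y - 1" i x] by blast
  ultimately show ?thesis by (simp add: add_all_def)
qed

text \<open>The residue of the first bead selects the case. In case \<open>A\<close> with no
  surviving letter in the tail, the first row grows and \<open>attach_Suc\<close> applies; its
  hypothesis is the claim for \<open>phi = 0\<close>, which is therefore part of the induction. If a
  letter survives in the tail, then \<open>phi\<close> is at least 2 and
  \<open>attach_add_all_addable\<close> hides any change of the tail. In case \<open>R\<close> the
  operator acts only if two letters survive in the tail, whose base is then unchanged, and
  \<open>attach_removable\<close> makes both alternatives equal. In case \<open>N\<close> the claim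
  for the tail is passed on by \<open>attach_add_all_neutral\<close>.\<close>

lemma attach_beads_f_op:
  assumes "is_partition l" "e \<ge> 2"
  shows "phi e m i l = 0 \<Longrightarrow> add_all e i (attach_beads e m l) = attach_beads e m l"
    "f_op e m i l = Some l' \<Longrightarrow> attach_beads e m l' =
       (if 2 \<le> phi e m i l then attach_beads e m l else add_all e i (attach_beads e m l))"
proof -
  have e0: "e > 0" using assms(2) by simp
  have "(phi e m i l = 0 \<longrightarrow> add_all e i (attach_beads e m l) = attach_beads e m l) \<and>
    (\<forall>l'. f_op e m i l = Some l' \<longrightarrow> attach_beads e m l' =
       (if 2 \<le> phi e m i l then attach_beads e m l else add_all e i (attach_beads e m l)))"
    using assms(1)
  proof (induction l m rule: partition_induct)
    case (empty m)
    have rows0: "rows empty_partition = 0" by (simp add: rows_def empty_partition_def)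
    have v: "attach_beads e m empty_partition = {..<m + 1}" for m
      by (simp add: attach_beads_def rows0)
    show ?case
    proof (cases "m mod int e = i mod int e")
      case True
      let ?l = "add_node 0 empty_partition"
      have ad: "addable e m i empty_partition 0" using True by (simp add: addable_res empty_partition_def)
      have "attach_beads e m ?l = attach e (m + 1) {..<m}"
        using attach_beads_step[OF is_partition_add_node[OF is_partition_empty ad] e0, of m] v[of "m - 1"]
        by (simp add: add_node_def tail_def empty_partition_def)
      also have "\<dots> = add_all e m (attach e m {..<m})"
      proof (rule attach_Suc[OF assms(2) core_lessThan])
        show "add_all e m {..<m} = {..<m}"
          unfolding add_all_id_iff[OF assms(2)]
        proof (intro ballI impI)
          fix a assume a: "a \<in> {..<m}" "int e dvd a - m"
          then have "a \<noteq> m - 1" using dvd_neighbours(1)[OF assms(2), of m m] by auto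
          then show "a + 1 \<in> {..<m}" using a by auto
        qed
      qed simp
      finally show ?thesis using True v add_all_cong[OF True] attach_lessThan[OF e0, of m]
        by (simp add: signature_empty f_op_def)
    next
      case False
      have "add_all e i {..<m + 1} = {..<m + 1}"
        unfolding add_all_id_iff[OF assms(2)]
      proof (intro ballI impI)
        fix a assume a: "a \<in> {..<m + 1}" "int e dvd a - i"
        then have "a \<noteq> m" using False by (auto simp: mod_eq_dvd_iff)
        then show "a + 1 \<in> {..<m + 1}" using a by auto
      qed
      then show ?thesis using False v by (simp add: signature_empty f_op_def)
    qed
  next
    case (Cons l m)
    let ?c = "attach_beads e (m - 1) (tail l)" and ?x = "m + int (l 0)"
    let ?w = "signature e (m - 1) i (tail l)"
    note v = attach_beads_step[OF Cons(1) e0, of m]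
    have sub: "?c \<subseteq> {..<?x}"
      using attach_beads_subset[OF is_partition_tail[OF Cons(1)], of e "m - 1"]
        is_partition_Suc[OF Cons(1), of 0] by auto
    have IH0: "add_all e i ?c = ?c" if "phi_word ?w = 0" using mp[OF conjunct1[OF Cons.IH] that] .
    have IH1: "attach_beads e (m - 1) (add_node a (tail l)) = (if 2 \<le> phi_word ?w then ?c else add_all e i ?c)"
      if "rightmost_addable ?w = Some a" for a
    proof -
      have "f_op e (m - 1) i (tail l) = Some (add_node a (tail l))" using that by (simp add: f_op_def)
      from mp[OF spec[OF conjunct2[OF Cons.IH]] this] show ?thesis .
    qed
    have node: "attach_beads e m (add_node (Suc a) l) = attach e ?x (attach_beads e (m - 1) (add_node a (tail l)))"
      if "rightmost_addable (signature e m i l) = Some (Suc a)" for a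
    proof -
      have "addable e m i l (Suc a)"
        using rightmost_addable_in[OF that] set_signature[OF Cons(1)] by auto
      moreover have "tail (add_node (Suc a) l) = add_node a (tail l)"
        by (auto simp: tail_def add_node_def)
      moreover have "add_node (Suc a) l 0 = l 0" by (simp add: add_node_def)
      ultimately show ?thesis
        using attach_beads_step[OF is_partition_add_node[OF Cons(1)] e0, of e m i "Suc a" m] by simp
    qed
    have fop: "f_op e m i l = map_option (\<lambda>a. add_node a l) (rightmost_addable (signature e m i l))"
      by (simp add: f_op_def)
    consider (A) "?x mod int e = i mod int e" | (R) "(?x - 1) mod int e = i mod int e"
      | (N) "?x mod int e \<noteq> i mod int e" "(?x - 1) mod int e \<noteq> i mod int e" by blast
    then show ?case
    proof cases
      case A
      then have d: "int e dvd ?x - i" by (simp add: mod_eq_dvd_iff)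
      note s = signature_step_addable[OF Cons(1) assms(2) A]
      show ?thesis
      proof (cases "phi_word ?w = 0")
        case True
        have ad: "addable e m i l 0" using A by (simp add: addable_res)
        have "tail (add_node 0 l) = tail l" by (auto simp: tail_def add_node_def)
        moreover have "m + int (add_node 0 l 0) = ?x + 1" by (simp add: add_node_def)
        ultimately have "attach_beads e m (add_node 0 l) = attach e (?x + 1) ?c"
          using attach_beads_step[OF is_partition_add_node[OF Cons(1) ad] e0, of m] by (simp add: add.assoc)
        also have "\<dots> = add_all e ?x (attach e ?x ?c)"
          using attach_Suc[OF assms(2) attach_beads_core _ sub] IH0[OF True] add_all_cong[OF A] by simp
        finally show ?thesis using True add_all_cong[OF A] by (simp add: s fop v)
      next
        case False
        then obtain a where a: "rightmost_addable ?w = Some a"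
          using rightmost_addable_eq_None[of ?w] by (cases "rightmost_addable ?w") auto
        then have r: "rightmost_addable (signature e m i l) = Some (Suc a)" using False by (simp add: s)
        have "attach e ?x (attach_beads e (m - 1) (add_node a (tail l))) = attach e ?x ?c"
          using IH1[OF a] attach_add_all_addable[OF assms(2) d] by simp
        moreover have "f_op e m i l = Some (add_node (Suc a) l)" by (simp add: fop r)
        ultimately show ?thesis using False by (simp add: node[OF r] v s)
      qed
    next
      case R
      then have d: "int e dvd ?x - 1 - i" by (simp add: mod_eq_dvd_iff)
      note s = signature_step_removable[OF Cons(1) assms(2) R]
      have id: "add_all e i (attach e ?x ?c) = attach e ?x ?c"
        by (rule attach_removable[OF assms(2) d sub])
      have "attach_beads e m l' = attach e ?x ?c" if l': "f_op e m i l = Some l'" for l'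
      proof -
        obtain a where a: "rightmost_addable ?w = Some a" "2 \<le> phi_word ?w"
            "rightmost_addable (signature e m i l) = Some (Suc a)" "l' = add_node (Suc a) l"
          using l' s(3) by (auto simp: fop split: if_splits)
        then show ?thesis using node[OF a(3)] IH1[OF a(1)] by simp
      qed
      then show ?thesis using id by (simp add: v)
    next
      case N
      then have d: "\<not> int e dvd ?x - i" "\<not> int e dvd ?x - 1 - i" by (simp_all add: mod_eq_dvd_iff)
      note s = signature_step_neutral[OF Cons(1) assms(2) N]
      note nc = attach_add_all_neutral[OF assms(2) d]
      show ?thesis
      proof (cases "phi_word ?w = 0")
        case True
        then show ?thesis using IH0 nc[of ?c] rightmost_addable_eq_None[of ?w] by (simp add: v s fop)
      next
        case False
        then obtain a where a: "rightmost_addable ?w = Some a"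
          using rightmost_addable_eq_None[of ?w] by (cases "rightmost_addable ?w") auto
        then have r: "rightmost_addable (signature e m i l) = Some (Suc a)" by (simp add: s)
        then have "f_op e m i l = Some (add_node (Suc a) l)" by (simp add: fop)
        then show ?thesis using IH1[OF a] nc[of ?c] False by (simp add: node[OF r] v s)
      qed
    qed
  qed
  then show "phi e m i l = 0 \<Longrightarrow> add_all e i (attach_beads e m l) = attach_beads e m l"
    "f_op e m i l = Some l' \<Longrightarrow> attach_beads e m l' =
       (if 2 \<le> phi e m i l then attach_beads e m l else add_all e i (attach_beads e m l))" by auto
qed

text \<open>Two cores that become equal once a bead is attached at \<open>a + e\<close> remain so when a bead
  \<open>s\<close> with \<open>a < s < a + e\<close> is attached first. It suffices to compare \<open>c\<close> with the set obtained
  from it by moving the smallest bead of each window \<open>[w, w + e)\<close>, \<open>w \<equiv> a\<close>, to \<open>w\<close>.\<close>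

lemma attach_attach_normal:
  assumes "core e c" "c \<subseteq> {..<s}" "a < s" "s < a + int e" "b \<in> c" "a \<le> b" "e > 0"
  defines "c' \<equiv> attach e (a + int e) c - {a + int e}"
  shows "attach e (a + int e) (attach e s c) = attach e (a + int e) (attach e s c')"
proof -
  let ?a = "a + int e"
  let ?D = "attach e s c" and ?D' = "attach e s c'"
  have sub': "c' \<subseteq> {..<s}"
  proof
    fix y assume "y \<in> c'"
    then consider "y \<le> ?a" "int e dvd y - ?a" "y \<noteq> ?a" | "y \<in> c" by (auto simp: c'_def attach_def)
    then show "y \<in> {..<s}"
    proof cases
      case 1
      have "\<not> a < y" using dvd_close[OF 1(2)] 1 assms(7) by auto
      then show ?thesis using assms(3) by simp
    qed (use assms(2) in auto)
  qed
  have D_sub: "?D \<subseteq> {..<s + 1}" "?D' \<subseteq> {..<s + 1}" using assms(2) sub' by (auto intro!: attach_subset)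
  have "y \<in> attach e ?a ?D \<longleftrightarrow> y \<in> attach e ?a ?D'" for y
  proof -
    obtain w where w: "int e dvd w - ?a" "w \<le> y" "y < w + int e" using window_exists[OF assms(7)] by blast
    show ?thesis
    proof (cases "w \<le> a")
      case False
      have "int e dvd w - a" using dvd_add[OF w(1) dvd_refl] by simp
      then have "w \<ge> ?a" using dvd_gap[of e w a] False by simp
      then have "y \<notin> ?D" "y \<notin> ?D'" using w(2) D_sub assms(4) by auto
      then show ?thesis unfolding mem_attach[OF w] by simp
    next
      case True
      \<comment> \<open>The left end congruent to \<open>s\<close> that lies in the window of
        \<open>w\<close>.\<close>
      define sw where "sw = w + (s - a)"
      have sw: "w < sw" "sw < w + int e" "sw \<le> s" using assms(3,4) True by (auto simp: sw_def)
      have wa: "int e dvd w - a"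
        using dvd_add[OF w(1) dvd_refl] by simp
      then have aw: "int e dvd a - w" by (metis dvd_minus_iff minus_diff_eq)
      have dsw: "int e dvd sw - s" using wa by (simp add: sw_def algebra_simps)
      have dsw': "int e dvd sw - int e - s" using dvd_diff[OF dsw dvd_refl] by (simp add: algebra_simps)
      \<comment> \<open>The bead \<open>b\<close>, brought down its runner into the window of
        \<open>w\<close>. It guarantees that the smallest bead of this window lies below
        \<open>sw\<close>.\<close>
      define \<beta> where "\<beta> = b - (a - w)"
      have \<beta>: "\<beta> \<in> c" "w \<le> \<beta>" "\<beta> < sw"
      proof -
        show "\<beta> \<in> c" unfolding \<beta>_def
          by (rule core_down[OF assms(1,5) _ _ assms(7)]) (use aw True in auto)
        show "w \<le> \<beta>" "\<beta> < sw" using assms(2,5,6) by (auto simp: \<beta>_def sw_def)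
      qed
      have \<beta>e: "\<beta> - int e \<in> c" using assms(1) \<beta>(1) by (simp add: core_def)
      have c': "z \<in> c' \<longleftrightarrow> z = w \<or> (z \<in> c \<and> (\<exists>y'\<in>c. w \<le> y' \<and> y' < z))" if "w \<le> z" "z < w + int e" for z
        using mem_attach[OF w(1) that, of c] True that by (auto simp: c'_def)
      have we: "int e dvd w - int e - ?a" using dvd_diff[OF w(1) dvd_refl] by (simp add: algebra_simps)
      have R: "z \<in> c' \<longleftrightarrow> z \<in> c" if "sw \<le> z" "z < w + int e" for z
      proof -
        have "\<exists>y'\<in>c. w \<le> y' \<and> y' < z" using \<beta> that by (intro bexI[of _ \<beta>]) auto
        then show ?thesis using c'[of z] that sw by auto
      qed
      have R': "z \<in> c' \<longleftrightarrow> z \<in> c" if "sw - int e \<le> z" "z < w" for z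
      proof -
        have "z \<in> attach e ?a c \<longleftrightarrow> (z = w - int e \<and> w - int e \<le> ?a) \<or> (z \<in> c \<and> (\<exists>y'\<in>c. w - int e \<le> y' \<and> y' < z))"
          by (rule mem_attach[OF we]) (use that sw in auto)
        moreover have "\<exists>y'\<in>c. w - int e \<le> y' \<and> y' < z" using \<beta>e \<beta> that by (intro bexI[of _ "\<beta> - int e"]) auto
        ultimately show ?thesis using that sw True by (auto simp: c'_def)
      qed
      have high: "z \<in> ?D' \<longleftrightarrow> z \<in> ?D" if z: "sw \<le> z" "z < w + int e" for z
      proof -
        have zz: "z < sw + int e" using z sw by simp
        have "(\<exists>y'\<in>c'. sw \<le> y' \<and> y' < z) \<longleftrightarrow> (\<exists>y'\<in>c. sw \<le> y' \<and> y' < z)"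
          by (rule window_cong) (use R z in auto)
        then show ?thesis using mem_attach[OF dsw z(1) zz] R[OF z] by simp
      qed
      have low: "z \<in> attach e s d \<longleftrightarrow> z \<in> d \<and> ((\<exists>y'\<in>d. sw - int e \<le> y' \<and> y' < w) \<or> (\<exists>y'\<in>d. w \<le> y' \<and> y' < z))"
        if z: "w \<le> z" "z < sw" for z d
      proof -
        have "z \<in> attach e s d \<longleftrightarrow> (z = sw - int e \<and> sw - int e \<le> s) \<or> (z \<in> d \<and> (\<exists>y'\<in>d. sw - int e \<le> y' \<and> y' < z))"
          by (rule mem_attach[OF dsw']) (use z sw in auto)
        moreover have "z \<noteq> sw - int e" using z sw by simp
        moreover have "(\<exists>y'\<in>d. sw - int e \<le> y' \<and> y' < z) \<longleftrightarrow>
            (\<exists>y'\<in>d. sw - int e \<le> y' \<and> y' < w) \<or> (\<exists>y'\<in>d. w \<le> y' \<and> y' < z)"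
        proof
          assume "\<exists>y'\<in>d. sw - int e \<le> y' \<and> y' < z"
          then obtain y' where "y' \<in> d" "sw - int e \<le> y'" "y' < z" by blast
          then show "(\<exists>y'\<in>d. sw - int e \<le> y' \<and> y' < w) \<or> (\<exists>y'\<in>d. w \<le> y' \<and> y' < z)"
            by (cases "y' < w") auto
        next
          assume "(\<exists>y'\<in>d. sw - int e \<le> y' \<and> y' < w) \<or> (\<exists>y'\<in>d. w \<le> y' \<and> y' < z)"
          then show "\<exists>y'\<in>d. sw - int e \<le> y' \<and> y' < z"
          proof (elim disjE bexE conjE)
            fix y' assume "y' \<in> d" "sw - int e \<le> y'" "y' < w"
            then show ?thesis using z by (intro bexI[of _ y']) auto
          next
            fix y' assume "y' \<in> d" "w \<le> y'" "y' < z"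
            then show ?thesis using sw by (intro bexI[of _ y']) auto
          qed
        qed
        ultimately show ?thesis by blast
      qed
      have r: "(\<exists>y'\<in>c'. sw - int e \<le> y' \<and> y' < w) \<longleftrightarrow> (\<exists>y'\<in>c. sw - int e \<le> y' \<and> y' < w)"
        by (rule window_cong) (use R' in auto)
      have wc': "w \<in> c'" using c'[of w] assms(7) by simp
      have "(y \<in> ?D \<and> (\<exists>y'\<in>?D. w \<le> y' \<and> y' < y)) \<longleftrightarrow> (y \<in> ?D' \<and> (\<exists>y'\<in>?D'. w \<le> y' \<and> y' < y))" if yw: "y \<noteq> w"
      \<comment> \<open>The window of \<open>s\<close> that ends at \<open>sw\<close> begins at
        \<open>sw - e\<close>, before \<open>w\<close>. If it has a bead before \<open>w\<close>,
        its smallest bead is there and the beads from \<open>w\<close> to \<open>sw\<close> are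
        untouched. Otherwise attaching \<open>s\<close> drops the smallest bead of the window of
        \<open>w\<close>, for \<open>c\<close> as for \<open>c'\<close>, and the same beads
        remain.\<close>
      proof (cases "\<exists>y'\<in>c. sw - int e \<le> y' \<and> y' < w")
        case True
        have lowD: "z \<in> ?D \<longleftrightarrow> z \<in> c" "z \<in> ?D' \<longleftrightarrow> z \<in> c'" if "w \<le> z" "z < sw" for z
          using low[OF that] True r by auto
        have wD': "w \<in> ?D'" using lowD(2)[of w] wc' sw by simp
        have bD: "\<beta> \<in> ?D" using lowD(1)[of \<beta>] \<beta> by simp
        have wy: "w < y" using w(2) yw by simp
        show ?thesis
        proof (cases "sw \<le> y")
          case True
          have "\<exists>y'\<in>?D. w \<le> y' \<and> y' < y" using bD \<beta> True by (intro bexI[of _ \<beta>]) auto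
          moreover have "\<exists>y'\<in>?D'. w \<le> y' \<and> y' < y" using wD' wy by (intro bexI[of _ w]) auto
          ultimately show ?thesis using high[OF True w(3)] by blast
        next
          case False
          then have ys: "y < sw" by simp
          have "(\<exists>y'\<in>?D. w \<le> y' \<and> y' < y) \<longleftrightarrow> (\<exists>y'\<in>c. w \<le> y' \<and> y' < y)"
            by (rule window_cong) (use lowD(1) ys in auto)
          moreover have "\<exists>y'\<in>?D'. w \<le> y' \<and> y' < y" using wD' wy by (intro bexI[of _ w]) auto
          ultimately show ?thesis using lowD[OF w(2) ys] c'[OF w(2,3)] yw by blast
        qed
      next
        case False
        have "z \<in> ?D' \<longleftrightarrow> z \<in> ?D" if z: "w \<le> z" "z < w + int e" for z
        proof (cases "sw \<le> z")
          case F: False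
          then have zs: "z < sw" by simp
          have "z \<in> ?D' \<longleftrightarrow> z \<in> c' \<and> (\<exists>y'\<in>c'. w \<le> y' \<and> y' < z)"
            using low[OF z(1) zs, of c'] False r by blast
          also have "\<dots> \<longleftrightarrow> z \<in> c \<and> (\<exists>y'\<in>c. w \<le> y' \<and> y' < z)"
            using c'[OF z] wc' z by (cases "z = w") force+
          also have "\<dots> \<longleftrightarrow> z \<in> ?D" using low[OF z(1) zs, of c] False by blast
          finally show ?thesis .
        qed (use high z in blast)
        then have same: "z \<in> ?D' \<longleftrightarrow> z \<in> ?D" if "w \<le> z" "z < w + int e" for z using that by blast
        have "(\<exists>y'\<in>?D'. w \<le> y' \<and> y' < y) \<longleftrightarrow> (\<exists>y'\<in>?D. w \<le> y' \<and> y' < y)"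
          by (rule window_cong) (use same w(3) in auto)
        then show ?thesis using same[OF w(2,3)] by simp
      qed
      then show ?thesis unfolding mem_attach[OF w] using True assms(7) by auto
    qed
  qed
  then show ?thesis by blast
qed

text \<open>The beads \<open>ss\<close> are passed one at a time by
  \<open>attach_attach_normal\<close>. The bead just attached serves as the next witness at or above
  \<open>a\<close>, so the hypotheses reproduce themselves.\<close>

lemma attach_attach_all_cong:
  assumes "core e c" "core e c'" "attach e (a + int e) c = attach e (a + int e) c'"
    "c \<subseteq> {..<u}" "c' \<subseteq> {..<u}" "b \<in> c" "a \<le> b" "b' \<in> c'" "a \<le> b'" "u \<le> a + int e"
    "sorted_wrt (<) ss" "\<forall>s\<in>set ss. u \<le> s \<and> a < s \<and> s < a + int e" "e > 0"
  shows "attach e (a + int e) (attach_all e c ss) = attach e (a + int e) (attach_all e c' ss)"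
  using assms(1-12)
proof (induction ss arbitrary: c c' u b b')
  case (Cons s ss)
  have s: "u \<le> s" "a < s" "s < a + int e" using Cons.prems(12) by auto
  have sub: "c \<subseteq> {..<s}" "c' \<subseteq> {..<s}" using Cons.prems(4,5) s(1) by auto
  have eq: "attach e (a + int e) (attach e s c) = attach e (a + int e) (attach e s c')"
    using attach_attach_normal[OF Cons.prems(1) sub(1) s(2,3) Cons.prems(6,7) assms(13)]
      attach_attach_normal[OF Cons.prems(2) sub(2) s(2,3) Cons.prems(8,9) assms(13)] Cons.prems(3)
    by simp
  have sub': "attach e s c \<subseteq> {..<s + 1}" "attach e s c' \<subseteq> {..<s + 1}"
    using sub by (auto intro!: attach_subset)
  have "attach e (a + int e) (attach_all e (attach e s c) ss) = attach e (a + int e) (attach_all e (attach e s c') ss)"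
    by (rule Cons.IH[OF attach_core[OF Cons.prems(1)] attach_core[OF Cons.prems(2)] eq sub'
        mem_attach_self _ mem_attach_self]) (use s Cons.prems(11,12) in auto)
  then show ?case by simp
qed simp

text \<open>Attaching \<open>b\<close> merely inserts it, since it rests on \<open>b - e\<close>. It
  is the only bead between \<open>a\<close> and \<open>a + e\<close>, and the attachment at
  \<open>a + e\<close> replaces it by \<open>a\<close>; in the lower windows that attachment does
  what attaching \<open>a\<close> in advance would have done. So both sides agree without
  \<open>ss\<close>, and \<open>attach_attach_all_cong\<close> inserts these beads.\<close>

lemma attach_attach_all_swap:
  assumes "core e d" "d \<subseteq> {..<a}" "a < b" "b < a + int e" "b - int e \<in> d"
    "sorted_wrt (<) ss" "\<forall>s\<in>set ss. b < s \<and> s < a + int e" "e > 0"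
  shows "attach e (a + int e) (attach_all e (attach e b d) ss) = attach e (a + int e) (attach_all e (attach e a d) ss)"
proof -
  have "d \<subseteq> {..<b}" using assms(2,3) by auto
  then have bd: "attach e b d = insert b d" using attach_trivial[of e d b] assms(1,5,8) by simp
  let ?a = "a + int e"
  have "y \<in> attach e ?a (insert b d) \<longleftrightarrow> y \<in> attach e ?a (attach e a d)" for y
  proof -
    obtain w where w: "int e dvd w - ?a" "w \<le> y" "y < w + int e" using window_exists[OF assms(8)] by blast
    have wa: "int e dvd w - a" using dvd_add[OF w(1) dvd_refl] by simp
    have "w < a \<or> w = a \<or> w \<ge> ?a" using dvd_gap[OF wa] by linarith
    then consider "w < a" | "w = a" | "w \<ge> ?a" by blast
    then show ?thesis
    proof cases
      case 1
      have "int e dvd a - w" using dvd_diff[OF dvd_0_right wa] by simp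
      then have wa': "w + int e \<le> a" using dvd_gap[of e a w] 1 by simp
      have A: "z \<in> attach e a d \<longleftrightarrow> z = w \<or> (z \<in> d \<and> (\<exists>y'\<in>d. w \<le> y' \<and> y' < z))"
        if "w \<le> z" "z < w + int e" for z using mem_attach[OF wa that] 1 by simp
      have "(y \<in> insert b d \<and> (\<exists>y'\<in>insert b d. w \<le> y' \<and> y' < y)) \<longleftrightarrow> (y \<in> d \<and> (\<exists>y'\<in>d. w \<le> y' \<and> y' < y))"
        using wa' w assms(3) by auto
      moreover have "(y \<in> attach e a d \<and> (\<exists>y'\<in>attach e a d. w \<le> y' \<and> y' < y)) \<longleftrightarrow>
          (y \<in> d \<and> (\<exists>y'\<in>d. w \<le> y' \<and> y' < y))" (is "?l \<longleftrightarrow> ?r")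
      proof
        assume ?r
        then have "y \<in> attach e a d" "w < y" using A[OF w(2,3)] by auto
        moreover have "w \<in> attach e a d" using A[of w] assms(8) by simp
        ultimately show ?l by (intro conjI bexI[of _ w]) auto
      next
        assume ?l then show ?r using A[OF w(2,3)] by auto
      qed
      ultimately show ?thesis unfolding mem_attach[OF w] by blast
    next
      case 2
      have sub: "attach e a d \<subseteq> {..<a + 1}" using assms(2) by (intro attach_subset) auto
      have "\<not> (y \<in> insert b d \<and> (\<exists>y'\<in>insert b d. w \<le> y' \<and> y' < y))" using 2 assms(2) by auto
      moreover have "\<not> (y \<in> attach e a d \<and> (\<exists>y'\<in>attach e a d. w \<le> y' \<and> y' < y))" using 2 sub by force
      ultimately show ?thesis unfolding mem_attach[OF w] by blast
    next
      case 3
      have sub: "attach e a d \<subseteq> {..<a + 1}" using assms(2) by (intro attach_subset) auto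
      have "y \<notin> insert b d" "y \<notin> attach e a d" using 3 w(2) assms(2,4,8) sub by auto
      then show ?thesis unfolding mem_attach[OF w] by blast
    qed
  qed
  then have eq: "attach e ?a (attach e b d) = attach e ?a (attach e a d)" unfolding bd by blast
  show ?thesis
  proof (rule attach_attach_all_cong[OF attach_core[OF assms(1)] attach_core[OF assms(1)] eq, of "b + 1" b a])
    show "attach e b d \<subseteq> {..<b + 1}" unfolding bd using assms(2,3) by auto
    have "attach e a d \<subseteq> {..<a + 1}" using assms(2) by (intro attach_subset) auto
    then show "attach e a d \<subseteq> {..<b + 1}" using assms(3) by auto
    show "b \<in> attach e b d" "a \<in> attach e a d" by (rule mem_attach_self)+
  qed (use assms(3,4,6-8) in auto)
qed

section \<open>Attachment of all beads and the operation \<open>down\<close>\<close>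

lemma attach_all_flush:
  assumes "core e c" "sorted_wrt (<) xs" "\<forall>x\<in>set xs. x - int e \<in> c \<union> set xs \<and> c \<subseteq> {..<x}" "e > 0"
  shows "attach_all e c xs = c \<union> set xs"
  using assms(1-3)
proof (induction xs arbitrary: c)
  case (Cons x xs)
  have "x - int e \<notin> insert x (set xs)" using Cons.prems(2) assms(4) by auto
  then have "x - int e \<in> c" using Cons.prems(3) by auto
  then have c: "attach e x c = insert x c" using attach_trivial[of e c x] Cons.prems(1,3) assms(4) by simp
  have "core e (insert x c)" using attach_core[OF Cons.prems(1), of x] c by simp
  then have "attach_all e (insert x c) xs = insert x c \<union> set xs"
    using Cons.prems by (intro Cons.IH) auto
  then show ?case by (simp add: c)
qed simp

text \<open>The gap left by the omitted bead is moved from index \<open>b\<close> to the front one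
  place at a time. Each exchange of a bead \<open>z\<close> for the next one is an instance of
  \<open>attach_attach_all_swap\<close> with \<open>a = z\<close>; the later attachment at
  \<open>z + e\<close> that it requires is found in \<open>us\<close>.\<close>

lemma attach_all_swap_chain:
  assumes "core e d" "sorted_wrt (<) (zz @ us)" "\<forall>x\<in>set zz. d \<subseteq> {..<x}"
    "\<forall>x\<in>set zz. \<forall>y\<in>set zz. y < x + int e" "\<forall>x\<in>set (tl zz). x - int e \<in> d"
    "b < length zz" "\<forall>i<b. zz ! i + int e \<in> set us" "e > 0"
  shows "attach_all e d (take b zz @ drop (Suc b) zz @ us) = attach_all e d (tl zz @ us)"
  using assms(1-7)
proof (induction b arbitrary: zz d)
  case 0
  then show ?case by (simp add: drop_Suc)
next
  case (Suc b)
  obtain z z2 zs where zz: "zz = z # z2 # zs"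
    using Suc.prems(6) by (cases zz; cases "tl zz") auto
  have lt: "z < z2" "\<forall>x\<in>set zs. z2 < x" using Suc.prems(2) by (auto simp: zz)
  have dz: "d \<subseteq> {..<z}" "z2 - int e \<in> d" using Suc.prems(3,5) by (auto simp: zz)
  have sub: "attach e z d \<subseteq> {..<z + 1}" using dz(1) by (intro attach_subset) auto
  have keep: "x - int e \<in> attach e z d" if "x \<in> set zs" for x
  proof -
    have "z < x" "x < z + int e" using lt that Suc.prems(4) by (auto simp: zz)
    then have "x - int e \<in> attach e z d \<longleftrightarrow> (x - int e = z - int e \<and> z - int e \<le> z) \<or>
        (x - int e \<in> d \<and> (\<exists>y'\<in>d. z - int e \<le> y' \<and> y' < x - int e))"
      by (intro mem_attach) auto
    moreover have "\<exists>y'\<in>d. z - int e \<le> y' \<and> y' < x - int e"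
      using dz(2) lt that by (intro bexI[of _ "z2 - int e"]) auto
    ultimately show ?thesis using Suc.prems(5) that by (auto simp: zz)
  qed
  have "attach_all e (attach e z d) (take b (z2 # zs) @ drop (Suc b) (z2 # zs) @ us) =
      attach_all e (attach e z d) (tl (z2 # zs) @ us)"
  proof (rule Suc.IH)
    show "core e (attach e z d)" by (rule attach_core[OF Suc.prems(1)])
    show "\<forall>x\<in>set (z2 # zs). attach e z d \<subseteq> {..<x}" using sub lt by force
    show "\<forall>i<b. (z2 # zs) ! i + int e \<in> set us" using Suc.prems(7) by (auto simp: zz)
  qed (use Suc.prems keep in \<open>auto simp: zz\<close>)
  also have "\<dots> = attach_all e (attach e z2 d) (zs @ us)"
  proof -
    have "z + int e \<in> set us" using Suc.prems(7) by (auto simp: zz)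
    then obtain us1 us2 where us: "us = us1 @ (z + int e) # us2" by (meson split_list)
    have "attach e (z + int e) (attach_all e (attach e z2 d) (zs @ us1)) =
        attach e (z + int e) (attach_all e (attach e z d) (zs @ us1))"
    proof (rule attach_attach_all_swap[OF Suc.prems(1) dz(1) lt(1) _ dz(2) _ _ assms(8)])
      show "z2 < z + int e" using Suc.prems(4) by (simp add: zz)
      show "sorted_wrt (<) (zs @ us1)" using Suc.prems(2) by (simp add: zz us sorted_wrt_append)
      show "\<forall>s\<in>set (zs @ us1). z2 < s \<and> s < z + int e"
        using Suc.prems(2,4) by (auto simp: zz us sorted_wrt_append)
    qed
    then show ?thesis by (simp add: us)
  qed
  finally show ?case by (simp add: zz)
qed

text \<open>Restrictedness of the partition: consecutive beads are at most \<open>e\<close>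
  apart.\<close>

definition gapless :: "nat \<Rightarrow> int set \<Rightarrow> bool" where
  "gapless e J \<longleftrightarrow> (\<forall>x\<in>J. \<exists>y\<in>J. x - int e \<le> y \<and> y < x)"

lemma sorted_split:
  "sorted_wrt (<) xs \<Longrightarrow> filter (\<lambda>x. x < a) xs @ filter (\<lambda>x. \<not> x < (a::int)) xs = xs"
proof (induction xs)
  case (Cons x xs)
  show ?case
  proof (cases "x < a")
    case False
    then have "filter (\<lambda>x. x < a) xs = []" "filter (\<lambda>x. \<not> x < a) xs = xs"
      using Cons.prems by (auto simp: filter_empty_conv filter_id_conv)
    then show ?thesis using False by simp
  qed (use Cons in auto)
qed simp

text \<open>The bead \<open>p\<close> pushes the smallest bead \<open>z\<close> of the window below
  it to \<open>p - e\<close>. On the lower windows this acts like an attachment at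
  \<open>p - e\<close>, and the other beads of the window remain.\<close>

lemma attach_clump:
  assumes "c0 \<subseteq> {..<p - int e}" "sorted_wrt (<) (z # zs)" "\<forall>x\<in>set (z # zs). p - int e < x \<and> x < p" "e > 0"
  shows "attach e p (c0 \<union> set (z # zs)) = attach e (p - int e) c0 \<union> set zs \<union> {p}"
proof -
  have "y \<in> attach e p (c0 \<union> set (z # zs)) \<longleftrightarrow> y \<in> attach e (p - int e) c0 \<union> set zs \<union> {p}" for y
  proof -
    obtain w where w: "int e dvd w - p" "w \<le> y" "y < w + int e" using window_exists[OF assms(4)] by blast
    have w': "int e dvd w - (p - int e)" using dvd_add[OF w(1) dvd_refl] by (simp add: algebra_simps)
    have sub: "attach e (p - int e) c0 \<subseteq> {..<p - int e + 1}" using assms(1) by (intro attach_subset) auto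
    note m = mem_attach[OF w] mem_attach[OF w' w(2,3)]
    consider "w < p - int e" | "w = p - int e" | "w > p - int e" by linarith
    then show ?thesis
    proof cases
      case 1
      have "int e dvd p - int e - w" using dvd_diff[OF dvd_0_right w'] by simp
      then have y: "y < p - int e" using dvd_gap 1 w(3) by force
      have "(\<exists>y'\<in>c0 \<union> set (z # zs). w \<le> y' \<and> y' < y) \<longleftrightarrow> (\<exists>y'\<in>c0. w \<le> y' \<and> y' < y)"
        by (rule window_cong) (use y assms(3) in auto)
      moreover have "y \<in> c0 \<union> set (z # zs) \<longleftrightarrow> y \<in> c0" "y \<notin> set zs" "y \<noteq> p"
        using y assms(3) by force+
      ultimately show ?thesis unfolding m Un_iff using 1 by auto
    next
      case 2
      have "y \<notin> c0" "y \<noteq> p" using 2 w assms(1) by auto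
      moreover have "(\<exists>y'\<in>c0 \<union> set (z # zs). w \<le> y' \<and> y' < y) \<longleftrightarrow> z < y"
      proof
        assume "\<exists>y'\<in>c0 \<union> set (z # zs). w \<le> y' \<and> y' < y"
        then obtain y' where "y' \<in> c0 \<union> set (z # zs)" "w \<le> y'" "y' < y" by blast
        moreover have "z \<le> y'" if "y' \<in> set (z # zs)" using that assms(2) by auto
        ultimately show "z < y" using assms(1) 2 by force
      next
        assume "z < y"
        then show "\<exists>y'\<in>c0 \<union> set (z # zs). w \<le> y' \<and> y' < y"
          using assms(3) 2 by (intro bexI[of _ z]) auto
      qed
      moreover have "y \<in> set (z # zs) \<and> z < y \<longleftrightarrow> y \<in> set zs" using assms(2) by auto
      ultimately show ?thesis unfolding m Un_iff using 2 assms(4) by auto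
    next
      case 3
      then have "p \<le> w" using dvd_gap[OF w'] by simp
      then have "y \<notin> c0 \<union> set (z # zs)" "y \<notin> attach e (p - int e) c0" "y \<notin> set zs" "y = w \<and> w \<le> p \<longleftrightarrow> y = p"
        using w sub assms(1,3) by force+
      then show ?thesis unfolding m(1) Un_iff by auto
    qed
  qed
  then show ?thesis by blast
qed

text \<open>A bead \<open>x\<close> that loses its neighbour \<open>q\<close> finds a new one at
  \<open>p - e\<close>, \<open>p\<close>, \<open>z\<close> or \<open>z + e\<close>, where
  \<open>z\<close> is a bead strictly between \<open>p - e\<close> and \<open>p\<close>. The last
  possibility occurs for \<open>q = p\<close>, when the beads of this interval have beads at
  distance \<open>e\<close> above them.\<close>

lemma gapless_down:
  assumes "gapless e J" "p \<in> J" "p - int e \<notin> J" "\<And>x. x \<in> J \<Longrightarrow> x < p \<Longrightarrow> x - int e \<in> J"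
    "p - int e < q" "q \<le> p" "\<And>x. p - int e < x \<Longrightarrow> x < q \<Longrightarrow> x \<in> J \<Longrightarrow> x + int e \<in> J"
  shows "gapless e (J - {q} \<union> {p - int e})"
  unfolding gapless_def
proof
  let ?J = "J - {q} \<union> {p - int e}"
  obtain z where z: "z \<in> J" "p - int e \<le> z" "z < p" using assms(1,2) by (auto simp: gapless_def)
  then have zp: "p - int e < z" using assms(3) by (cases "z = p - int e") auto
  fix x assume x: "x \<in> ?J"
  show "\<exists>y\<in>?J. x - int e \<le> y \<and> y < x"
  proof (cases "x = p - int e")
    case True
    have "z - int e \<in> J" by (rule assms(4)[OF z(1,3)])
    then show ?thesis using True z zp assms(5) by (intro bexI[of _ "z - int e"]) auto
  next
    case False
    then have xJ: "x \<in> J" "x \<noteq> q" using x by auto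
    then obtain y where y: "y \<in> J" "x - int e \<le> y" "y < x" using assms(1) by (auto simp: gapless_def)
    consider "y \<noteq> q" | "y = q" "q < p" "x \<le> p" | "y = q" "q < p" "x > p" | "y = q" "q = p" "x \<le> z + int e"
      | "y = q" "q = p" "x > z + int e" using assms(6) by linarith
    then show ?thesis
    proof cases
      case 1 then show ?thesis using y by (intro bexI[of _ y]) auto
    next
      case 2 then show ?thesis using y assms(5) by (intro bexI[of _ "p - int e"]) auto
    next
      case 3 then show ?thesis using y assms(2) by (intro bexI[of _ p]) auto
    next
      case 4 then show ?thesis using y z by (intro bexI[of _ z]) auto
    next
      case 5
      then have "z + int e \<in> J" using assms(7)[OF zp] z by simp
      then show ?thesis using 5 y zp by (intro bexI[of _ "z + int e"]) auto
    qed
  qed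
qed

lemma beta_base_down:
  assumes "U_set e J \<noteq> {}" "U_set e ((down e ^^ n) (down e J)) = {}"
  shows "U_set e ((down e ^^ Suc n) J) = {}" "beta_base e J = beta_base e (down e J)"
proof -
  show *: "U_set e ((down e ^^ Suc n) J) = {}" using assms(2) by (simp add: funpow_swap1)
  have "(LEAST n. U_set e ((down e ^^ n) J) = {}) = Suc (LEAST n. U_set e ((down e ^^ Suc n) J) = {})"
    by (rule Least_Suc[where P = "\<lambda>n. U_set e ((down e ^^ n) J) = {}", OF *]) (use assms(1) in simp)
  then show "beta_base e J = beta_base e (down e J)"
    by (simp add: beta_base_def funpow_swap1)
qed

text \<open>Induction on the total height of the beads above \<open>L\<close>. Let \<open>zz\<close>
  consist of the beads in \<open>(p - e, p]\<close>. Attaching them has the same effect as attaching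
  \<open>p - e\<close> first and omitting the smallest bead of \<open>zz\<close>, see
  \<open>vzz\<close>. The operation \<open>down\<close> inserts the same \<open>p - e\<close> but
  omits \<open>q\<close>; the omission is moved from one place to the other by
  \<open>attach_all_swap_chain\<close>.\<close>

lemma beta_base_attach_all:
  assumes "e > 0" "sorted_wrt (<) xs" "\<forall>x\<in>set xs. L \<le> x" "gapless e ({..<L} \<union> set xs)"
  shows "(\<exists>n. U_set e ((down e ^^ n) ({..<L} \<union> set xs)) = {}) \<and>
    beta_base e ({..<L} \<union> set xs) = attach_all e {..<L} xs"
  using assms(2-4)
proof (induction "nat (\<Sum>x\<leftarrow>xs. x - L)" arbitrary: xs rule: less_induct)
  case (less xs)
  define J where "J = {..<L} \<union> set xs"
  have low: "x \<in> J" if "x < L" for x using that by (simp add: J_def)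
  show ?case
  proof (cases "U_set e J = {}")
    case True
    have "(LEAST n. U_set e ((down e ^^ n) J) = {}) = 0" by (rule Least_eq_0) (use True in simp)
    then have "beta_base e J = J" by (simp add: beta_base_def)
    moreover have "attach_all e {..<L} xs = J"
      unfolding J_def
    proof (rule attach_all_flush[OF core_lessThan less.prems(1) _ assms(1)])
      show "\<forall>x\<in>set xs. x - int e \<in> {..<L} \<union> set xs \<and> {..<L} \<subseteq> {..<x}"
        using True less.prems(2) by (fastforce simp: U_set_def J_def)
    qed
    moreover have "U_set e ((down e ^^ 0) J) = {}" using True by simp
    ultimately show ?thesis unfolding J_def by blast
  next
    case False
    have U_sub: "U_set e J \<subseteq> set xs" using low by (force simp: U_set_def J_def)
    then have finU: "finite (U_set e J)" using finite_subset by blast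
    define p where "p = Min (U_set e J)"
    have pU: "p \<in> U_set e J" unfolding p_def by (rule Min_in[OF finU False])
    then have p: "p \<in> J" "p - int e \<notin> J" "p \<in> set xs" using U_sub by (auto simp: U_set_def)
    have pL: "L \<le> p - int e" using low[of "p - int e"] p(2) by force
    have flush: "x - int e \<in> J" if "x \<in> J" "x < p" for x
    proof (rule ccontr)
      assume "x - int e \<notin> J"
      then have "x \<in> U_set e J" using that(1) by (simp add: U_set_def)
      then have "p \<le> x" unfolding p_def by (rule Min_le[OF finU])
      then show False using that(2) by simp
    qed
    define q where "q = Min (W_set e J)"
    have W: "W_set e J = {x. x > p - int e \<and> x \<in> J \<and> x + int e \<notin> J} \<union> {p}"
      by (simp only: W_set_def p_def Let_def)
    have "W_set e J \<subseteq> set xs" unfolding W using p(3) pL by (auto simp: J_def)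
    then have finW: "finite (W_set e J)" using finite_subset by blast
    have qW: "q \<in> W_set e J" unfolding q_def by (rule Min_in[OF finW]) (auto simp: W)
    have qp: "q \<le> p" unfolding q_def by (rule Min_le[OF finW]) (simp add: W)
    have q: "q \<in> J" "p - int e < q" using qW p(1) assms(1) by (auto simp: W)
    \<comment> \<open>This is the point of \<open>W_set\<close>: the beads of
      \<open>(p - e, q)\<close> cannot be the removed ones because they support a bead at distance
      \<open>e\<close>.\<close>
    have blocked: "x + int e \<in> J" if "p - int e < x" "x < q" "x \<in> J" for x
    proof (rule ccontr)
      assume "x + int e \<notin> J"
      then have "x \<in> W_set e J" using that by (simp add: W)
      then have "q \<le> x" unfolding q_def by (rule Min_le[OF finW])
      then show False using that(2) by simp
    qed
    obtain ys us where xs: "xs = ys @ p # us" using p(3) by (meson split_list)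
    define pre zs where "pre = filter (\<lambda>x. x < p - int e) ys" and "zs = filter (\<lambda>x. \<not> x < p - int e) ys"
    have "sorted_wrt (<) ys" using less.prems(1) by (simp add: xs sorted_wrt_append)
    then have ys: "ys = pre @ zs" unfolding pre_def zs_def by (rule sorted_split[symmetric])
    have srt: "sorted_wrt (<) (pre @ zs @ p # us)" using less.prems(1) by (simp add: xs ys)
    have pre: "\<forall>x\<in>set pre. x < p - int e" by (simp add: pre_def)
    have zs_in: "\<forall>x\<in>set zs. p - int e < x \<and> x < p"
    proof
      fix x assume x: "x \<in> set zs"
      then have "x \<noteq> p - int e" using p(2) by (auto simp: J_def xs ys)
      then show "p - int e < x \<and> x < p" using x srt by (auto simp: zs_def sorted_wrt_append)
    qed
    define c0 where "c0 = {..<L} \<union> set pre"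
    have c0_sub: "c0 \<subseteq> {..<p - int e}" using pre pL by (auto simp: c0_def)
    have c0J: "x \<in> c0" if "x \<in> J" "x < p - int e" for x
    proof -
      have "\<forall>x\<in>set us. p < x" using srt by (simp add: sorted_wrt_append)
      then have "x \<notin> set us" "x \<notin> set zs" "x \<noteq> p" using that zs_in assms(1) by force+
      then show ?thesis using that(1) by (simp add: c0_def J_def xs ys)
    qed
    have Jc0: "c0 \<subseteq> J" by (auto simp: c0_def J_def xs ys)
    have v0: "attach_all e {..<L} pre = c0" unfolding c0_def
    proof (rule attach_all_flush[OF core_lessThan _ _ assms(1)])
      show "sorted_wrt (<) pre" using srt by (simp add: sorted_wrt_append)
      show "\<forall>x\<in>set pre. x - int e \<in> {..<L} \<union> set pre \<and> {..<L} \<subseteq> {..<x}"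
      proof
        fix x assume x: "x \<in> set pre"
        then have "x \<in> J" "x < p - int e" "L \<le> x" using pre less.prems(2) by (auto simp: J_def xs ys)
        then show "x - int e \<in> {..<L} \<union> set pre \<and> {..<L} \<subseteq> {..<x}"
          using c0J[of "x - int e"] flush[of x] assms(1) by (auto simp: c0_def)
      qed
    qed
    have core0: "core e c0" using attach_all_core[OF core_lessThan, of e L pre] v0 by simp
    have zflush: "x - int e \<in> c0" if "x \<in> set zs" for x
      using c0J[of "x - int e"] flush[of x] that zs_in by (auto simp: J_def xs ys)
    have v1: "attach_all e c0 zs = c0 \<union> set zs"
    proof (rule attach_all_flush[OF core0 _ _ assms(1)])
      show "sorted_wrt (<) zs" using srt by (simp add: sorted_wrt_append)
      show "\<forall>x\<in>set zs. x - int e \<in> c0 \<union> set zs \<and> c0 \<subseteq> {..<x}" using zflush zs_in c0_sub by force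
    qed
    obtain y where y: "y \<in> J" "p - int e \<le> y" "y < p"
      using less.prems(3) p(1) unfolding J_def gapless_def by blast
    have us_gt: "\<forall>x\<in>set us. p < x" using srt by (simp add: sorted_wrt_append)
    have mid: "x \<in> set zs \<or> x = p" if "x \<in> J" "p - int e \<le> x" "x \<le> p" for x
    proof -
      have "x \<in> set xs" using that pL by (auto simp: J_def)
      then have "x \<in> set ys \<or> x = p" using that us_gt by (auto simp: xs)
      then show ?thesis using that by (auto simp: zs_def)
    qed
    have "y \<in> set zs" using mid[of y] y by simp
    then obtain z zs' where zs: "zs = z # zs'" by (cases zs) auto
    define zz where "zz = zs @ [p]"
    have tlz: "tl zz = zs' @ [p]" by (simp add: zz_def zs)
    define d0 where "d0 = attach e (p - int e) c0"
    have d0_sub: "d0 \<subseteq> {..<p - int e + 1}" unfolding d0_def using c0_sub by (intro attach_subset) auto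
    have tl_d0: "\<forall>x\<in>set (tl zz). x - int e \<in> d0"
    proof
      fix x assume "x \<in> set (tl zz)"
      then consider "x = p" | "x \<in> set zs'" by (auto simp: tlz)
      then show "x - int e \<in> d0"
      proof cases
        case 1 then show ?thesis by (simp add: d0_def mem_attach_self)
      next
        case 2
        have xz: "z < x" "x < p" "p - int e < z" using 2 srt zs_in by (auto simp: zs sorted_wrt_append)
        have "x - int e \<in> attach e (p - int e) c0 \<longleftrightarrow>
            (x - int e = p - int e - int e \<and> p - int e - int e \<le> p - int e) \<or>
            (x - int e \<in> c0 \<and> (\<exists>y'\<in>c0. p - int e - int e \<le> y' \<and> y' < x - int e))"
          by (rule mem_attach) (use xz in auto)
        moreover have "\<exists>y'\<in>c0. p - int e - int e \<le> y' \<and> y' < x - int e"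
          using zflush[of z] xz by (intro bexI[of _ "z - int e"]) (auto simp: zs)
        ultimately show ?thesis using zflush[of x] 2 by (auto simp: zs d0_def)
      qed
    qed
    have core_d0: "core e d0" unfolding d0_def by (rule attach_core[OF core0])
    \<comment> \<open>Once \<open>p - e\<close> is attached, every bead of \<open>tl zz\<close>
      rests on another one and is merely inserted. By \<open>attach_clump\<close> the bead
      \<open>p\<close>, attached last, achieves the same.\<close>
    have vzz: "attach_all e d0 (tl zz) = attach e p (c0 \<union> set zs)"
    proof -
      have "attach_all e d0 (tl zz) = d0 \<union> set (tl zz)"
      proof (rule attach_all_flush[OF core_d0 _ _ assms(1)])
        show "sorted_wrt (<) (tl zz)" using srt by (auto simp: tlz zs sorted_wrt_append)
        have "x > p - int e" if "x \<in> set (tl zz)" for x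
          using that zs_in assms(1) by (auto simp: tlz zs)
        then show "\<forall>x\<in>set (tl zz). x - int e \<in> d0 \<union> set (tl zz) \<and> d0 \<subseteq> {..<x}"
          using tl_d0 d0_sub by force
      qed
      also have "\<dots> = attach e p (c0 \<union> set zs)"
        unfolding zs d0_def tlz
        by (subst attach_clump[OF c0_sub]) (use srt zs_in assms(1) in \<open>auto simp: zs sorted_wrt_append\<close>)
      finally show ?thesis .
    qed
    have "q \<in> set zz" using mid[of q] q qp by (auto simp: zz_def)
    then obtain b where b: "b < length zz" "zz ! b = q" by (auto simp: in_set_conv_nth)
    have srt': "sorted_wrt (<) (pre @ zz @ us)" using srt by (simp add: zz_def)
    then have sz: "sorted_wrt (<) zz" by (simp add: sorted_wrt_append)
    have zz_in: "\<forall>x\<in>set zz. p - int e < x \<and> x \<le> p" using zs_in assms(1) by (auto simp: zz_def)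
    \<comment> \<open>The beads supported by those before \<open>q\<close> are larger than
      \<open>p\<close>, hence attached after \<open>zz\<close>, as the swap chain requires.\<close>
    have up: "zz ! i + int e \<in> set us" if "i < b" for i
    proof -
      have i: "zz ! i < q" using sorted_wrt_nth_less[OF sz that] b by simp
      have m: "zz ! i \<in> set zz" using that b(1) by simp
      then have "zz ! i \<in> J" by (auto simp: J_def xs ys zz_def)
      then have "zz ! i + int e \<in> J" using blocked i m zz_in by blast
      moreover have "zz ! i + int e > p" using m zz_in by force
      moreover have "\<forall>x\<in>set pre. x < p" using srt by (simp add: sorted_wrt_append)
      ultimately show ?thesis using pL zs_in assms(1) by (force simp: J_def xs ys)
    qed
    define w where "w = pre @ (p - int e) # take b zz @ drop (Suc b) zz @ us"
    have zz_split: "zz = take b zz @ q # drop (Suc b) zz" using id_take_nth_drop[OF b(1)] b(2) by simp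
    have vw: "attach_all e {..<L} w = attach_all e {..<L} xs"
    proof -
      have "attach_all e {..<L} w = attach_all e d0 (take b zz @ drop (Suc b) zz @ us)" by (simp add: w_def v0 d0_def)
      also have "\<dots> = attach_all e d0 (tl zz @ us)"
      proof (rule attach_all_swap_chain[OF core_d0 _ _ _ tl_d0 b(1) _ assms(1)])
        show "sorted_wrt (<) (zz @ us)" using srt' by (simp add: sorted_wrt_append)
        show "\<forall>x\<in>set zz. d0 \<subseteq> {..<x}" using zz_in d0_sub by force
        show "\<forall>x\<in>set zz. \<forall>y\<in>set zz. y < x + int e"
        proof (intro ballI)
          fix x y assume "x \<in> set zz" "y \<in> set zz"
          then have "p - int e < x" "y \<le> p" using zz_in by auto
          then show "y < x + int e" by simp
        qed
        show "\<forall>i<b. zz ! i + int e \<in> set us" using up by blast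
      qed
      also have "\<dots> = attach_all e {..<L} xs" by (simp add: xs ys v0 v1 vzz)
      finally show ?thesis .
    qed
    have setJ: "J = {..<L} \<union> set pre \<union> (set (take b zz) \<union> {q} \<union> set (drop (Suc b) zz)) \<union> set us"
    proof -
      have "set zz = set (take b zz) \<union> {q} \<union> set (drop (Suc b) zz)" by (subst zz_split) auto
      moreover have "J = {..<L} \<union> set pre \<union> set zz \<union> set us" by (auto simp: J_def xs ys zz_def)
      ultimately show ?thesis by simp
    qed
    have srtq: "sorted_wrt (<) (pre @ (take b zz @ q # drop (Suc b) zz) @ us)"
      using srt' zz_split by simp
    have qn: "q \<notin> {..<L} \<union> set pre \<union> set (take b zz) \<union> set (drop (Suc b) zz) \<union> set us"
      using srtq q(2) pL by (auto simp: sorted_wrt_append)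
    have dJ: "down e J = {..<L} \<union> set w"
    proof -
      have "down e J = (J - {q}) \<union> {p - int e}" using False by (simp add: down_def p_def q_def)
      also have "\<dots> = {..<L} \<union> set w" unfolding setJ w_def using qn by auto
      finally show ?thesis .
    qed
    have dJ': "down e J = J - {q} \<union> {p - int e}" using False by (simp add: down_def p_def q_def)
    have "gapless e (down e J)" unfolding dJ'
      by (rule gapless_down[OF less.prems(3)[folded J_def] p(1,2) flush q(2) qp blocked])
    then have gw: "gapless e ({..<L} \<union> set w)" by (simp add: dJ)
    have sw: "sorted_wrt (<) w"
    proof -
      have "\<forall>x\<in>set (take b zz @ drop (Suc b) zz @ us). p - int e < x"
      proof -
        have "\<forall>x\<in>set us. p - int e < x" using srt assms(1) by (auto simp: sorted_wrt_append)
        then show ?thesis using zz_in by (auto dest: in_set_takeD in_set_dropD)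
      qed
      then show ?thesis using srtq pre unfolding w_def by (auto simp: sorted_wrt_append)
    qed
    have Lw: "\<forall>x\<in>set w. L \<le> x"
    proof -
      have "set w \<subseteq> insert (p - int e) (set xs)"
        unfolding w_def by (auto simp: xs ys zz_def dest!: in_set_takeD in_set_dropD)
      then show ?thesis using less.prems(2) pL by auto
    qed
    have "(\<Sum>x\<leftarrow>xs. x - L) = (\<Sum>x\<leftarrow>pre @ (take b zz @ q # drop (Suc b) zz) @ us. x - L)"
      by (subst zz_split[symmetric]) (simp add: xs ys zz_def)
    also have "\<dots> > (\<Sum>x\<leftarrow>w. x - L)" using q(2) by (simp add: w_def)
    finally have "(\<Sum>x\<leftarrow>w. x - L) < (\<Sum>x\<leftarrow>xs. x - L)" .
    moreover have "(\<Sum>x\<leftarrow>w. x - L) \<ge> 0" by (rule sum_list_nonneg) (use Lw in auto)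
    ultimately have "nat (\<Sum>x\<leftarrow>w. x - L) < nat (\<Sum>x\<leftarrow>xs. x - L)" by simp
    from less.hyps[OF this sw Lw gw] obtain n where
      n: "U_set e ((down e ^^ n) (down e J)) = {}" and base: "beta_base e (down e J) = attach_all e {..<L} w"
      by (auto simp: dJ)
    show ?thesis
      using beta_base_down[OF False n] base vw unfolding J_def by metis
  qed
qed

lemma beta_eq_beads:
  assumes "is_partition l"
  shows "beta m l = {..<m - int (rows l) + 1} \<union> set (map (\<lambda>k. int (l k) + m - int k) (rev [0..<rows l]))"
proof -
  have z: "l k = 0 \<longleftrightarrow> rows l \<le> k" for k using partition_eq_0_iff[OF assms] by blast
  have *: "x \<in> range (\<lambda>k. int (l k) + m - int k) \<longleftrightarrow> x < m - int (rows l) + 1 \<or>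
      (\<exists>k<rows l. x = int (l k) + m - int k)" for x
  proof
    assume "x \<in> range (\<lambda>k. int (l k) + m - int k)"
    then obtain k where k: "x = int (l k) + m - int k" by blast
    show "x < m - int (rows l) + 1 \<or> (\<exists>k<rows l. x = int (l k) + m - int k)"
      using k z[of k] by (cases "k < rows l") auto
  next
    assume "x < m - int (rows l) + 1 \<or> (\<exists>k<rows l. x = int (l k) + m - int k)"
    then show "x \<in> range (\<lambda>k. int (l k) + m - int k)"
    proof
      assume "x < m - int (rows l) + 1"
      then have "x = int (l (nat (m - x))) + m - int (nat (m - x))" using z[of "nat (m - x)"] by auto
      then show ?thesis by blast
    qed blast
  qed
  have "x \<in> set (map (\<lambda>k. int (l k) + m - int k) (rev [0..<rows l])) \<longleftrightarrow>
      (\<exists>k<rows l. x = int (l k) + m - int k)" for x by auto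
  then show ?thesis by (intro set_eqI) (simp only: * beta_def Un_iff lessThan_iff)
qed

lemma beta_base_partition:
  assumes "l \<in> restricted_partitions e" "e > 0"
  shows "beta_base e (beta m l) = attach_beads e m l"
proof -
  have lp: "is_partition l" by (rule restricted_is_partition[OF assms(1)])
  let ?L = "m - int (rows l) + 1" and ?xs = "map (\<lambda>k. int (l k) + m - int k) (rev [0..<rows l])"
  have "gapless e (beta m l)"
    unfolding gapless_def
  proof
    fix x assume "x \<in> beta m l"
    then obtain k where k: "x = int (l k) + m - int k" by (auto simp: beta_def)
    have "l k - l (Suc k) < e" "l (Suc k) \<le> l k"
      using assms(1) is_partition_Suc[OF lp] by (auto simp: restricted_partitions_def)
    then show "\<exists>y\<in>beta m l. x - int e \<le> y \<and> y < x"
      unfolding k by (intro bexI[of _ "int (l (Suc k)) + m - int (Suc k)"])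
        (simp, unfold beta_def, rule rangeI)
  qed
  moreover have "sorted_wrt (<) ?xs"
  proof -
    have "sorted_wrt (\<lambda>i j. int (l j) + m - int j < int (l i) + m - int i) [0..<rows l]"
    proof (rule sorted_wrt_mono_rel[OF _ sorted_wrt_upt])
      fix i j assume "i \<in> set [0..<rows l]" "j \<in> set [0..<rows l]" "i < j"
      then show "int (l j) + m - int j < int (l i) + m - int i" using is_partitionD[OF lp, of i j] by simp
    qed
    then show ?thesis by (simp add: sorted_wrt_map sorted_wrt_rev)
  qed
  moreover have "\<forall>x\<in>set ?xs. ?L \<le> x" using partition_eq_0_iff[OF lp] by auto
  ultimately show ?thesis
    using beta_base_attach_all[OF assms(2), of ?xs ?L] beta_eq_beads[OF lp, of m]
    by (simp only: attach_beads_def)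
qed

section \<open>The stable form\<close>

lemma is_core_iff: "is_core e m l \<longleftrightarrow> is_partition l \<and> core e (beta m l)"
  by (auto simp: is_core_def core_def U_set_def)

lemma addable_bead:
  assumes "is_partition l"
  shows "addable e m i l a \<longleftrightarrow> int (l a) + m - int a + 1 \<notin> beta m l \<and> int e dvd int (l a) + m - int a - i"
proof -
  have "(a = 0 \<or> l a < l (a - 1)) \<longleftrightarrow> int (l a) + m - int a + 1 \<notin> beta m l"
  proof
    assume *: "a = 0 \<or> l a < l (a - 1)"
    show "int (l a) + m - int a + 1 \<notin> beta m l"
    proof
      assume "int (l a) + m - int a + 1 \<in> beta m l"
      then obtain b where b: "int (l a) + m - int a + 1 = int (l b) + m - int b" by (auto simp: beta_def)
      have "b < a"
      proof (rule ccontr)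
        assume "\<not> b < a"
        then have "a = b \<or> a < b" by auto
        then show False using b beta_strict[OF assms, of a b m] by auto
      qed
      moreover have "l (a - 1) \<le> l b" using \<open>b < a\<close> by (intro is_partitionD[OF assms]) simp
      ultimately show False using * b by linarith
    qed
  next
    assume *: "int (l a) + m - int a + 1 \<notin> beta m l"
    show "a = 0 \<or> l a < l (a - 1)"
    proof (rule ccontr)
      assume "\<not> (a = 0 \<or> l a < l (a - 1))"
      then have "a > 0" "l (a - 1) = l a" using is_partitionD[OF assms, of "a - 1" a] by auto
      then have "int (l a) + m - int a + 1 = int (l (a - 1)) + m - int (a - 1)" by simp
      then show False using * unfolding beta_def by blast
    qed
  qed
  moreover have "(m - int a + int (l a)) mod int e = i mod int e \<longleftrightarrow> int e dvd int (l a) + m - int a - i"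
    by (simp add: mod_eq_dvd_iff algebra_simps)
  ultimately show ?thesis unfolding addable_res by blast
qed

lemma removable_bead:
  assumes "is_partition l"
  shows "removable e m i l a \<Longrightarrow> int (l a) + m - int a - 1 \<notin> beta m l \<and>
    int e dvd int (l a) + m - int a - 1 - i"
proof -
  assume r: "removable e m i l a"
  then have la: "l (Suc a) < l a" by (simp add: removable_def)
  have "int (l a) + m - int a - 1 \<noteq> int (l b) + m - int b" for b
  proof (cases "b \<le> a")
    case True
    then have "b = a \<or> b < a" by auto
    then show ?thesis using beta_strict[OF assms, of b a m] by auto
  next
    case False
    then have "l b \<le> l (Suc a)" by (intro is_partitionD[OF assms]) simp
    then show ?thesis using False la by simp
  qed
  then have "int (l a) + m - int a - 1 \<notin> beta m l" by (auto simp: beta_def)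
  moreover have s: "int (l a - 1) = int (l a) - 1" using la by simp
  have "int e dvd int (l a) + m - int a - 1 - i"
    using r unfolding removable_def res_def mod_eq_dvd_iff s by (simp add: algebra_simps)
  ultimately show ?thesis by blast
qed

section \<open>Adding all addable nodes to a core\<close>

lemma add_all_move:
  assumes "e \<ge> 2" "x \<in> c" "x + 1 \<notin> c" "int e dvd x - i"
  shows "add_all e i (move x c) = add_all e i c"
proof -
  have "y \<in> add_all e i (move x c) \<longleftrightarrow> y \<in> add_all e i c" for y
  proof -
    consider (l) "int e dvd y - i" | (r) "int e dvd y - 1 - i"
      | (n) "\<not> int e dvd y - i" "\<not> int e dvd y - 1 - i" by blast
    then show ?thesis
    proof cases
      case l
      have "y \<noteq> x + 1" using dvd_neighbours(2)[OF assms(1,4)] l by auto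
      moreover have "y + 1 \<noteq> x" using dvd_neighbours(2)[OF assms(1) l] assms(4) by auto
      ultimately show ?thesis using assms(2,3) unfolding mem_add_all(1)[OF assms(1) l] by (auto simp: move_def)
    next
      case r
      have "y \<noteq> x" using dvd_neighbours(1)[OF assms(1,4)] r by auto
      moreover have "y - 1 \<noteq> x + 1"
      proof
        assume "y - 1 = x + 1"
        then show False using dvd_neighbours(2)[OF assms(1,4)] r by (simp only:)
      qed
      ultimately show ?thesis using assms(2,3) unfolding mem_add_all(2)[OF assms(1) r] by (auto simp: move_def)
    next
      case n
      then have "y \<noteq> x" "y \<noteq> x + 1" using assms(4) by auto
      then show ?thesis unfolding mem_add_all(3)[OF assms(1) n] by (auto simp: move_def)
    qed
  qed
  then show ?thesis by blast
qed

lemma add_all_core: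
  assumes "core e c" shows "core e (add_all e i c)"
  unfolding core_def
proof
  fix y assume y: "y \<in> add_all e i c"
  have d: "int e dvd y - int e - i \<longleftrightarrow> int e dvd y - i" "int e dvd y - int e - 1 - i \<longleftrightarrow> int e dvd y - 1 - i"
    using dvd_diff_right_iff[of "int e" "int e" "y - i"] dvd_diff_right_iff[of "int e" "int e" "y - 1 - i"]
      dvd_add_triv_right_iff[of "int e" "y - int e - i"] dvd_add_triv_right_iff[of "int e" "y - int e - 1 - i"]
    by (simp_all add: algebra_simps)
  have c: "z - int e \<in> c" if "z \<in> c" for z using assms that by (simp add: core_def)
  have "y - int e + 1 = y + 1 - int e" "y - int e - 1 = y - 1 - int e" by simp_all
  then show "y - int e \<in> add_all e i c"
    using y c[of y] c[of "y + 1"] c[of "y - 1"] unfolding add_all_def mem_Collect_eq d by metis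
qed

text \<open>The counterpart of \<open>add_all\<close> for partitions, see \<open>beta_bump\<close>;
  on a core it is the end of the \<open>i\<close>-string, see \<open>iter_f_op_core\<close>.\<close>

definition bump :: "nat \<Rightarrow> int \<Rightarrow> int \<Rightarrow> (nat \<Rightarrow> nat) \<Rightarrow> (nat \<Rightarrow> nat)" where
  "bump e m i l = (\<lambda>a. l a + of_bool (addable e m i l a))"

lemma bump_partition:
  assumes "is_partition l" shows "is_partition (bump e m i l)"
  unfolding is_partition_iff
proof
  show "antimono (bump e m i l)"
  proof (rule decseq_SucI)
    fix n show "bump e m i l (Suc n) \<le> bump e m i l n"
      using is_partition_Suc[OF assms, of n] by (auto simp: bump_def addable_def)
  qed
  have "l (rows l) = 0" "l (Suc (rows l)) = 0" using partition_eq_0_iff[OF assms] by auto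
  then show "\<exists>k. bump e m i l k = 0"
    by (intro exI[of _ "Suc (rows l)"]) (simp add: bump_def addable_def)
qed

lemma beta_bump:
  assumes "is_partition l" "e \<ge> 2"
  shows "beta m (bump e m i l) = add_all e i (beta m l)"
proof -
  have bead: "int (l a) + m - int a \<in> beta m l" for a by (auto simp: beta_def)
  have "y \<in> beta m (bump e m i l) \<longleftrightarrow> y \<in> add_all e i (beta m l)" for y
  proof
    assume "y \<in> beta m (bump e m i l)"
    then obtain a where y: "y = int (bump e m i l a) + m - int a" by (auto simp: beta_def)
    show "y \<in> add_all e i (beta m l)"
    proof (cases "addable e m i l a")
      case True
      then have "y - 1 = int (l a) + m - int a" by (simp add: y bump_def)
      then show ?thesis using bead[of a] True addable_bead[OF assms(1), of e m i a] by (simp add: add_all_def)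
    next
      case False
      then have "y = int (l a) + m - int a" by (simp add: y bump_def)
      then show ?thesis using bead[of a] False addable_bead[OF assms(1), of e m i a] by (auto simp: add_all_def)
    qed
  next
    assume y: "y \<in> add_all e i (beta m l)"
    have stay: "y \<in> beta m (bump e m i l)" if s: "y \<in> beta m l" "int e dvd y - i \<longrightarrow> y + 1 \<in> beta m l"
    proof -
      obtain a where a: "y = int (l a) + m - int a" using s(1) by (auto simp: beta_def)
      then have "\<not> addable e m i l a" using s(2) addable_bead[OF assms(1), of e m i a] by auto
      then have "y = int (bump e m i l a) + m - int a" using a by (simp add: bump_def)
      then show ?thesis unfolding beta_def by blast
    qed
    show "y \<in> beta m (bump e m i l)"
    proof (cases "y \<in> beta m l \<and> (int e dvd y - i \<longrightarrow> y + 1 \<in> beta m l)")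
      case False
      then have r: "int e dvd y - 1 - i" "y - 1 \<in> beta m l" using y by (auto simp: add_all_def)
      then have "y \<notin> beta m l" using False dvd_neighbours(1)[OF assms(2), of y i] by auto
      moreover obtain a where a: "y - 1 = int (l a) + m - int a" using r(2) by (auto simp: beta_def)
      moreover have "int (l a) + m - int a + 1 = y" using a by simp
      moreover have "int e dvd int (l a) + m - int a - i" using r(1) unfolding a .
      ultimately have "addable e m i l a" using addable_bead[OF assms(1), of e m i a] by simp
      then have "y = int (bump e m i l a) + m - int a" using a by (simp add: bump_def)
      then show ?thesis unfolding beta_def by blast
    qed (use stay in blast)
  qed
  then show ?thesis by blast
qed

lemma bump_core: "is_core e m l \<Longrightarrow> e \<ge> 2 \<Longrightarrow> is_core e m (bump e m i l)"
  by (simp add: is_core_iff bump_partition beta_bump add_all_core)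

lemma bump_increasing: "l \<le> bump e m i l"
  by (simp add: le_fun_def bump_def)

lemma bump_mono:
  assumes "l \<le> l'" shows "bump e m i l \<le> bump e m i l'"
proof (rule le_funI)
  fix a
  have le: "l b \<le> l' b" for b using assms by (simp add: le_fun_def)
  have "addable e m i l' a" if "addable e m i l a" "l a = l' a"
    using that le[of "a - 1"] by (auto simp: addable_def)
  then show "bump e m i l a \<le> bump e m i l' a"
    using le[of a] by (cases "l a = l' a") (auto simp: bump_def of_bool_def)
qed

text \<open>The two beads lie on neighbouring runners. If the bead of the addable node is high
  enough, it forces the free place under the removable node to be occupied; otherwise the other bead
  forces the free place of the addable node to be occupied.\<close>

lemma core_letters:
  assumes "is_core e m l" "e \<ge> 2" "addable e m i l a" shows "\<not> removable e m i l b"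
proof
  assume r: "removable e m i l b"
  have l: "is_partition l" "core e (beta m l)" using assms(1) by (simp_all add: is_core_iff)
  let ?x = "int (l a) + m - int a" and ?y = "int (l b) + m - int b"
  have x: "?x \<in> beta m l" "?x + 1 \<notin> beta m l" "int e dvd ?x - i"
    using addable_bead[OF l(1), of e m i a] assms(3) by (auto simp: beta_def)
  have y: "?y \<in> beta m l" "?y - 1 \<notin> beta m l" "int e dvd ?y - 1 - i"
    using removable_bead[OF l(1) r] by (auto simp: beta_def)
  have e0: "e > 0" using assms(2) by simp
  have d: "int e dvd ?x - (?y - 1)" "int e dvd ?y - (?x + 1)"
    using dvd_diff[OF x(3) y(3)] dvd_diff[OF y(3) x(3)] by (simp_all add: algebra_simps)
  show False
  proof (cases "?y - 1 \<le> ?x")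
    case True
    then show False using core_down[OF l(2) x(1) d(1) _ e0] y(2) by blast
  next
    case False
    then show False using core_down[OF l(2) y(1) d(2) _ e0] x(2) by force
  qed
qed

lemma filter_flip_at:
  assumes "(Addable, a) \<in> set w" "distinct (map snd w)"
  shows "length (filter (\<lambda>x. fst x = Addable) w) = Suc (length (filter (\<lambda>x. fst x = Addable) (flip_at a w)))"
  using assms
proof (induction w)
  case (Cons x w)
  have id: "flip_at a w = w" if "a \<notin> snd ` set w"
    using that by (induction w) (auto simp: flip_at_def)
  show ?case
  proof (cases "snd x = a")
    case True
    then have "x = (Addable, a)" using Cons.prems by (cases x) (auto simp: image_iff)
    moreover have "a \<notin> snd ` set w" using Cons.prems True by auto
    ultimately show ?thesis using id by (simp add: flip_at_def)
  next
    case False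
    then show ?thesis using Cons by (cases x) (auto simp: flip_at_def)
  qed
qed simp

text \<open>Two quantities are followed along the string: the set obtained by adding all addable
  nodes is constant, and the number of all addable nodes, cancelled or not, falls together with
  \<open>phi\<close>.\<close>

lemma iter_f_op_letters:
  assumes "is_partition l" "e \<ge> 2" "iter (f_op e m i) n l = Some l'"
  shows "is_partition l' \<and> add_all e i (beta m l') = add_all e i (beta m l) \<and>
    length (filter (\<lambda>x. fst x = Addable) (signature e m i l)) =
      length (filter (\<lambda>x. fst x = Addable) (signature e m i l')) + n \<and> phi e m i l = phi e m i l' + n"
  using assms(3)
proof (induction n arbitrary: l')
  case (Suc n)
  then obtain k where k: "iter (f_op e m i) n l = Some k" "f_op e m i k = Some l'"
    by (cases "iter (f_op e m i) n l") (auto simp: iter_Suc)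
  note IH = Suc.IH[OF k(1)]
  then have kp: "is_partition k" by blast
  from f_opE[OF kp assms(2) k(2)] obtain a where a: "rightmost_addable (signature e m i k) = Some a"
    "addable e m i k a" "l' = add_node a k" "is_partition l'" "signature e m i l' = flip_at a (signature e m i k)"
    by metis
  let ?x = "int (k a) + m - int a"
  have "add_all e i (beta m l') = add_all e i (beta m k)"
    unfolding a(3) beta_add_node[OF kp a(2)]
    by (rule add_all_move[OF assms(2)]) (use a(2) addable_bead[OF kp, of e m i a] in \<open>auto simp: beta_def\<close>)
  moreover have "(Addable, a) \<in> set (signature e m i k)" using a(2) set_signature[OF kp] by blast
  then have "length (filter (\<lambda>x. fst x = Addable) (signature e m i k)) =
      Suc (length (filter (\<lambda>x. fst x = Addable) (signature e m i l')))"
    unfolding a(5) by (rule filter_flip_at[OF _ distinct_signature[OF kp assms(2)]])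
  moreover have "Suc (phi e m i l') = phi e m i k" using f_op_count[OF kp assms(2) k(2)] by simp
  ultimately show ?case using IH a(4) by simp
qed (use assms(1) in simp)

lemma iter_f_op_exists:
  assumes "is_partition l" "e \<ge> 2" "n \<le> phi e m i l"
  shows "\<exists>l'. iter (f_op e m i) n l = Some l'"
  using assms(3)
proof (induction n)
  case (Suc n)
  then obtain k where k: "iter (f_op e m i) n l = Some k" by auto
  have "phi e m i k \<noteq> 0" using iter_f_op_letters[OF assms(1,2) k] Suc.prems by simp
  then show ?case using k f_op_eq_None[of e m i k] by (cases "f_op e m i k") (auto simp: iter_Suc)
qed simp

lemma core_phi_eps:
  assumes "is_core e m l" "e \<ge> 2"
  shows "phi e m i l = length (filter (\<lambda>x. fst x = Addable) (signature e m i l))"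
    "phi e m i l = 0 \<or> eps e m i l = 0"
proof -
  have l: "is_partition l" using assms(1) by (simp add: is_core_iff)
  have "(\<forall>x\<in>set (signature e m i l). fst x = Addable) \<or> (\<forall>x\<in>set (signature e m i l). fst x = Removable)"
  proof (rule ccontr)
    assume "\<not> ?thesis"
    then obtain a b where "(Removable, a) \<in> set (signature e m i l)" "(Addable, b) \<in> set (signature e m i l)" by force
    then show False using set_signature[OF l] core_letters[OF assms] by blast
  qed
  then show "phi e m i l = length (filter (\<lambda>x. fst x = Addable) (signature e m i l))"
    "phi e m i l = 0 \<or> eps e m i l = 0"
    using all_Addable[of "signature e m i l"] all_Removable[of "signature e m i l"]
    by (auto simp: filter_id_conv[THEN iffD2] filter_empty_conv[THEN iffD2])
qed

text \<open>On a core no letter cancels, so no addable \<open>i\<close>-node is left at the end of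
  the string. The invariant \<open>add_all\<close> then identifies the final partition.\<close>

lemma iter_f_op_core:
  assumes "is_core e m l" "e \<ge> 2"
  shows "iter (f_op e m i) (phi e m i l) l = Some (bump e m i l)"
proof -
  have l: "is_partition l" using assms(1) by (simp add: is_core_iff)
  obtain l' where l': "iter (f_op e m i) (phi e m i l) l = Some l'"
    using iter_f_op_exists[OF l assms(2)] by blast
  note * = iter_f_op_letters[OF l assms(2) l']
  then have p: "is_partition l'" by blast
  have "filter (\<lambda>x. fst x = Addable) (signature e m i l') = []" using * core_phi_eps(1)[OF assms, of i] by simp
  then have na: "\<not> addable e m i l' a" for a
    using set_signature[OF p, of Addable a e m i] by (auto simp: filter_empty_conv)
  have "add_all e i (beta m l') = beta m l'"
    unfolding add_all_id_iff[OF assms(2)]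
  proof (intro ballI impI)
    fix x assume x: "x \<in> beta m l'" "int e dvd x - i"
    then obtain a where "x = int (l' a) + m - int a" by (auto simp: beta_def)
    then show "x + 1 \<in> beta m l'" using na[of a] x(2) addable_bead[OF p, of e m i a] by auto
  qed
  then have "beta m l' = beta m (bump e m i l)" using * beta_bump[OF l assms(2)] by simp
  then show ?thesis using beta_inj[OF p bump_partition[OF l]] l' by simp
qed

lemma bump_trivial:
  assumes "is_core e m l" "e \<ge> 2" "phi e m i l = 0" shows "bump e m i l = l"
  using iter_f_op_core[OF assms(1,2), of i] assms(3) by simp

section \<open>Blocks of equal cores\<close>

lemma stretch_simps [simp]:
  "stretch h [] = []" "stretch h (x # xs) = replicate h x @ stretch h xs"
  "stretch h (xs @ ys) = stretch h xs @ stretch h ys" "stretch h (replicate k x) = replicate (h * k) x"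
  "length (stretch h xs) = h * length xs"
proof -
  show "stretch h (replicate k x) = replicate (h * k) x"
    by (induction k) (simp_all add: stretch_def replicate_add)
  show "length (stretch h xs) = h * length xs" by (induction xs) (simp_all add: stretch_def)
qed (simp_all add: stretch_def)

lemma stretch_1: "stretch 1 xs = xs"
  by (induction xs) simp_all

lemma iter_singleton: "iter (f_tensor e m i) n [b] = map_option (\<lambda>b'. [b']) (iter (f_op e m i) n b)"
proof (induction n)
  case (Suc n)
  then show ?case by (cases "iter (f_op e m i) n b") (simp_all add: iter_Suc f_tensor_singleton)
qed simp

text \<open>One of the two kinds of surviving letters is absent, so copies of \<open>b\<close> do
  not cancel each other.\<close>

lemma replicate_tensor:
  assumes "phi e m i b = 0 \<or> eps e m i b = 0"
  shows "phi_tensor e m i (replicate M b) = M * phi e m i b" "eps_tensor e m i (replicate M b) = M * eps e m i b"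
proof -
  have "phi_tensor e m i (replicate M b) = M * phi e m i b \<and> eps_tensor e m i (replicate M b) = M * eps e m i b"
  proof (induction M)
    case (Suc M)
    then show ?case
      using assms tensor_append[of e m i "[b]" "replicate M b"] by auto
  qed simp
  then show "phi_tensor e m i (replicate M b) = M * phi e m i b"
    "eps_tensor e m i (replicate M b) = M * eps e m i b" by auto
qed

lemma stretch_tensor:
  assumes "\<forall>b\<in>set bs. phi e m i b = 0 \<or> eps e m i b = 0"
  shows "phi_tensor e m i (stretch M bs) = M * phi_tensor e m i bs \<and>
    eps_tensor e m i (stretch M bs) = M * eps_tensor e m i bs"
  using assms
proof (induction bs)
  case (Cons b bs)
  then show ?case
    using tensor_append[of e m i "[b]" bs] tensor_append[of e m i "replicate M b" "stretch M bs"]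
      replicate_tensor[of e m i b M] by (simp add: algebra_simps diff_mult_distrib2)
qed simp

text \<open>The result of \<open>M * d\<close> steps on \<open>M\<close> copies of a core
  \<open>b\<close>: they advance one copy after the other to the end of its string. For
  \<open>phi = 0\<close> the quotient is 0 by convention and nothing changes.\<close>

definition part :: "nat \<Rightarrow> int \<Rightarrow> int \<Rightarrow> nat \<Rightarrow> nat \<Rightarrow> (nat \<Rightarrow> nat) \<Rightarrow> (nat \<Rightarrow> nat) list" where
  "part e m i M d b = (let k = M * d div phi e m i b in replicate k (bump e m i b) @ replicate (M - k) b)"

lemma iter_replicate:
  assumes "is_core e m b" "e \<ge> 2" "phi e m i b > 0" "k \<le> M"
  shows "iter (f_tensor e m i) (k * phi e m i b) (replicate M b) =
    Some (replicate k (bump e m i b) @ replicate (M - k) b)"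
  using assms(4)
proof (induction M arbitrary: k)
  case (Suc M)
  let ?n = "phi e m i b"
  have b: "is_partition b" using assms(1) by (simp add: is_core_iff)
  show ?case
  proof (cases k)
    case (Suc k')
    have e0: "phi e m i b = 0 \<or> eps e m i b = 0" by (rule core_phi_eps(2)[OF assms(1,2)])
    have le: "k * ?n \<le> phi_tensor e m i ([b] @ replicate M b)"
      using replicate_tensor(1)[OF e0, of "Suc M"] mult_le_mono1[OF Suc.prems, of ?n] by simp
    have "eps_tensor e m i (replicate M b) = 0" using replicate_tensor(2)[OF e0] e0 assms(3) by auto
    then have kk: "min (k * ?n) (phi_tensor e m i [b] - eps_tensor e m i (replicate M b)) = ?n"
      "k * ?n - ?n = k' * ?n" by (simp_all add: Suc)
    obtain xs' ys' where *: "iter (f_tensor e m i) (k * ?n) ([b] @ replicate M b) = Some (xs' @ ys')"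
      "iter (f_tensor e m i) ?n [b] = Some xs'" "iter (f_tensor e m i) (k' * ?n) (replicate M b) = Some ys'"
      using iter_f_tensor_append[OF _ _ assms(2) le] b unfolding kk by (auto simp: partitions_def)
    have "xs' = [bump e m i b]" using *(2) iter_f_op_core[OF assms(1,2), of i] by (simp add: iter_singleton)
    moreover have "ys' = replicate k' (bump e m i b) @ replicate (M - k') b"
      using *(3) Suc.IH[of k'] Suc.prems Suc by simp
    ultimately show ?thesis using *(1) by (simp add: Suc)
  qed simp
qed simp

text \<open>The divisibility makes the \<open>M * d\<close> steps fill a whole number of copies; the
  maximum with 1 takes care of cores with \<open>phi = 0\<close>.\<close>

lemma iter_part:
  assumes "is_core e m b" "e \<ge> 2" "d \<le> phi e m i b" "max 1 (phi e m i b) dvd M"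
  shows "iter (f_tensor e m i) (M * d) (replicate M b) = Some (part e m i M d b)"
proof (cases "phi e m i b = 0")
  case True
  then show ?thesis using assms(3) by (simp add: part_def)
next
  case False
  then have dv: "phi e m i b dvd M" using assms(4) by (simp add: max_def split: if_splits)
  have "M * d div phi e m i b \<le> M"
    using div_le_mono[of "M * d" "M * phi e m i b" "phi e m i b"] assms(3) False by simp
  moreover have "M * d div phi e m i b * phi e m i b = M * d" using dv by simp
  ultimately show ?thesis using iter_replicate[OF assms(1,2), of i "M * d div phi e m i b" M] False
    by (simp add: part_def Let_def)
qed

text \<open>The list \<open>r\<close> is in reading order, that is, the last tensor factor comes first.\<close>

fun blocks :: "nat \<Rightarrow> int \<Rightarrow> int \<Rightarrow> nat \<Rightarrow> nat \<Rightarrow> (nat \<Rightarrow> nat) list \<Rightarrow> (nat \<Rightarrow> nat) list" where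
  "blocks e m i M c [] = []"
| "blocks e m i M c (b # r) =
     (let c' = min c (phi_tensor e m i (rev r) - eps e m i b)
      in blocks e m i M c' r @ part e m i M (c - c') b)"

lemma set_part: "x \<in> set (part e m i M d b) \<Longrightarrow> x = b \<or> x = bump e m i b"
  by (auto simp: part_def Let_def)

lemma set_blocks: "x \<in> set (blocks e m i M c r) \<Longrightarrow> \<exists>b\<in>set r. x = b \<or> x = bump e m i b"
  by (induction r arbitrary: c) (auto simp: Let_def dest: set_part)

text \<open>The number \<open>c\<close> counts in units of \<open>M\<close>. The share
  \<open>c'\<close> of the other factors is the tensor product rule for one copy of each core; by
  \<open>stretch_tensor\<close> all counts scale with \<open>M\<close>, and so does this
  share.\<close>

lemma iter_blocks:
  assumes "\<forall>b\<in>set r. is_core e m b \<and> max 1 (phi e m i b) dvd M" "e \<ge> 2" "c \<le> phi_tensor e m i (rev r)"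
  shows "iter (f_tensor e m i) (M * c) (stretch M (rev r)) = Some (blocks e m i M c r)"
  using assms(1,3)
proof (induction r arbitrary: c)
  case (Cons b r)
  let ?p = "phi_tensor e m i" let ?c = "min c (?p (rev r) - eps e m i b)"
  have b: "is_core e m b" "max 1 (phi e m i b) dvd M" using Cons.prems by auto
  have cores: "\<forall>b\<in>set (rev r). phi e m i b = 0 \<or> eps e m i b = 0"
    using Cons.prems(1) core_phi_eps(2)[OF _ assms(2)] by auto
  have parts: "partitions (stretch M (rev r))" "partitions (replicate M b)"
    using Cons.prems(1) by (auto simp: partitions_def stretch_def is_core_def)
  note e0 = core_phi_eps(2)[OF b(1) assms(2), of i]
  note st = stretch_tensor[OF cores, of M]
  have total: "?p (rev (b # r)) = phi e m i b + (?p (rev r) - eps e m i b)"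
    using tensor_append(1)[of e m i "rev r" "[b]"] by simp
  have le: "M * c \<le> ?p (stretch M (rev r) @ replicate M b)"
  proof -
    have "?p (stretch M (rev r) @ replicate M b) = M * ?p (rev (b # r))"
      unfolding total using tensor_append(1)[of e m i "stretch M (rev r)" "replicate M b"] st
        replicate_tensor[OF e0, of M] by (simp add: algebra_simps diff_mult_distrib2)
    then show ?thesis using Cons.prems(2) by simp
  qed
  have share: "min (M * c) (?p (stretch M (rev r)) - eps_tensor e m i (replicate M b)) = M * ?c"
    using st replicate_tensor(2)[OF e0, of M] by (simp add: diff_mult_distrib2 nat_mult_min_right)
  obtain xs' ys' where *: "iter (f_tensor e m i) (M * c) (stretch M (rev r) @ replicate M b) = Some (xs' @ ys')"
    "iter (f_tensor e m i) (M * ?c) (stretch M (rev r)) = Some xs'"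
    "iter (f_tensor e m i) (M * c - M * ?c) (replicate M b) = Some ys'"
    using iter_f_tensor_append[OF parts assms(2) le] unfolding share by blast
  have "iter (f_tensor e m i) (M * ?c) (stretch M (rev r)) = Some (blocks e m i M ?c r)"
    using Cons.prems by (intro Cons.IH) auto
  then have xs': "xs' = blocks e m i M ?c r" using *(2) by simp
  have "c - ?c \<le> phi e m i b" using Cons.prems(2) total by auto
  then have "ys' = part e m i M (c - ?c) b"
    using iter_part[OF b(1) assms(2) _ b(2)] *(3) by (simp add: diff_mult_distrib2[symmetric])
  then show ?case using *(1) xs' by (simp add: Let_def)
qed simp

lemma stretch_part:
  assumes "max 1 (phi e m i b) dvd M"
  shows "stretch t (part e m i M d b) = part e m i (t * M) d b"
proof (cases "phi e m i b = 0")
  case True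
  then show ?thesis by (simp add: part_def)
next
  case False
  then obtain q where "M = phi e m i b * q" using assms by (auto simp: max_def split: if_splits)
  then have "t * M * d div phi e m i b = t * (M * d div phi e m i b)"
    using False by (simp add: mult.assoc mult.left_commute[of t])
  then show ?thesis by (simp add: part_def Let_def diff_mult_distrib2)
qed

text \<open>\<open>M\<close> enters only as a scale, so the shape of the result is the same for all
  multiples.\<close>

lemma stretch_blocks:
  "\<forall>b\<in>set r. max 1 (phi e m i b) dvd M \<Longrightarrow> stretch t (blocks e m i M c r) = blocks e m i (t * M) c r"
  by (induction r arbitrary: c) (simp_all add: Let_def stretch_part)

lemma part_full:
  assumes "is_core e m b" "e \<ge> 2" "M > 0"
  shows "set (part e m i M (phi e m i b) b) \<subseteq> {bump e m i b}"
  using bump_trivial[OF assms(1,2)] by (cases "phi e m i b = 0") (auto simp: part_def)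

text \<open>When all letters are used up, a core with \<open>phi > 0\<close> advances completely. A
  core with \<open>phi = 0\<close> may have cancelled letters of the others, but it equals its own
  \<open>bump\<close>, and the remaining factors lie above it.\<close>

lemma blocks_full_ge:
  assumes "\<forall>b\<in>set r. is_core e m b \<and> b0 \<le> b" "e \<ge> 2" "M > 0" "sorted_wrt (\<le>) r"
    "x \<in> set (blocks e m i M (phi_tensor e m i (rev r)) r)"
  shows "bump e m i b0 \<le> x"
  using assms(1,4,5)
proof (induction r)
  case (Cons b r)
  let ?p = "phi_tensor e m i (rev r)"
  have b: "is_core e m b" "b0 \<le> b" using Cons.prems(1) by auto
  have total: "phi_tensor e m i (rev (b # r)) = phi e m i b + (?p - eps e m i b)"
    using tensor_append(1)[of e m i "rev r" "[b]"] by simp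
  have mb: "bump e m i b0 \<le> bump e m i b" by (rule bump_mono[OF b(2)])
  consider "x \<in> set (part e m i M (phi e m i b) b)" | "x \<in> set (blocks e m i M (?p - eps e m i b) r)"
    using Cons.prems(3) unfolding blocks.simps total by (auto simp: Let_def)
  then show ?case
  proof cases
    case 1
    then show ?thesis using part_full[OF b(1) assms(2,3), of i] mb by auto
  next
    case 2
    show ?thesis
    proof (cases "phi e m i b = 0")
      case True
      obtain b' where b': "b' \<in> set r" "x = b' \<or> x = bump e m i b'" using set_blocks[OF 2] by blast
      then have "b \<le> b'" using Cons.prems(2) by simp
      then have "b \<le> x" using b'(2) bump_increasing[of b' e m i] by auto
      then show ?thesis using mb bump_trivial[OF b(1) assms(2) True] by auto
    next
      case False
      then have "eps e m i b = 0" using core_phi_eps(2)[OF b(1) assms(2), of i] by simp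
      then show ?thesis using 2 Cons.IH Cons.prems(1,2) by simp
    qed
  qed
qed simp

text \<open>The critical case is an advanced copy of \<open>b\<close> next to factors coming from
  \<open>r\<close>. The operator reaches \<open>b\<close> only when the letters of \<open>r\<close>
  not cancelled by \<open>b\<close> are spent; as an advancing core has \<open>eps = 0\<close>,
  these are all letters of \<open>r\<close>, and \<open>blocks_full_ge\<close> bounds those factors
  from below.\<close>

lemma sorted_blocks:
  assumes "\<forall>b\<in>set r. is_core e m b" "e \<ge> 2" "M > 0" "sorted_wrt (\<le>) r"
  shows "sorted_wrt (\<ge>) (blocks e m i M c r)"
  using assms(1,4)
proof (induction r arbitrary: c)
  case (Cons b r)
  let ?p = "phi_tensor e m i (rev r)" let ?c = "min c (?p - eps e m i b)"
  have b: "is_core e m b" using Cons.prems(1) by auto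
  have "sorted_wrt (\<ge>) (blocks e m i M ?c r)" using Cons by auto
  moreover have "sorted_wrt (\<ge>) (part e m i M (c - ?c) b)"
  proof -
    have "sorted_wrt (\<ge>) (replicate k x)" for k and x :: "nat \<Rightarrow> nat" by (induction k) auto
    then show ?thesis using bump_increasing[of b e m i] by (simp add: part_def Let_def sorted_wrt_append)
  qed
  moreover have "y \<le> x" if x: "x \<in> set (blocks e m i M ?c r)" and y: "y \<in> set (part e m i M (c - ?c) b)" for x y
  proof -
    obtain b' where b': "b' \<in> set r" "x = b' \<or> x = bump e m i b'" using set_blocks[OF x] by blast
    then have "b \<le> b'" using Cons.prems(2) by simp
    then have bx: "b \<le> x" using b'(2) bump_increasing[of b' e m i] by auto
    show ?thesis
    proof (cases "y = b")
      case False
      then have "y = bump e m i b" using set_part[OF y] by blast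
      \<comment> \<open>An advanced copy different from \<open>b\<close> shows that the quotient is
        not the default value 0 of a division by 0, so \<open>phi\<close> and the share of
        \<open>b\<close> are both positive.\<close>
      moreover have "M * (c - ?c) div phi e m i b \<noteq> 0"
        using y False by (auto simp: part_def Let_def)
      then have pos: "phi e m i b \<noteq> 0" "c - ?c \<noteq> 0"
        by - (rule notI, simp only: div_by_0 mult_0_right div_0 simp_thms)+
      have "eps e m i b = 0" using core_phi_eps(2)[OF b assms(2), of i] pos(1) by simp
      then have "?c = ?p" using pos(2) by auto
      then have x': "x \<in> set (blocks e m i M ?p r)" using x by (simp only:)
      have "bump e m i b \<le> x"
        by (rule blocks_full_ge[OF _ assms(2,3) _ x']) (use Cons.prems in simp_all)
      ultimately show ?thesis by simp
    qed (use bx in simp)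
  qed
  ultimately show ?case by (simp add: Let_def sorted_wrt_append)
qed simp

lemma last_part:
  assumes "max 1 (phi e m i b) dvd M" "M > 0" "d \<le> phi e m i b" "is_core e m b" "e \<ge> 2"
  shows "part e m i M d b \<noteq> []" "last (part e m i M d b) = (if d = phi e m i b then bump e m i b else b)"
proof -
  let ?n = "phi e m i b" let ?k = "M * d div ?n"
  have "part e m i M d b \<noteq> [] \<and> last (part e m i M d b) = (if d = ?n then bump e m i b else b)"
  proof (cases "?n = 0")
    case True
    then show ?thesis using assms(2,3) bump_trivial[OF assms(4,5) True] by (simp add: part_def)
  next
    case n: False
    show ?thesis
    proof (cases "d = ?n")
      case True
      then show ?thesis using n assms(2) by (simp add: part_def)
    next
      case False
      then have "M * d < M * ?n" using assms(2,3) by simp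
      then have "?k < M" using n by (simp add: div_less_iff_less_mult)
      then show ?thesis using False by (simp add: part_def Let_def)
    qed
  qed
  then show "part e m i M d b \<noteq> []" "last (part e m i M d b) = (if d = ?n then bump e m i b else b)" by auto
qed

text \<open>Induction along the operators, with the number of factors multiplied by \<open>K\<close>
  in each step. Per unit there are \<open>N * phi e m i l\<close> letters, of which \<open>N\<close>
  are used, beginning with the first factors. For \<open>phi = 1\<close> all are used and the last
  core advances completely; for larger \<open>phi\<close> some letter of the last core remains,
  unless it has none. This is the rule of \<open>attach_beads_f_op\<close>. The order of the list is
  recorded to keep equal cores adjacent.\<close>

lemma amplify_stable:
  assumes "l \<in> restricted_partitions e" "e \<ge> 2"
  shows "\<exists>bs. bs \<noteq> [] \<and> (\<forall>b\<in>set bs. is_core e m b) \<and> sorted_wrt (\<ge>) bs \<and>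
    (\<forall>t\<ge>1. amplify e m (t * length bs) l = stretch t bs) \<and> beta m (last bs) = attach_beads e m l"
  using assms
proof (induction l rule: restricted_induct[where m = m])
  case empty
  have "is_core e m empty_partition"
    by (simp add: is_core_iff beta_empty core_lessThan is_partition_empty)
  moreover have "beta m empty_partition = attach_beads e m empty_partition"
    using beta_empty[of m] by (simp add: attach_beads_def rows_def empty_partition_def)
  ultimately show ?case
    by (intro exI[of _ "[empty_partition]"]) (simp add: amplify_empty[OF assms(2)])
next
  case (f_op l i l')
  obtain bs where bs: "bs \<noteq> []" "\<forall>b\<in>set bs. is_core e m b" "sorted_wrt (\<ge>) bs"
    "\<And>t. t \<ge> 1 \<Longrightarrow> amplify e m (t * length bs) l = stretch t bs" "beta m (last bs) = attach_beads e m l"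
    using f_op.IH by blast
  have lp: "is_partition l" by (rule restricted_is_partition[OF f_op.hyps(1)])
  define N r where "N = length bs" and "r = rev bs"
  \<comment> \<open>A common multiple of all nonzero \<open>phi\<close>, so that every block splits
    into whole copies.\<close>
  define K where "K = (\<Prod>b\<in>set bs. max 1 (phi e m i b))"
  have K: "K > 0" "\<forall>b\<in>set r. max 1 (phi e m i b) dvd K"
    by (auto simp: K_def r_def intro!: prod_pos dvd_prodI)
  have N: "N > 0" using bs(1) by (simp add: N_def)
  have total: "phi_tensor e m i (rev r) = N * phi e m i l"
    using amplify_counts(1)[OF assms(2) f_op.hyps(1), of m i N] bs(4)[of 1] by (simp add: r_def N_def stretch_1[simplified])
  have phi0: "phi e m i l \<noteq> 0" using f_op.hyps(2) f_op_eq_None[of e m i l] by simp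
  have Nle: "N \<le> phi_tensor e m i (rev r)" using total phi0 by simp
  define bs' where "bs' = blocks e m i K N r"
  have cores: "\<forall>b\<in>set r. is_core e m b" using bs(2) by (simp add: r_def)
  have amp: "amplify e m (t * (K * N)) l' = stretch t bs'" if "t \<ge> 1" for t
  proof -
    have "iter (f_tensor e m i) (t * K * N) (amplify e m (t * K * N) l) = Some (amplify e m (t * K * N) l')"
      by (rule amplify_f_op[OF assms(2) f_op.hyps(1,2)])
    moreover have "amplify e m (t * K * N) l = stretch (t * K) (rev r)"
      using bs(4)[of "t * K"] that K(1) by (simp add: N_def r_def)
    moreover have "iter (f_tensor e m i) (t * K * N) (stretch (t * K) (rev r)) = Some (blocks e m i (t * K) N r)"
      by (rule iter_blocks[OF _ assms(2) Nle]) (use cores K(2) in auto)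
    ultimately show ?thesis using stretch_blocks[OF K(2), of t N] by (simp add: bs'_def mult.assoc)
  qed
  have len: "length bs' = K * N"
  proof -
    have "amplify e m (K * N) l' \<in> tensor_power e (K * N)"
      using amplify_component[OF f_op.hyps(3) assms(2)] by blast
    then show ?thesis using amp[of 1] by (simp add: tensor_power_def stretch_1[simplified])
  qed
  obtain b r' where r: "r = b # r'" using bs(1) by (cases r) (auto simp: r_def)
  let ?c = "min N (phi_tensor e m i (rev r') - eps e m i b)"
  have b: "is_core e m b" "max 1 (phi e m i b) dvd K" "last bs = b"
  proof -
    have "bs = rev r' @ [b]" using r unfolding r_def by (metis rev.simps(2) rev_rev_ident)
    then show "last bs = b" by simp
  qed (use cores K(2) r in auto)
  have tot: "N * phi e m i l = phi e m i b + (phi_tensor e m i (rev r') - eps e m i b)"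
    using total tensor_append(1)[of e m i "rev r'" "[b]"] by (simp add: r)
  have Nphi: "N \<le> N * phi e m i l" using phi0 by simp
  have dle: "N - ?c \<le> phi e m i b" using tot Nphi by auto
  note lst = last_part[OF b(2) K(1) dle b(1) assms(2)]
  have last_bs': "last bs' = (if N - ?c = phi e m i b then bump e m i b else b)" "bs' \<noteq> []"
    using lst by (simp_all add: bs'_def r Let_def)
  have "beta m (last bs') = attach_beads e m l'"
  proof (cases "2 \<le> phi e m i l")
    case True
    \<comment> \<open>If a last core with \<open>phi > 0\<close> advanced completely,
      \<open>N\<close> steps would exhaust at least \<open>2 * N\<close> letters.\<close>
    then have "N * 2 \<le> N * phi e m i l" by (rule mult_le_mono2)
    then have "N - ?c = phi e m i b \<Longrightarrow> phi e m i b = 0" using tot N by auto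
    then have "last bs' = b" using last_bs'(1) bump_trivial[OF b(1) assms(2)] by auto
    then show ?thesis using bs(5) b(3) attach_beads_f_op(2)[OF lp assms(2) f_op.hyps(2)] True by simp
  next
    case False
    then have "phi e m i l = 1" using phi0 by simp
    then have "N - ?c = phi e m i b" using tot by auto
    then have "beta m (last bs') = add_all e i (beta m b)"
      using last_bs'(1) beta_bump[of b e m i] b(1) assms(2) by (simp add: is_core_iff)
    then show ?thesis using bs(5) b(3) attach_beads_f_op(2)[OF lp assms(2) f_op.hyps(2)] False by simp
  qed
  moreover have "\<forall>x\<in>set bs'. is_core e m x"
    using set_blocks[of _ e m i K N r] cores bump_core[OF _ assms(2)] unfolding bs'_def by blast
  moreover have "sorted_wrt (\<ge>) bs'" unfolding bs'_def
    by (rule sorted_blocks[OF cores assms(2) K(1)]) (use bs(3) in \<open>simp add: r_def sorted_wrt_rev\<close>)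
  ultimately show ?case using amp last_bs'(2) len by (intro exI[of _ bs']) simp
qed

section \<open>From decreasing lists of cores to the stable form\<close>

lemma sorted_runs:
  fixes xs :: "'a::order list"
  assumes "sorted_wrt (\<ge>) xs" "xs \<noteq> []"
  shows "\<exists>rs. rs \<noteq> [] \<and> xs = concat (map (\<lambda>(v, k). replicate k v) rs) \<and> (\<forall>(v, k)\<in>set rs. k > 0) \<and>
    sorted_wrt (\<lambda>p q. fst q < fst p) rs"
  using assms
proof (induction xs)
  case (Cons x xs)
  show ?case
  proof (cases "xs = []")
    case True
    then show ?thesis by (intro exI[of _ "[(x, 1)]"]) simp
  next
    case False
    then obtain rs where rs: "rs \<noteq> []" "xs = concat (map (\<lambda>(v, k). replicate k v) rs)"
      "\<forall>(v, k)\<in>set rs. k > 0" "sorted_wrt (\<lambda>p q. fst q < fst p) rs"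
      using Cons by auto
    then obtain v k rs' where rs': "rs = (v, k) # rs'" by (cases rs) auto
    have k: "k > 0" using rs(3) by (simp add: rs')
    then have "v \<in> set xs" by (simp add: rs(2) rs')
    then have vx: "v \<le> x" using Cons.prems(1) by simp
    show ?thesis
    proof (cases "v = x")
      case True
      then show ?thesis using rs by (intro exI[of _ "(v, Suc k) # rs'"]) (simp add: rs')
    next
      case False
      then have "v < x" using vx by simp
      then show ?thesis using rs by (intro exI[of _ "(x, 1) # rs"]) (auto simp: rs')
    qed
  qed
qed simp

lemma stable_form_exists:
  assumes "l \<in> restricted_partitions e" "e \<ge> 2" "bs \<noteq> []" "\<forall>b\<in>set bs. is_core e m b"
    "sorted_wrt (\<ge>) bs" "\<And>t. t \<ge> 1 \<Longrightarrow> amplify e m (t * length bs) l = stretch t bs"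
  shows "\<exists>s a \<nu>. stable_form e m l s a \<nu> \<and> last bs = \<nu> s"
proof -
  obtain rs where rs: "rs \<noteq> []" "bs = concat (map (\<lambda>(v, k). replicate k v) rs)"
    "\<forall>(v, k)\<in>set rs. k > 0" "sorted_wrt (\<lambda>p q. fst q < fst p) rs"
    using sorted_runs[OF assms(5,3)] by blast
  define s where "s = length rs"
  \<comment> \<open>The relative positions of the ends of the runs.\<close>
  define a :: "nat \<Rightarrow> rat" where "a = (\<lambda>k. of_nat (\<Sum>p\<leftarrow>take k rs. snd p) / of_nat (length bs))"
  define \<nu> where "\<nu> = (\<lambda>k. fst (rs ! (k - 1)))"
  have pos: "snd (rs ! k) > 0" if "k < s" for k
    using rs(3)[unfolded case_prod_unfold] that nth_mem[of k rs] by (simp add: s_def)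
  have N: "length bs > 0" using assms(3) by simp
  have len: "length bs = (\<Sum>p\<leftarrow>rs. snd p)"
    unfolding rs(2) by (simp add: length_concat comp_def case_prod_unfold)
  have step: "a (Suc k) = a k + of_nat (snd (rs ! k)) / of_nat (length bs)" if "k < s" for k
    using that by (simp add: a_def s_def take_Suc_conv_app_nth add_divide_distrib)
  have last: "last bs = \<nu> s"
  proof -
    obtain v k where vk: "last rs = (v, k)" by fastforce
    have rsd: "butlast rs @ [(v, k)] = rs" using append_butlast_last_id[OF rs(1)] vk by simp
    have "bs = concat (map (\<lambda>(v, k). replicate k v) (butlast rs @ [(v, k)]))"
      unfolding rsd by (rule rs(2))
    moreover have "k > 0"
      using bspec[OF rs(3)[unfolded case_prod_unfold] last_in_set[OF rs(1)]] vk by simp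
    ultimately have "last bs = v" by simp
    moreover have "\<nu> s = fst (last rs)" using last_conv_nth[OF rs(1)] by (simp add: \<nu>_def s_def)
    ultimately show ?thesis using vk by simp
  qed
  have core: "is_core e m (\<nu> k)" if "k \<in> {1..s}" for k
  proof -
    have mem: "rs ! (k - 1) \<in> set rs" using that by (auto simp: s_def)
    have "k - 1 < s" using that by auto
    then have "\<nu> k \<in> set (case rs ! (k - 1) of (v, k) \<Rightarrow> replicate k v)"
      using pos[of "k - 1"] by (simp add: case_prod_unfold \<nu>_def)
    then have "\<nu> k \<in> set bs" unfolding rs(2) set_concat set_map by (rule UN_I[OF imageI[OF mem]])
    then show ?thesis using assms(4) by blast
  qed
  have inj: "inj_on \<nu> {1..s}"
  proof (rule linorder_inj_onI)
    fix j k assume "j < k" "j \<in> {1..s}" "k \<in> {1..s}"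
    then have "fst (rs ! (k - 1)) < fst (rs ! (j - 1))"
      using sorted_wrt_nth_less[OF rs(4), of "j - 1" "k - 1"] by (simp add: s_def)
    then show "\<nu> j \<noteq> \<nu> k" by (auto simp: \<nu>_def)
  qed auto
  have form: "S_map e m h l = concat (map (\<lambda>k. replicate (t * snd (rs ! (k - 1))) (\<nu> k)) [1..<Suc s])"
    if "h = t * length bs" "t \<ge> 1" for h t
  proof -
    have "S_map e m h l = stretch t bs"
      using S_map_eq[OF assms(2) _ assms(1), of h m] assms(6)[OF that(2)] that N by simp
    also have "\<dots> = concat (map (\<lambda>p. replicate (t * snd p) (fst p)) rs)"
      unfolding rs(2) by (induction rs) (auto simp: case_prod_unfold)
    also have "map (\<lambda>p. replicate (t * snd p) (fst p)) rs =
        map (\<lambda>k. replicate (t * snd (rs ! (k - 1))) (\<nu> k)) [1..<Suc s]"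
      by (rule nth_equalityI) (simp_all add: s_def \<nu>_def del: upt_Suc)
    finally show ?thesis .
  qed
  have "stable_form e m l s a \<nu>"
    unfolding stable_form_def
  proof (intro conjI)
    show "1 \<le> s" using rs(1) by (simp add: s_def Suc_le_eq)
    show "a 0 = 0" by (simp add: a_def)
    have "(\<Sum>p\<leftarrow>take s rs. snd p) = length bs" unfolding len by (simp add: s_def)
    then show "a s = 1" using N by (simp add: a_def)
    show "\<forall>k<s. a k < a (Suc k)" using step pos N by simp
    show "inj_on \<nu> {1..s}" by (rule inj)
    show "\<forall>k\<in>{1..s}. is_core e m (\<nu> k)" using core by blast
    show "\<exists>N\<ge>1. \<forall>h\<ge>1. N dvd h \<longrightarrow> (\<exists>n :: nat \<Rightarrow> nat.
        (\<forall>k\<in>{1..s}. of_nat (n k) = (a k - a (k - 1)) * of_nat h) \<and>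
        S_map e m h l = concat (map (\<lambda>k. replicate (n k) (\<nu> k)) [1..<Suc s]))"
    proof (intro exI[of _ "length bs"] conjI allI impI)
      show "1 \<le> length bs" using N by linarith
      fix h :: nat assume h: "1 \<le> h" "length bs dvd h"
      then obtain t where t: "h = t * length bs" by (metis dvd_def mult.commute)
      then have t1: "t \<ge> 1" using h(1) by (cases t) auto
      have "of_nat (t * snd (rs ! (k - 1))) = (a k - a (k - 1)) * (of_nat h :: rat)" if "k \<in> {1..s}" for k
      proof -
        have "a k - a (k - 1) = of_nat (snd (rs ! (k - 1))) / of_nat (length bs)"
        proof -
          have "Suc (k - 1) = k" "k - 1 < s" using that by auto
          then show ?thesis using step[of "k - 1"] by simp
        qed
        then show ?thesis using N t by simp
      qed
      then show "\<exists>n :: nat \<Rightarrow> nat. (\<forall>k\<in>{1..s}. of_nat (n k) = (a k - a (k - 1)) * of_nat h) \<and>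
          S_map e m h l = concat (map (\<lambda>k. replicate (n k) (\<nu> k)) [1..<Suc s])"
        using form[OF t t1] by (intro exI[of _ "\<lambda>k. t * snd (rs ! (k - 1))"] conjI ballI)
    qed
  qed
  then show ?thesis using last by blast
qed

text \<open>At a common multiple both descriptions give the same list. Its last entry is
  \<open>\<nu> s\<close>, because the strict increase of \<open>a\<close> makes the last
  multiplicity positive.\<close>

lemma stable_form_last:
  assumes "l \<in> restricted_partitions e" "e \<ge> 2" "bs \<noteq> []"
    "\<And>t. t \<ge> 1 \<Longrightarrow> amplify e m (t * length bs) l = stretch t bs" "stable_form e m l s a \<nu>"
  shows "\<nu> s = last bs"
proof -
  obtain N where N: "N \<ge> 1" "\<And>h. h \<ge> 1 \<Longrightarrow> N dvd h \<Longrightarrow> \<exists>n :: nat \<Rightarrow> nat.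
      (\<forall>k\<in>{1..s}. of_nat (n k) = (a k - a (k - 1)) * of_nat h) \<and>
      S_map e m h l = concat (map (\<lambda>k. replicate (n k) (\<nu> k)) [1..<Suc s])"
    and s: "1 \<le> s" "\<forall>k<s. a k < a (Suc k)"
    using assms(5) unfolding stable_form_def by blast
  let ?h = "N * length bs"
  have h: "?h \<ge> 1" using N(1) assms(3) by (simp add: Suc_le_eq)
  obtain n where n: "\<forall>k\<in>{1..s}. of_nat (n k) = (a k - a (k - 1)) * of_nat ?h"
    "S_map e m ?h l = concat (map (\<lambda>k. replicate (n k) (\<nu> k)) [1..<Suc s])"
    using N(2)[OF h] by auto
  have "a (s - 1) < a s" using s(2)[rule_format, of "s - 1"] s(1) by simp
  moreover have "?h > 0" using h by linarith
  then have "(of_nat ?h :: rat) > 0" by (simp only: of_nat_0_less_iff)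
  ultimately have "(a s - a (s - 1)) * of_nat ?h > 0" by (intro mult_pos_pos) auto
  then have "(of_nat (n s) :: rat) > 0" using n(1) s(1) by simp
  then have ns: "n s > 0" by simp
  have "[1..<Suc s] = [1..<s] @ [s]" using s(1) by simp
  then have "last (S_map e m ?h l) = \<nu> s" using ns unfolding n(2) by simp
  moreover have "S_map e m ?h l = stretch N bs"
    using S_map_eq[OF assms(2) h assms(1)] assms(4)[OF N(1)] by simp
  moreover have "last (stretch N bs) = last bs"
  proof -
    have "bs = butlast bs @ [last bs]" using assms(3) by simp
    then have "stretch N bs = stretch N (butlast bs) @ replicate N (last bs)"
      by (metis append_Nil2 stretch_simps(1,2,3))
    then show ?thesis using N(1) by simp
  qed
  ultimately show ?thesis by simp
qed

theorem corollary8p5: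
  fixes e :: nat and m :: int and l :: "nat \<Rightarrow> nat"
  assumes "e \<ge> 2"
    and "l \<in> restricted_partitions e"
  shows "partition_base e m l = partition_floor e m l"
proof -
  obtain bs where bs: "bs \<noteq> []" "\<forall>b\<in>set bs. is_core e m b" "sorted_wrt (\<ge>) bs"
    "\<And>t. t \<ge> 1 \<Longrightarrow> amplify e m (t * length bs) l = stretch t bs" "beta m (last bs) = attach_beads e m l"
    using amplify_stable[OF assms(2,1), of m] by blast
  have "is_partition (last bs)" using bs(1,2) by (simp add: is_core_def)
  then have "partition_of_beta m (beta m (last bs)) = last bs"
    unfolding partition_of_beta_def using beta_inj by (intro the_equality) blast+
  moreover have "beta m (last bs) = beta_base e (beta m l)"
    using beta_base_partition[OF assms(2), of m] bs(5) assms(1) by simp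
  moreover have "partition_floor e m l = last bs"
    unfolding partition_floor_def
  proof (rule the_equality)
    show "\<exists>s a \<nu>. stable_form e m l s a \<nu> \<and> last bs = \<nu> s"
      by (rule stable_form_exists[OF assms(2,1) bs(1-4)])
    fix c assume "\<exists>s a \<nu>. stable_form e m l s a \<nu> \<and> c = \<nu> s"
    then show "c = last bs" using stable_form_last[OF assms(2,1) bs(1,4)] by blast
  qed
  ultimately show ?thesis by (simp add: partition_base_def)
qed

end
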